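(* Let $M$ be the Hardy--Littlewood maximal operator on $\mathbb{R}^n$, and let $u\in A_1$ and $v\in A_\infty$ be weights on $\mathbb{R}^n$. Then there is a finite constant $c$, depending (besides the dimension $n$) only on the $A_1$ constant of $u$ and the $A_\infty$ constant of $v$, such that for every $f\in L^1(uv)$ $$\Big\|\frac{M(fv)}{v}\Big\|_{L^{1,\infty}(uv)}\le c\,\|f\|_{L^1(uv)}.$$
   Context: A weight is a non-negative locally integrable function on $\mathbb{R}^n$, positive a.e. $Mf(x)=\sup_{Q\ni x}\frac1{|Q|}\int_Q|f|$, the supremum over cubes $Q$ with sides parallel to the axes. $u\in A_1$ means $[u]_{A_1}=\operatorname{ess\,sup}_x Mu(x)/u(x)<\infty$ (the $A_1$ constant). For $1<p<\infty$, $v\in A_p$ means $[v]_{A_p}=\sup_Q\big(\frac1{|Q|}\int_Q v\big)\big(\frac1{|Q|}\int_Q v^{-1/(p-1)}\big)^{p-1}<\infty$, and $A_\infty=\bigcup_{p>1}A_p$. The $A_\infty$ constant is $[v]_{A_\infty}=\sup_Q \frac{1}{v(Q)}\int_Q M(v\chi_Q)\,dx$ (finite if and only if $v\in A_\infty$). The product $uv$ need not be locally integrable; $uv$ also denotes the measure $u(x)v(x)\,dx$, $\|f\|_{L^1(uv)}=\int_{\mathbb{R}^n}|f|uv\,dx$ and $\|h\|_{L^{1,\infty}(uv)}=\sup_{t>0}t\,(uv)(\{x:|h(x)|>t\})$. *)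

theory Defs
  imports "HOL-Probability.Essential_Supremum"
begin

definition cubes :: "(real ^ 'n) set set" where
  "cubes = {cbox a (\<chi> i. a $ i + l) | a l. 0 < l}"

definition avg :: "(real ^ 'n) set \<Rightarrow> (real ^ 'n \<Rightarrow> real) \<Rightarrow> ennreal" where
  "avg Q g = (\<integral>\<^sup>+y\<in>Q. ennreal (g y) \<partial>lebesgue) / emeasure lebesgue Q"

definition maximal :: "(real ^ 'n \<Rightarrow> real) \<Rightarrow> real ^ 'n \<Rightarrow> ennreal" where
  "maximal f x = (SUP Q\<in>{Q \<in> cubes. x \<in> Q}. avg Q (\<lambda>y. \<bar>f y\<bar>))"

definition locally_integrable :: "(real ^ 'n \<Rightarrow> real) \<Rightarrow> bool" where
  "locally_integrable f \<longleftrightarrow> (\<forall>K. compact K \<longrightarrow> set_integrable lebesgue K f)"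

definition weight :: "(real ^ 'n \<Rightarrow> real) \<Rightarrow> bool" where
  "weight w \<longleftrightarrow> (\<forall>x. 0 \<le> w x) \<and> locally_integrable w \<and> (AE x in lebesgue. 0 < w x)"

text \<open>Weights may vanish on a null set. There the quotients below take the conventional
  values of division by zero in \<^typ>\<open>ennreal\<close> (and \<open>0 powr a = 0\<close>), which affects neither
  essential suprema nor integrals.\<close>

definition A1_const :: "(real ^ 'n \<Rightarrow> real) \<Rightarrow> ennreal" where
  "A1_const u = esssup lebesgue (\<lambda>x. maximal u x / ennreal (u x))"

definition A1 :: "(real ^ 'n \<Rightarrow> real) set" where
  "A1 = {u. weight u \<and> A1_const u < \<infinity>}"

text \<open>Real powers of extended non-negative numbers, for exponents \<open>a > 0\<close>.\<close>

definition ennreal_pow :: "ennreal \<Rightarrow> real \<Rightarrow> ennreal" where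
  "ennreal_pow x a = (if x = \<infinity> then \<infinity> else ennreal (enn2real x powr a))"

definition Ap_const :: "real \<Rightarrow> (real ^ 'n \<Rightarrow> real) \<Rightarrow> ennreal" where
  "Ap_const p v =
     (SUP Q\<in>cubes. avg Q v * ennreal_pow (avg Q (\<lambda>x. v x powr (- 1 / (p - 1)))) (p - 1))"

definition Ap :: "real \<Rightarrow> (real ^ 'n \<Rightarrow> real) set" where
  "Ap p = {v. weight v \<and> Ap_const p v < \<infinity>}"

definition Ainf :: "(real ^ 'n \<Rightarrow> real) set" where
  "Ainf = (\<Union>p\<in>{1<..}. Ap p)"

definition Ainf_const :: "(real ^ 'n \<Rightarrow> real) \<Rightarrow> ennreal" where
  "Ainf_const v =
     (SUP Q\<in>cubes. (\<integral>\<^sup>+x\<in>Q. maximal (\<lambda>y. v y * indicator Q y) x \<partial>lebesgue)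
                     / (\<integral>\<^sup>+x\<in>Q. ennreal (v x) \<partial>lebesgue))"

definition weighted :: "(real ^ 'n \<Rightarrow> real) \<Rightarrow> (real ^ 'n) measure" where
  "weighted w = density lebesgue (\<lambda>x. ennreal (w x))"

definition L1_norm :: "'a measure \<Rightarrow> ('a \<Rightarrow> real) \<Rightarrow> ennreal" where
  "L1_norm \<mu> f = (\<integral>\<^sup>+x. ennreal \<bar>f x\<bar> \<partial>\<mu>)"

text \<open>The weak \<open>L\<^sup>1\<close> quasi-norm, for functions with values in \<open>[0, \<infinity>]\<close>.\<close>

definition weak_L1_norm :: "'a measure \<Rightarrow> ('a \<Rightarrow> ennreal) \<Rightarrow> ennreal" where
  "weak_L1_norm \<mu> h = (SUP t\<in>{0<..}. ennreal t * emeasure \<mu> {x \<in> space \<mu>. h x > ennreal t})"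

end

theory Submission
  imports Defs
begin

text \<open>Write \<open>g = \<bar>f\<bar> v\<close> and cut \<open>{M g > v}\<close> along the layers \<open>W\<^sub>k = {\<beta> ^ k < v \<le> \<beta> ^ (k + 1)}\<close>. On \<open>W\<^sub>k\<close> one
  has \<open>M g > \<beta> ^ k\<close>, so this part is covered by the triples of the maximal dyadic cubes \<open>I\<close> on which the
  average of \<open>g\<close> exceeds \<open>4 ^ (-n) \<beta> ^ k\<close>. Sort the pairs \<open>(k, I)\<close> by the integer \<open>l\<close> for which the average of
  \<open>v\<close> over \<open>I\<close> is about \<open>2 ^ l \<beta> ^ k\<close>. When \<open>\<bar>l\<bar>\<close> is large, \<open>W\<^sub>k\<close> fills only an exponentially small part of
  the triple of \<open>I\<close>, because \<open>v\<close> is an \<open>A\<^sub>\<infinity>\<close> weight, and this remains true for the measure \<open>u dx\<close>, because \<open>u\<close>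
  is an \<open>A\<^sub>1\<close> weight. So it suffices to bound the sum of \<open>\<beta> ^ k u(I)\<close> over the pairs with a fixed \<open>l\<close> by the
  integral of \<open>g u\<close>, uniformly in \<open>l\<close>. For fixed \<open>l\<close> the averages of \<open>v\<close> grow geometrically along nested cubes,
  hence the cubes are sparse with respect to \<open>v dx\<close>. Among the cubes whose \<open>u\<close>-average is about \<open>2 ^ m\<close>,
  sparseness leaves only the maximal ones, whose contribution is at most a multiple of \<open>2 ^ m\<close> times
  the integral of \<open>g\<close> over their union. Finally, the sum of \<open>2 ^ m\<close> over all \<open>m\<close> whose union contains \<open>x\<close> is at
  most \<open>2 M u(x)\<close>, which is at most a multiple of \<open>u(x)\<close>.\<close>

section \<open>Dyadic grids\<close>

text \<open>The measure \<open>u v dx\<close> need be neither doubling nor locally finite, so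
  covering arguments cannot be run in it directly. The layers avoid this: on
  \<open>W\<^sub>k\<close> the measure \<open>u v dx\<close> is comparable to
  \<open>\<beta> ^ k u dx\<close>, and stopping cubes are measured only by \<open>dx\<close>,
  \<open>u dx\<close>, \<open>v dx\<close> and \<open>g dx\<close>. The base \<beta> is at least
  \<open>2 / \<delta>\<close>, where \<delta> is the volume fraction in the
  \<open>A\<^sub>\<infinity>\<close> condition of \<open>v\<close>; smaller cubes with the same
  \<open>l\<close> then fill at most the fraction \<delta> of a cube.

  The constant may see \<open>v\<close> only through the Fujii-Wilson constant. That constant is
  turned into a pair (\<delta>, \<theta>), and an iteration over dyadic cells takes the place of the
  reverse Hoelder inequality to produce power decay with constants that depend on this pair alone.
  Since \<open>c\<close> is real-valued, it must also be shown that every \<open>A\<^sub>p\<close>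
  weight has a finite Fujii-Wilson constant. Finally, maximal cubes are obtained from finite total
  mass, while \<open>\<bar>f\<bar> v\<close> need not be integrable; it is truncated to growing
  cubes, on each of which \<open>u\<close> is bounded below.\<close>

abbreviation vol :: "(real ^ 'n) set \<Rightarrow> ennreal" where
  "vol \<equiv> emeasure lebesgue"

abbreviation closed_cube :: "real ^ 'n \<Rightarrow> real \<Rightarrow> (real ^ 'n) set" where
  "closed_cube a l \<equiv> cbox a (\<chi> i. a $ i + l)"

text \<open>Half-open, so that dyadic cells tile space exactly. The closed cubes in the definition
  of the maximal function differ from these by null sets and have the same mass for every absolutely
  continuous measure.\<close>

definition hcube :: "real ^ 'n \<Rightarrow> real \<Rightarrow> (real ^ 'n) set" where
  "hcube a l = {y. \<forall>i. a $ i \<le> y $ i \<and> y $ i < a $ i + l}"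

text \<open>The cell of generation \<open>m\<close> around \<open>x\<close> is described by the
  integer labels of its points, which reduces nesting and countability to arithmetic of floors.
  Origin \<open>p\<close> and unit \<open>s\<close> are free, so any given half-open cube can serve
  as the root \<open>cell p s 0 p\<close> of its own grid.\<close>

definition cell :: "real ^ 'n \<Rightarrow> real \<Rightarrow> int \<Rightarrow> real ^ 'n \<Rightarrow> (real ^ 'n) set" where
  "cell p s m x =
    {y. \<forall>i. \<lfloor>(y $ i - p $ i) / (s * 2 powi m)\<rfloor> = \<lfloor>(x $ i - p $ i) / (s * 2 powi m)\<rfloor>}"

definition grid :: "real ^ 'n \<Rightarrow> real \<Rightarrow> (real ^ 'n) set set" where
  "grid p s = {cell p s m x | m x. True}"

text \<open>For a half-open cube \<open>I\<close> this is the open concentric cube with three times the side.\<close>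

definition triple :: "(real ^ 'n) set \<Rightarrow> (real ^ 'n) set" where
  "triple I = {x + y - z | x y z. x \<in> I \<and> y \<in> I \<and> z \<in> I}"

lemma triple_mono: "I \<subseteq> J \<Longrightarrow> triple I \<subseteq> triple J"
  unfolding triple_def by blast

lemma box_subset_hcube: "box a (\<chi> i. a $ i + l) \<subseteq> hcube a l"
  by (auto simp: hcube_def mem_box_cart less_imp_le)

lemma hcube_subset_cbox: "hcube a l \<subseteq> closed_cube a l"
  by (auto simp: hcube_def mem_box_cart less_imp_le)

lemma hcube_borel [measurable]: "hcube a l \<in> sets borel"
proof -
  have "hcube a l = (\<Inter>i. {y. a $ i \<le> y $ i} \<inter> {y. y $ i < a $ i + l})"
    by (auto simp: hcube_def)
  also have "\<dots> \<in> sets borel"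
    by (intro sets.countable_INT'' sets.Int borel_closed borel_open
        closed_Collect_le open_Collect_less continuous_intros) auto
  finally show ?thesis .
qed

lemma hcube_lebesgue [measurable]: "hcube a l \<in> sets lebesgue"
  using hcube_borel[of a l] by (simp add: sets_completionI_sets)

lemma emeasure_lebesgue_cbox_cube:
  fixes a :: "real ^ 'n"
  assumes "0 \<le> l"
  shows "vol (closed_cube a l) = ennreal (l ^ CARD('n))"
proof -
  have "measure lborel (closed_cube a l) = l ^ CARD('n)"
    using assms by (subst content_cbox_if_cart) (auto simp: interval_eq_empty_cart not_less)
  then show ?thesis
    using emeasure_lborel_cbox_finite[of a "\<chi> i. a $ i + l"]
    by (simp add: emeasure_eq_ennreal_measure less_top)
qed

lemma cbox_diff_hcube_null:
  "closed_cube a l - hcube a l \<in> null_sets lebesgue"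
proof (rule null_sets_subset[rotated])
  show "closed_cube a l - hcube a l \<subseteq> closed_cube a l - box a (\<chi> i. a $ i + l)"
    using box_subset_hcube by blast
  show "closed_cube a l - box a (\<chi> i. a $ i + l) \<in> null_sets lebesgue"
    using negligible_frontier_interval negligible_iff_null_sets by blast
  show "closed_cube a l - hcube a l \<in> sets lebesgue"
    by (intro sets.Diff) auto
qed

lemma emeasure_hcube_cbox:
  assumes "absolutely_continuous lebesgue N" "sets N = sets lebesgue"
  shows "emeasure N (hcube a l) = emeasure N (closed_cube a l)"
proof -
  have null: "closed_cube a l - hcube a l \<in> null_sets N"
    using assms cbox_diff_hcube_null unfolding absolutely_continuous_def by blast
  have "closed_cube a l = hcube a l \<union> (closed_cube a l - hcube a l)"
    using hcube_subset_cbox by blast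
  then show ?thesis
    using emeasure_Un_null_set[OF _ null, of "hcube a l"] assms(2) by simp
qed

lemma emeasure_lebesgue_hcube:
  fixes a :: "real ^ 'n"
  assumes "0 \<le> l"
  shows "vol (hcube a l) = ennreal (l ^ CARD('n))"
  using emeasure_hcube_cbox[of lebesgue a l] emeasure_lebesgue_cbox_cube[OF assms]
  by (simp add: absolutely_continuous_def)

lemma cell_self [simp]: "x \<in> cell p s m x"
  by (simp add: cell_def)

lemma cell_eq: "y \<in> cell p s m x \<Longrightarrow> cell p s m y = cell p s m x"
  by (auto simp: cell_def)

text \<open>The label at a coarser scale is the integer quotient of the finer label by a power of
  2.\<close>

lemma cell_mono:
  assumes "m \<le> m'"
  shows "cell p s m x \<subseteq> cell p s m' x"
proof
  fix y assume y: "y \<in> cell p s m x"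
  define q where "q = nat (m' - m)"
  have m': "m' = m + int q" using assms by (simp add: q_def)
  have "\<lfloor>(z $ i - p $ i) / (s * 2 powi m')\<rfloor> = \<lfloor>(z $ i - p $ i) / (s * 2 powi m)\<rfloor> div 2 ^ q" for z i
  proof -
    have "(z $ i - p $ i) / (s * 2 powi m') = (z $ i - p $ i) / (s * 2 powi m) / real_of_int (2 ^ q)"
      by (simp add: m' power_int_add mult.assoc)
    then show ?thesis by (simp only: floor_divide_real_eq_div[of "2^q"] zero_le_power zero_le_numeral)
  qed
  then show "y \<in> cell p s m' x"
    using y by (simp add: cell_def)
qed

lemma cell_eq_hcube:
  assumes "0 < s"
  shows "cell p s m x =
    hcube (\<chi> i. p $ i + \<lfloor>(x $ i - p $ i) / (s * 2 powi m)\<rfloor> * (s * 2 powi m)) (s * 2 powi m)"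
proof -
  have pos: "0 < s * 2 powi m" using assms by simp
  have *: "\<lfloor>(t - c) / d\<rfloor> = k \<longleftrightarrow> c + k * d \<le> t \<and> t < c + k * d + d" if "0 < d" for t c d :: real and k :: int
    using that by (simp add: floor_eq_iff pos_le_divide_eq pos_divide_less_eq algebra_simps)
  show ?thesis unfolding cell_def hcube_def using *[OF pos] by simp
qed

lemma cell_hcubeE:
  assumes "0 < s"
  obtains a where "cell p s m x = hcube a (s * 2 powi m)"
  using cell_eq_hcube[OF assms] by blast

lemma gridE:
  assumes "I \<in> grid p s" "0 < s"
  obtains a l where "I = hcube a l" "0 < l"
proof -
  from assms obtain m x where "I = cell p s m x" unfolding grid_def by blast
  moreover obtain a where "cell p s m x = hcube a (s * 2 powi m)" using assms(2) by (rule cell_hcubeE)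
  ultimately show ?thesis using assms by (intro that[of a "s * 2 powi m"]) auto
qed

lemma cell_in_grid [simp]: "cell p s m x \<in> grid p s"
  unfolding grid_def by blast

lemma grid_as_cell: "I \<in> grid p s \<Longrightarrow> x \<in> I \<Longrightarrow> \<exists>m. I = cell p s m x"
  unfolding grid_def using cell_eq by blast

lemma grid_nonempty: "I \<in> grid p s \<Longrightarrow> \<exists>x. x \<in> I"
  unfolding grid_def using cell_self by blast

lemma grid_lebesgue: "I \<in> grid p s \<Longrightarrow> 0 < s \<Longrightarrow> I \<in> sets lebesgue"
  by (metis gridE hcube_lebesgue)

lemma grid_nested:
  assumes "I \<in> grid p s" "J \<in> grid p s" "I \<inter> J \<noteq> {}"
  shows "I \<subseteq> J \<or> J \<subseteq> I"
proof -
  from assms(3) obtain x where "x \<in> I" "x \<in> J" by blast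
  then obtain m m' where "I = cell p s m x" "J = cell p s m' x"
    using assms grid_as_cell by meson
  then show ?thesis using cell_mono[of m m' p s x] cell_mono[of m' m p s x] by (metis linear)
qed

lemma countable_grid: "countable (grid p s)"
proof -
  let ?g = "\<lambda>(m, z :: 'a \<Rightarrow> int). {y. \<forall>i. \<lfloor>(y $ i - p $ i) / (s * 2 powi m)\<rfloor> = z i}"
  have "grid p s \<subseteq> range ?g"
  proof
    fix I assume "I \<in> grid p s"
    then obtain m x where "I = cell p s m x" unfolding grid_def by blast
    then have "I = ?g (m, \<lambda>i. \<lfloor>(x $ i - p $ i) / (s * 2 powi m)\<rfloor>)"
      by (simp add: cell_def)
    then show "I \<in> range ?g" by blast
  qed
  then show ?thesis by (rule countable_subset) simp
qed

lemma hcube_eq_cell: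
  assumes "0 < s"
  shows "hcube p s = cell p s 0 p"
  using cell_eq_hcube[OF assms, of p 0 p] by (simp add: vec_eq_iff)

lemma hcube_in_grid: "0 < s \<Longrightarrow> hcube p s \<in> grid p s"
  by (simp add: hcube_eq_cell)

lemma emeasure_cell:
  fixes p :: "real ^ 'n"
  assumes "0 < s"
  shows "vol (cell p s m x) = ennreal ((s * 2 powi m) ^ CARD('n))"
  by (subst cell_eq_hcube[OF assms], subst emeasure_lebesgue_hcube) (use assms in auto)

lemma cell_subset_open:
  assumes "0 < s" "open U" "x \<in> U"
  shows "\<exists>m\<le>0. cell p s m x \<subseteq> U"
proof -
  from assms obtain e where e: "0 < e" "ball x e \<subseteq> U" using open_contains_ball by blast
  let ?n = "real CARD('a)"
  obtain q :: nat where q: "s * ?n / e < 2 ^ q" using real_arch_pow[of 2 "s * ?n / e"] by auto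
  define d where "d = s * 2 powi (- int q)"
  have d: "0 < d" "d * ?n < e"
    using q e assms by (simp_all add: d_def power_int_minus field_simps)
  have "cell p s (- int q) x \<subseteq> ball x e"
  proof
    fix y assume y: "y \<in> cell p s (- int q) x"
    obtain a where a: "cell p s (- int q) x = hcube a d"
      unfolding d_def using assms(1) by (rule cell_hcubeE)
    have "x \<in> hcube a d" "y \<in> hcube a d" using y a cell_self by blast+
    then have i: "\<bar>(x - y) $ i\<bar> \<le> d" for i
      unfolding hcube_def by (auto simp: abs_le_iff) (smt (verit))+
    have "norm (x - y) \<le> (\<Sum>i\<in>UNIV. \<bar>(x - y) $ i\<bar>)" by (rule norm_le_l1_cart)
    also have "\<dots> \<le> (\<Sum>i\<in>(UNIV :: 'a set). d)" by (intro sum_mono i)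
    also have "\<dots> < e" using d by (simp add: mult.commute)
    finally show "y \<in> ball x e" by (simp add: dist_norm)
  qed
  then show ?thesis using e by (intro exI[of _ "- int q"]) auto
qed

text \<open>The cells around one point of \<open>I\<close> form a chain indexed by the generation,
  and the volume bound caps the generations that occur in \<open>S\<close>.\<close>

lemma grid_maximal:
  fixes p :: "real ^ 'n"
  assumes s: "0 < s" and S: "S \<subseteq> grid p s" and B: "\<And>I. I \<in> S \<Longrightarrow> vol I \<le> ennreal B"
    and I: "I \<in> S"
  shows "\<exists>J\<in>S. I \<subseteq> J \<and> (\<forall>J'\<in>S. J \<subseteq> J' \<longrightarrow> J' = J)"
proof -
  obtain x where x: "x \<in> I" using I S grid_nonempty by blast
  let ?K = "{m. cell p s m x \<in> S}"
  obtain m0 where m0: "I = cell p s m0 x" using I S x grid_as_cell by blast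
  \<comment> \<open>The \<open>max 1\<close> makes an oversized side exceed 1, so its power is at
    least the side itself and volume can be compared with \<open>B\<close> without taking
    roots.\<close>
  obtain q :: nat where q: "max 1 B / s < 2 ^ q" using real_arch_pow[of 2 "max 1 B / s"] by auto
  have bound: "m \<le> int q" if "m \<in> ?K" for m
  proof (rule ccontr)
    assume "\<not> m \<le> int q"
    then have "(2::real) powi (int q) \<le> 2 powi m" by (intro power_int_increasing) auto
    then have "s * 2 ^ q \<le> s * 2 powi m" using s by simp
    moreover have "max 1 B < s * 2 ^ q" using q s by (simp add: field_simps)
    ultimately have 1: "max 1 B < s * 2 powi m" by linarith
    then have "s * 2 powi m \<le> (s * 2 powi m) ^ CARD('n)"
      by (intro self_le_power) auto
    then have "max 1 B < (s * 2 powi m) ^ CARD('n)" using 1 by linarith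
    moreover have "ennreal ((s * 2 powi m) ^ CARD('n)) \<le> ennreal (max 1 B)"
      using B[of "cell p s m x"] that emeasure_cell[OF s, of p m x]
      by (simp add: ennreal_leI order_trans[OF _ ennreal_leI[of B "max 1 B"]])
    ultimately show False by (subst (asm) ennreal_le_iff) auto
  qed
  have "\<exists>m\<in>?K. \<forall>m'\<in>?K. m' \<le> m"
  proof -
    have fin: "finite {m \<in> ?K. m0 \<le> m}"
      by (rule finite_subset[of _ "{m0..int q}"]) (use bound in auto)
    have ne: "m0 \<in> {m \<in> ?K. m0 \<le> m}" using I m0 by auto
    have "Max {m \<in> ?K. m0 \<le> m} \<in> {m \<in> ?K. m0 \<le> m}" using fin ne by (intro Max_in) auto
    moreover have "m' \<le> Max {m \<in> ?K. m0 \<le> m}" if "m' \<in> ?K" for m'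
    proof (cases "m0 \<le> m'")
      case True then show ?thesis using fin that by (intro Max_ge) auto
    next
      case False
      then show ?thesis using fin ne by (meson Max_ge le_cases order_trans)
    qed
    ultimately show ?thesis by blast
  qed
  then obtain m where m: "m \<in> ?K" "\<And>m'. m' \<in> ?K \<Longrightarrow> m' \<le> m" by blast
  have "m0 \<le> m" using m(2)[of m0] I m0 by simp
  show ?thesis
  proof (intro bexI conjI ballI impI)
    show "cell p s m x \<in> S" using m by simp
    show "I \<subseteq> cell p s m x" using \<open>m0 \<le> m\<close> m0 cell_mono by blast
    fix J' assume J': "J' \<in> S" "cell p s m x \<subseteq> J'"
    then have "x \<in> J'" using cell_self by blast
    then obtain m' where m': "J' = cell p s m' x" using J' S grid_as_cell by blast
    then have "m' \<le> m" using m J' by simp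
    then show "J' = cell p s m x" using J' m' cell_mono by blast
  qed
qed

lemma grid_maximal_family:
  fixes p :: "real ^ 'n"
  assumes s: "0 < s" and S: "S \<subseteq> grid p s" and B: "\<And>I. I \<in> S \<Longrightarrow> vol I \<le> ennreal B"
  obtains T where "T \<subseteq> S" "countable T" "disjoint T" "\<Union>T = \<Union>S"
    "\<And>I. I \<in> S \<Longrightarrow> \<exists>J\<in>T. I \<subseteq> J" "\<And>I J. I \<in> T \<Longrightarrow> J \<in> S \<Longrightarrow> I \<subseteq> J \<Longrightarrow> J = I"
proof -
  define T where "T = {J \<in> S. \<forall>J'\<in>S. J \<subseteq> J' \<longrightarrow> J' = J}"
  have cov: "\<exists>J\<in>T. I \<subseteq> J" if "I \<in> S" for I
    using grid_maximal[OF s S B that] unfolding T_def by blast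
  show ?thesis
  proof
    show "T \<subseteq> S" by (auto simp: T_def)
    then show "countable T" using S countable_grid countable_subset by (metis order_trans)
    show "disjoint T"
    proof (rule disjointI)
      fix I J assume "I \<in> T" "J \<in> T" "I \<noteq> J"
      then show "I \<inter> J = {}" using grid_nested[of I p s J] S unfolding T_def by blast
    qed
    show "\<Union>T = \<Union>S" using cov \<open>T \<subseteq> S\<close> by blast
    show "\<exists>J\<in>T. I \<subseteq> J" if "I \<in> S" for I using cov that .
    show "J = I" if "I \<in> T" "J \<in> S" "I \<subseteq> J" for I J using that unfolding T_def by blast
  qed
qed

section \<open>Tripled cells and the passage from arbitrary cubes to cells\<close>

lemma triple_hcube_subset: "triple (hcube a l) \<subseteq> hcube (a - (\<chi> i. l)) (3 * l)"
  unfolding triple_def hcube_def by (auto; smt (verit))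

lemma open_triple_hcube: "open (triple (hcube (a :: real ^ 'n) l))"
proof -
  have "triple (hcube a l) = (if 0 < l then box (a - (\<chi> i. l)) (a + (\<chi> i. 2 * l)) else {})"
  proof (cases "0 < l")
    case True
    have "y \<in> triple (hcube a l)" if "y \<in> box (a - (\<chi> i. l)) (a + (\<chi> i. 2 * l))" for y
    proof -
      let ?e = "\<lambda>i. (y $ i - (a $ i - l)) / (3 * l)"
      have e: "0 < ?e i" "?e i < 1" for i
        using that[unfolded mem_box_cart, rule_format, of i] True by (simp_all add: field_simps)
      \<comment> \<open>With \<open>?e\<close> the relative position of \<open>y\<close> in the
        tripled side, \<open>y $ i - a $ i = l * (3 * ?e i - 1)\<close>, which splits as twice
        \<open>l * ?e i\<close> minus \<open>l * (1 - ?e i)\<close>.\<close>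
      define x where "x = (\<chi> i. a $ i + l * ?e i)"
      define z where "z = (\<chi> i. a $ i + l * (1 - ?e i))"
      have "y = x + x - z"
        using True by (auto simp: x_def z_def vec_eq_iff field_simps)
      moreover have "x \<in> hcube a l" "z \<in> hcube a l"
        using mult_strict_left_mono[OF e(1) True] mult_strict_left_mono[OF e(2) True]
        by (simp_all add: x_def z_def hcube_def right_diff_distrib less_imp_le del: times_divide_eq_right)
      ultimately show ?thesis unfolding triple_def by blast
    qed
    moreover have "y \<in> box (a - (\<chi> i. l)) (a + (\<chi> i. 2 * l))" if "y \<in> triple (hcube a l)" for y
      using that unfolding triple_def hcube_def mem_box_cart by (auto; smt (verit))
    ultimately show ?thesis using True by auto
  next
    case False
    then have "hcube a l = {}" by (auto simp: hcube_def not_less)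
    then show ?thesis using False by (simp add: triple_def)
  qed
  then show ?thesis by (simp add: open_box)
qed

text \<open>Since the side of the cube is shorter than that of the cells, the labels of the two
  endpoints in each coordinate differ by at most 1, and no third label fits in between. Hence the
  cells around the corners suffice.\<close>

lemma cube_covered_by_corners:
  fixes a :: "real ^ 'n"
  assumes "0 < s" "0 < l" "l < s * 2 powi m"
  shows "closed_cube a l \<subseteq> (\<Union>b\<in>(UNIV :: ('n \<Rightarrow> bool) set).
    cell p s m (\<chi> i. a $ i + (if b i then l else 0)))"
proof
  fix y assume y: "y \<in> closed_cube a l"
  let ?d = "s * 2 powi m"
  let ?f = "\<lambda>t i. \<lfloor>(t - p $ i) / ?d\<rfloor>"
  have d: "0 < ?d" using assms by simp
  have "?f (y $ i) i = ?f (a $ i) i \<or> ?f (y $ i) i = ?f (a $ i + l) i" for i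
  proof -
    have b: "a $ i \<le> y $ i" "y $ i \<le> a $ i + l" using y by (auto simp: mem_box_cart)
    have 1: "?f (a $ i) i \<le> ?f (y $ i) i" "?f (y $ i) i \<le> ?f (a $ i + l) i"
      using b d by (intro floor_mono divide_right_mono; simp)+
    have "(a $ i + l - p $ i) / ?d \<le> (a $ i - p $ i) / ?d + 1"
      using d assms(1,3) by (simp add: pos_divide_le_eq distrib_right)
    then have "?f (a $ i + l) i \<le> \<lfloor>(a $ i - p $ i) / ?d + 1\<rfloor>" by (rule floor_mono)
    also have "\<dots> = ?f (a $ i) i + 1" by (rule one_add_floor[symmetric])
    finally have "?f (a $ i + l) i \<le> ?f (a $ i) i + 1" .
    then show ?thesis using 1 by linarith
  qed
  then have "y \<in> cell p s m (\<chi> i. a $ i + (if (?f (y $ i) i = ?f (a $ i + l) i) then l else 0))"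
    by (auto simp: cell_def)
  then show "y \<in> (\<Union>b\<in>(UNIV :: ('n \<Rightarrow> bool) set).
    cell p s m (\<chi> i. a $ i + (if b i then l else 0)))" by (intro UN_I[of "\<lambda>i. ?f (y $ i) i = ?f (a $ i + l) i"]) auto
qed

lemma cube_subset_triple:
  fixes a :: "real ^ 'n"
  assumes "0 < s" "0 < l" "l < s * 2 powi m" "x \<in> closed_cube a l"
  shows "closed_cube a l \<subseteq> triple (cell p s m x)"
proof
  fix y assume y: "y \<in> closed_cube a l"
  let ?d = "s * 2 powi m"
  obtain c where c: "cell p s m x = hcube c ?d" using assms(1) by (rule cell_hcubeE)
  have x: "c $ i \<le> x $ i" "x $ i < c $ i + ?d" for i
    using cell_self[of x p s m] unfolding c hcube_def by auto
  have xy: "\<bar>y $ i - x $ i\<bar> < ?d" for i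
    using y assms(3,4) by (auto simp: mem_box_cart) (smt (verit))
  \<comment> \<open>The positive and the negative part of the displacement \<open>y - x\<close>,
    both shifted to the corner \<open>c\<close>; each is shorter than the side, so both points stay
    in the cell.\<close>
  define u where "u = (\<chi> i. if x $ i \<le> y $ i then c $ i + (y $ i - x $ i) else c $ i)"
  define w where "w = (\<chi> i. if x $ i \<le> y $ i then c $ i else c $ i + (x $ i - y $ i))"
  have "y = x + u - w" by (auto simp: u_def w_def vec_eq_iff)
  moreover have "0 < ?d" using assms by simp
  then have "u \<in> hcube c ?d" "w \<in> hcube c ?d"
    using xy by (auto simp: u_def w_def hcube_def abs_less_iff algebra_simps)
  moreover have "x \<in> hcube c ?d" using x by (simp add: hcube_def)
  ultimately show "y \<in> triple (cell p s m x)" unfolding c triple_def by blast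
qed

lemma dyadic_scale:
  assumes "0 < s" "0 < l"
  shows "\<exists>m. l < s * 2 powi m \<and> s * 2 powi m \<le> 2 * (l::real)"
proof -
  define m where "m = \<lfloor>log 2 (l / s)\<rfloor> + 1"
  have "2 powr (real_of_int m) = 2 powi m" by (simp add: powr_real_of_int')
  moreover have "log 2 (l / s) < real_of_int m" "real_of_int m \<le> log 2 (l / s) + 1"
    unfolding m_def by linarith+
  moreover have "2 powr (log 2 (l / s)) = l / s" "2 powr (log 2 (l / s) + 1) = 2 * (l / s)"
    using assms by (simp_all add: powr_add)
  ultimately have "l / s < 2 powi m" "2 powi m \<le> 2 * (l / s)"
    by (metis powr_less_mono one_less_numeral_iff semiring_norm(76),
        metis powr_mono one_le_numeral)
  then show ?thesis using assms by (intro exI[of _ m]) (simp add: field_simps)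
qed

text \<open>Pigeonhole over the \<open>2 ^ n\<close> corner cells, whose sides are at most
  \<open>2 * l\<close>: if all their averages were at most \<open>t\<close>, the cube would have
  mass at most \<open>2 ^ n * t * (2 * l) ^ n\<close>, and this is where \<open>4 ^ n\<close> comes
  from. A single grid thus controls the maximal function, at the price of replacing cells by their
  triples.\<close>

lemma cube_to_cell:
  fixes a :: "real ^ 'n"
  assumes s: "0 < s" and l: "0 < l" and G: "sets G = sets lebesgue" and t: "0 \<le> t"
    and big: "ennreal (4 ^ CARD('n) * t) * vol (closed_cube a l)
      < emeasure G (closed_cube a l)"
  shows "\<exists>I\<in>grid p s. ennreal t * vol I < emeasure G I \<and>
    closed_cube a l \<subseteq> triple I"
proof -
  let ?Q = "closed_cube a l"
  obtain m where m: "l < s * 2 powi m" "s * 2 powi m \<le> 2 * l"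
    using dyadic_scale[OF s l] by blast
  let ?c = "\<lambda>b :: 'n \<Rightarrow> bool. (\<chi> i. a $ i + (if b i then l else 0))"
  have sets: "cell p s m x \<in> sets G" for x using G s grid_lebesgue cell_in_grid by blast
  have "\<exists>b. ennreal t * vol (cell p s m (?c b)) < emeasure G (cell p s m (?c b))"
  proof (rule ccontr)
    assume "\<not> ?thesis"
    then have no: "emeasure G (cell p s m (?c b)) \<le> ennreal t * vol (cell p s m (?c b))" for b
      by (auto simp: not_less)
    have "emeasure G ?Q \<le> emeasure G (\<Union>b\<in>UNIV. cell p s m (?c b))"
      using cube_covered_by_corners[OF s l m(1)] sets by (intro emeasure_mono) auto
    also have "\<dots> \<le> (\<Sum>b\<in>UNIV. emeasure G (cell p s m (?c b)))"
      using sets by (intro emeasure_subadditive_finite) auto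
    also have "\<dots> \<le> (\<Sum>b\<in>(UNIV :: ('n \<Rightarrow> bool) set). ennreal (t * (2 * l) ^ CARD('n)))"
    proof (intro sum_mono order_trans[OF no])
      fix b
      show "ennreal t * vol (cell p s m (?c b)) \<le> ennreal (t * (2 * l) ^ CARD('n))"
        using m s t power_mono[of "s * 2 powi m" "2 * l" "CARD('n)"]
        by (simp add: emeasure_cell[OF s] ennreal_mult[symmetric] ennreal_leI mult_left_mono)
    qed
    also have "\<dots> = ennreal (2 ^ CARD('n) * (t * (2 * l) ^ CARD('n)))"
    proof -
      have "of_nat CARD('n \<Rightarrow> bool) = ennreal (2 ^ CARD('n))"
        unfolding ennreal_of_nat_eq_real_of_nat by (simp add: card_fun[where 'a='n and 'b=bool])
      then show ?thesis unfolding sum_constant using t l by (subst ennreal_mult) simp_all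
    qed
    also have "2 ^ CARD('n) * (t * (2 * l) ^ CARD('n)) = 4 ^ CARD('n) * t * l ^ CARD('n)"
      using power_mult_distrib[of "2::real" 2 "CARD('n)"] by (simp add: power_mult_distrib)
    also have "ennreal \<dots> = ennreal (4 ^ CARD('n) * t) * vol ?Q"
      using l t by (subst emeasure_lebesgue_cbox_cube) (simp_all add: ennreal_mult)
    finally show False using big by simp
  qed
  then obtain b where b: "ennreal t * vol (cell p s m (?c b)) < emeasure G (cell p s m (?c b))" ..
  have "?c b \<in> ?Q" using l by (auto simp: mem_box_cart)
  then have "?Q \<subseteq> triple (cell p s m (?c b))" using cube_subset_triple[OF s l m(1)] by blast
  then show ?thesis using b by (intro bexI[of _ "cell p s m (?c b)"]) auto
qed

section \<open>Calderon-Zygmund decomposition and outer regularity\<close>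

lemma emeasure_Union_mono:
  assumes T: "countable T" "disjoint T" and sets: "T \<subseteq> sets M" "T \<subseteq> sets N" "A \<in> sets M" "B \<in> sets N"
    and le: "\<And>I. I \<in> T \<Longrightarrow> emeasure M (A \<inter> I) \<le> c * emeasure N (B \<inter> I)"
  shows "emeasure M (A \<inter> \<Union>T) \<le> c * emeasure N (B \<inter> \<Union>T)"
proof -
  have dis: "disjoint_family_on (\<lambda>I. X \<inter> I) T" for X
    using T(2) by (auto simp: disjoint_family_on_def disjoint_def)
  have eq: "emeasure K (X \<inter> \<Union>T) = (\<integral>\<^sup>+I. emeasure K (X \<inter> I) \<partial>count_space T)"
    if "T \<subseteq> sets K" "X \<in> sets K" for K X
    using emeasure_UN_countable[OF _ T(1) dis, of X K] that by auto
  show ?thesis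
    unfolding eq[OF sets(1,3)] eq[OF sets(2,4)]
    by (subst nn_integral_cmult[symmetric]) (auto intro!: nn_integral_mono le)
qed

text \<open>Covers Lebesgue measure and the measures of weights at once. Absolute continuity allows
  null sets to be discarded; finiteness on cubes allows subtraction and continuity from
  above.\<close>

definition ac_loc_finite :: "(real ^ 'n) measure \<Rightarrow> bool" where
  "ac_loc_finite N \<longleftrightarrow> sets N = sets lebesgue \<and> absolutely_continuous lebesgue N \<and>
    (\<forall>a l. emeasure N (hcube a l) < \<infinity>)"

lemma ac_loc_finite_lebesgue: "ac_loc_finite lebesgue"
  unfolding ac_loc_finite_def
proof (intro conjI allI)
  show "absolutely_continuous lebesgue lebesgue" by (simp add: absolutely_continuous_def)
  fix a :: "real ^ 'n" and l
  have "vol (hcube a l) \<le> vol (closed_cube a l)"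
    by (intro emeasure_mono hcube_subset_cbox) auto
  also have "\<dots> < \<infinity>" using emeasure_lborel_cbox_finite by simp
  finally show "vol (hcube a l) < \<infinity>" .
qed auto

lemma ac_loc_finite_sets: "ac_loc_finite N \<Longrightarrow> sets N = sets lebesgue"
  by (simp add: ac_loc_finite_def)

lemma ac_loc_finite_hcube: "ac_loc_finite N \<Longrightarrow> emeasure N (hcube a l) < \<infinity>"
  by (simp add: ac_loc_finite_def)

lemma ac_loc_finite_null: "ac_loc_finite N \<Longrightarrow> A \<in> null_sets lebesgue \<Longrightarrow> A \<in> null_sets N"
  by (auto simp: ac_loc_finite_def absolutely_continuous_def)

lemma emeasure_parent:
  fixes p :: "real ^ 'n"
  assumes "0 < s"
  shows "vol (cell p s (m + 1) x) = ennreal (2 ^ CARD('n)) * vol (cell p s m x)"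
proof -
  have "(s * 2 powi (m + 1)) ^ CARD('n) = 2 ^ CARD('n) * (s * 2 powi m) ^ CARD('n)"
    by (simp add: power_int_add power_mult_distrib)
  then show ?thesis using assms by (simp add: emeasure_cell ennreal_mult del: power_mult_distrib)
qed

lemma cell_parent_neq:
  fixes p :: "real ^ 'n"
  assumes "0 < s"
  shows "cell p s (m + 1) x \<noteq> cell p s m x"
proof
  assume "cell p s (m + 1) x = cell p s m x"
  then have "ennreal ((s * 2 powi (m + 1)) ^ CARD('n)) = ennreal ((s * 2 powi m) ^ CARD('n))"
    using emeasure_cell[OF assms] by metis
  then have "(s * 2 powi (m + 1)) ^ CARD('n) = (s * 2 powi m) ^ CARD('n)"
    using assms by (subst (asm) ennreal_inj) auto
  then have "s * 2 powi (m + 1) = s * 2 powi m"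
    using assms by (subst (asm) power_eq_iff_eq_base) auto
  then show False using assms by (simp add: power_int_add)
qed

lemma emeasure_grid_pos: "I \<in> grid p s \<Longrightarrow> 0 < s \<Longrightarrow> 0 < vol I"
  by (metis gridE emeasure_lebesgue_hcube ennreal_less_zero_iff ennreal_0 less_imp_le zero_less_power ennreal_less_iff order_refl)

lemma emeasure_grid_finite: "I \<in> grid p s \<Longrightarrow> 0 < s \<Longrightarrow> ac_loc_finite N \<Longrightarrow> emeasure N I < \<infinity>"
  by (metis gridE ac_loc_finite_hcube)

text \<open>Finite total mass bounds the volume of every cell with average above \<open>t\<close>,
  so maximal ones exist; the parent of a maximal cell has average at most \<open>t\<close>, whence
  the factor \<open>2 ^ n\<close>. The last conclusion, maximality among all cells with large
  average, is what later forces nested stopping cells to have different heights.\<close>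

lemma Calderon_Zygmund:
  fixes p :: "real ^ 'n"
  assumes s: "0 < s" and G: "sets G = sets lebesgue" "emeasure G UNIV < \<infinity>" and t: "0 < t"
  obtains T where "T \<subseteq> grid p s" "countable T" "disjoint T"
    "\<And>I. I \<in> T \<Longrightarrow> ennreal t * vol I < emeasure G I"
    "\<And>I. I \<in> T \<Longrightarrow> emeasure G I \<le> ennreal (2 ^ CARD('n) * t) * vol I"
    "\<And>J. J \<in> grid p s \<Longrightarrow> ennreal t * vol J < emeasure G J \<Longrightarrow> \<exists>I\<in>T. J \<subseteq> I"
    "\<And>I J. I \<in> T \<Longrightarrow> J \<in> grid p s \<Longrightarrow> ennreal t * vol J < emeasure G J \<Longrightarrow> I \<subseteq> J \<Longrightarrow> J = I"
proof -
  define S where "S = {J \<in> grid p s. ennreal t * vol J < emeasure G J}"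
  have sp: "space G = UNIV" using sets_eq_imp_space_eq[OF G(1)] by simp
  obtain g where g: "emeasure G UNIV = ennreal g" "0 \<le> g" using G(2) by (cases "emeasure G UNIV") auto
  have S: "S \<subseteq> grid p s" by (auto simp: S_def)
  have B: "vol I \<le> ennreal (g / t)" if "I \<in> S" for I
  proof -
    have "ennreal t * vol I \<le> emeasure G I" using that by (simp add: S_def less_imp_le)
    also have "\<dots> \<le> ennreal g" using emeasure_space[of G I] g sp by simp
    finally have "ennreal (1/t) * (ennreal t * vol I) \<le> ennreal (1/t) * ennreal g"
      by (rule mult_left_mono) simp
    moreover have "ennreal (1/t) * (ennreal t * vol I) = vol I"
      using t by (simp add: mult.assoc[symmetric] ennreal_mult[symmetric])
    moreover have "ennreal (1/t) * ennreal g = ennreal (g / t)"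
      using t g by (simp add: ennreal_mult[symmetric])
    ultimately show ?thesis by simp
  qed
  obtain T where T: "T \<subseteq> S" "countable T" "disjoint T" "\<Union>T = \<Union>S"
    "\<And>I. I \<in> S \<Longrightarrow> \<exists>J\<in>T. I \<subseteq> J" "\<And>I J. I \<in> T \<Longrightarrow> J \<in> S \<Longrightarrow> I \<subseteq> J \<Longrightarrow> J = I"
    using grid_maximal_family[OF s S B] by blast
  show ?thesis
  proof
    show "T \<subseteq> grid p s" "countable T" "disjoint T" using T S by auto
    show "ennreal t * vol I < emeasure G I" if "I \<in> T" for I
      using that T(1) by (auto simp: S_def)
    show "\<exists>I\<in>T. J \<subseteq> I" if "J \<in> grid p s" "ennreal t * vol J < emeasure G J" for J
      using T(5) that by (auto simp: S_def)
    show "J = I" if "I \<in> T" "J \<in> grid p s" "ennreal t * vol J < emeasure G J" "I \<subseteq> J" for I J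
      using T(6) that by (auto simp: S_def)
    show "emeasure G I \<le> ennreal (2 ^ CARD('n) * t) * vol I" if "I \<in> T" for I
    proof -
      have "I \<in> grid p s" using that T(1) S by blast
      then obtain m x where I: "I = cell p s m x" unfolding grid_def by blast
      have "cell p s (m + 1) x \<notin> S"
        using T(6)[OF that, of "cell p s (m + 1) x"] cell_mono[of m "m + 1" p s x] cell_parent_neq[OF s, of p m x] I by auto
      then have le: "emeasure G (cell p s (m + 1) x) \<le> ennreal t * vol (cell p s (m + 1) x)"
        by (simp add: S_def not_less)
      have "emeasure G I \<le> emeasure G (cell p s (m + 1) x)"
        using I cell_mono[of m "m + 1" p s x] G(1) grid_lebesgue[OF cell_in_grid s] by (intro emeasure_mono) auto
      also note le
      also have "ennreal t * vol (cell p s (m + 1) x) = ennreal (2 ^ CARD('n) * t) * vol I"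
        using t by (simp add: emeasure_parent[OF s] I ennreal_mult mult_ac)
      finally show ?thesis .
    qed
  qed
qed

lemma cell_subset_hcube:
  assumes "0 < s" "x \<in> hcube p s" "m \<le> 0"
  shows "cell p s m x \<subseteq> hcube p s"
proof -
  have "cell p s 0 x = hcube p s"
    using assms cell_eq[of x p s 0 p] by (simp add: hcube_eq_cell)
  then show ?thesis using cell_mono[OF assms(3)] by blast
qed

text \<open>Outer regularity of \<open>N\<close> replaces the Lebesgue differentiation theorem.\<close>

lemma emeasure_le_of_cells:
  fixes p :: "real ^ 'n"
  assumes s: "0 < s" and M: "sets M = sets lebesgue" and N: "ac_loc_finite N"
    and E: "E \<in> sets lebesgue" "E \<subseteq> hcube p s"
    and le: "\<And>I. I \<in> grid p s \<Longrightarrow> I \<subseteq> hcube p s \<Longrightarrow> I \<inter> E \<noteq> {} \<Longrightarrow>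
      emeasure M (E \<inter> I) \<le> ennreal c * emeasure N I"
  shows "emeasure M E \<le> ennreal c * emeasure N E"
proof -
  note setsN = ac_loc_finite_sets[OF N]
  have "\<exists>U. open U \<and> E \<subseteq> U \<and> U - E \<in> lmeasurable \<and> vol (U - E) < ennreal (1 / real (Suc n))" for n
    using sets_lebesgue_outer_open[OF E(1), of "1 / real (Suc n)"] by (metis zero_less_divide_1_iff of_nat_0_less_iff zero_less_Suc)
  then obtain U where U: "\<And>n. open (U n)" "\<And>n. E \<subseteq> U n"
    "\<And>n. vol (U n - E) < ennreal (1 / real (Suc n))"
    by metis
  \<comment> \<open>Intersecting the neighbourhoods makes the sequence decreasing, and the root cube
    makes its \<open>N\<close>-measure finite, as continuity from above requires.\<close>
  define V where "V n = (\<Inter>i\<le>n. U i) \<inter> hcube p s" for n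
  have openV: "open (\<Inter>i\<le>n. U i)" for n using U(1) by (intro open_INT) auto
  have V: "V n \<in> sets lebesgue" for n unfolding V_def using openV[of n] by (intro sets.Int) (auto simp: borel_open)
  have bound: "emeasure M E \<le> ennreal c * emeasure N (V n)" for n
  proof -
    \<comment> \<open>Every point of \<open>E\<close> has a small cell inside the open set, so these
      cells cover \<open>E\<close>; the hypothesis is applied to the maximal ones.\<close>
    define S where "S = {I \<in> grid p s. I \<subseteq> V n \<and> I \<inter> E \<noteq> {}}"
    have S: "S \<subseteq> grid p s" by (auto simp: S_def)
    have B: "vol I \<le> ennreal (s ^ CARD('n))" if "I \<in> S" for I
    proof -
      have "vol I \<le> vol (hcube p s)"
        using that by (intro emeasure_mono) (auto simp: S_def V_def)
      then show ?thesis using emeasure_lebesgue_hcube[of s p] s by simp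
    qed
    obtain T where T: "T \<subseteq> S" "countable T" "disjoint T" "\<Union>T = \<Union>S"
      using grid_maximal_family[OF s S B] by metis
    have setsT: "T \<subseteq> sets lebesgue" using T(1) S s grid_lebesgue by blast
    have "E \<subseteq> \<Union>S"
    proof
      fix x assume x: "x \<in> E"
      then have "x \<in> (\<Inter>i\<le>n. U i)" using U(2) by auto
      then obtain m where m: "m \<le> 0" "cell p s m x \<subseteq> (\<Inter>i\<le>n. U i)" using cell_subset_open[OF s openV] by metis
      then have "cell p s m x \<subseteq> V n" using cell_subset_hcube[OF s, of x p m] x E by (auto simp: V_def)
      moreover have "cell p s m x \<inter> E \<noteq> {}" using x cell_self[of x p s m] by blast
      ultimately have "cell p s m x \<in> S" unfolding S_def by simp
      then show "x \<in> \<Union>S" using cell_self by blast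
    qed
    then have "emeasure M E = emeasure M (E \<inter> \<Union>T)" using T(4) by (simp add: Int_absorb2)
    also have "\<dots> \<le> ennreal c * emeasure N (UNIV \<inter> \<Union>T)"
    proof (rule emeasure_Union_mono[OF T(2,3)])
      fix I assume "I \<in> T"
      then show "emeasure M (E \<inter> I) \<le> ennreal c * emeasure N (UNIV \<inter> I)"
        using le[of I] T(1) by (auto simp: S_def V_def)
    qed (use setsT M setsN E sets.top[of N] sets_eq_imp_space_eq[OF setsN] in auto)
    also have "\<dots> \<le> ennreal c * emeasure N (V n)"
      using T(4) V setsN by (intro mult_left_mono emeasure_mono) (auto simp: S_def)
    finally show ?thesis .
  qed
  have dec: "decseq V" by (fastforce simp: decseq_def V_def)
  have "(\<lambda>n. emeasure N (V n)) \<longlonglongrightarrow> emeasure N (\<Inter>n. V n)"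
  proof (rule Lim_emeasure_decseq[OF _ dec])
    fix n
    have "emeasure N (V n) \<le> emeasure N (hcube p s)"
      using setsN by (intro emeasure_mono) (auto simp: V_def)
    then show "emeasure N (V n) \<noteq> \<infinity>" using ac_loc_finite_hcube[OF N, of p s] by auto
  qed (use V setsN in auto)
  moreover have "emeasure N (\<Inter>n. V n) = emeasure N E"
  proof -
    have EV: "E \<subseteq> (\<Inter>n. V n)" using U(2) E(2) by (auto simp: V_def)
    have sV: "(\<Inter>n. V n) \<in> sets lebesgue" using V by auto
    have "vol ((\<Inter>n. V n) - E) \<le> ennreal (1 / real (Suc n))" for n
    proof -
      have "vol ((\<Inter>n. V n) - E) \<le> vol (U n - E)"
        using U(1)[of n] E(1) by (intro emeasure_mono) (auto simp: V_def borel_open)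
      then show ?thesis using U(3)[of n] by simp
    qed
    moreover have "(\<lambda>n. ennreal (1 / real (Suc n))) \<longlonglongrightarrow> ennreal 0"
      by (intro tendsto_ennrealI) (use LIMSEQ_inverse_real_of_nat in \<open>simp add: inverse_eq_divide\<close>)
    ultimately have "vol ((\<Inter>n. V n) - E) \<le> ennreal 0"
      by (intro LIMSEQ_le_const) auto
    then have "(\<Inter>n. V n) - E \<in> null_sets lebesgue" using sV E(1) by (intro null_setsI) auto
    then have "emeasure N (E \<union> ((\<Inter>n. V n) - E)) = emeasure N E"
      using N ac_loc_finite_null setsN E(1) by (intro emeasure_Un_null_set) auto
    moreover have "E \<union> ((\<Inter>n. V n) - E) = (\<Inter>n. V n)" using EV by blast
    ultimately show ?thesis by simp
  qed
  ultimately have "(\<lambda>n. ennreal c * emeasure N (V n)) \<longlonglongrightarrow> ennreal c * emeasure N E"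
    by (intro ennreal_tendsto_cmult) auto
  then show ?thesis by (rule LIMSEQ_le_const) (use bound in auto)
qed

section \<open>Power decay by iteration over dyadic generations\<close>

lemma ennreal_le_mult_self_imp_0:
  fixes x :: ennreal
  assumes "x \<le> ennreal r * x" "r < 1" "x < \<infinity>"
  shows "x = 0"
proof (cases x)
  case (real y)
  show ?thesis
  proof (cases "0 \<le> r")
    case True
    then have "y \<le> r * y" using assms real by (simp add: ennreal_mult[symmetric])
    then have "(1 - r) * y \<le> 0" by (simp add: algebra_simps)
    then have "y \<le> 0" using assms(2) by (simp add: mult_le_0_iff)
    then show ?thesis using real by simp
  next
    case False
    then show ?thesis using assms by (simp add: ennreal_neg)
  qed
qed (use assms in auto)

text \<open>The substitute for the reverse Hoelder inequality. A set that is not yet large in the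
  root is enlarged to a union of cells: this multiplies its \<mu>-measure by at least
  \<open>1 / r\<close>, while its \<nu>-measure grows by at most the factor \<open>C * D\<close>.
  After \<open>j\<close> enlargements the hypothesis \<open>H\<close> applies to the root
  itself.\<close>

lemma emeasure_power_decay:
  fixes p :: "real ^ 'n"
  assumes s: "0 < s" and \<mu>: "ac_loc_finite \<mu>" and \<nu>: "sets \<nu> = sets lebesgue"
    and r: "0 < r" "r < 1" and C: "1 \<le> C" and D: "1 \<le> D"
    and H: "\<And>I E. I \<in> grid p s \<Longrightarrow> I \<subseteq> hcube p s \<Longrightarrow> E \<in> sets lebesgue \<Longrightarrow>
      ennreal r * emeasure \<mu> I < emeasure \<mu> (E \<inter> I) \<Longrightarrow> emeasure \<nu> I \<le> ennreal C * emeasure \<nu> (E \<inter> I)"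
    and par: "\<And>m x. m < 0 \<Longrightarrow> x \<in> hcube p s \<Longrightarrow>
      emeasure \<nu> (cell p s (m + 1) x) \<le> ennreal D * emeasure \<nu> (cell p s m x)"
  shows "E \<in> sets lebesgue \<Longrightarrow> E \<subseteq> hcube p s \<Longrightarrow>
    ennreal (r ^ Suc j) * emeasure \<mu> (hcube p s) < emeasure \<mu> E \<Longrightarrow>
    emeasure \<nu> (hcube p s) \<le> ennreal (C * (C * D) ^ j) * emeasure \<nu> E"
proof (induction j arbitrary: E)
  case 0
  then show ?case using H[of "hcube p s" E] hcube_in_grid[OF s, of p] by (simp add: Int_absorb2)
next
  case (Suc j)
  let ?Q = "hcube p s"
  note E = Suc.prems(1,2)
  note sets\<mu> = ac_loc_finite_sets[OF \<mu>]
  have CD: "1 \<le> C * D" using mult_mono[OF C D] C by simp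
  show ?case
  proof (cases "ennreal r * emeasure \<mu> ?Q < emeasure \<mu> E")
    case True
    have "emeasure \<nu> ?Q \<le> ennreal C * emeasure \<nu> E"
      using H[of ?Q E] hcube_in_grid[OF s, of p] E True by (simp add: Int_absorb2)
    also have "\<dots> \<le> ennreal (C * (C * D) ^ Suc j) * emeasure \<nu> E"
      using C one_le_power[OF CD, of "Suc j"] by (intro mult_right_mono ennreal_leI) auto
    finally show ?thesis .
  next
    case False
    let ?big = "\<lambda>m x. ennreal r * emeasure \<mu> (cell p s m x) < emeasure \<mu> (E \<inter> cell p s m x)"
    \<comment> \<open>Cells in which \<open>E\<close> has proportion at most \<open>r\<close>, but
      with a child in which it exceeds \<open>r\<close>. The first property makes the union larger
      than \<open>E\<close> by the factor \<open>1 / r\<close> in \<mu>; the second bounds \<nu> on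
      the cell, by \<open>D\<close> for passing to the child and by \<open>C\<close> for passing
      from the child to its part in \<open>E\<close>.\<close>
    define S where "S = {J \<in> grid p s. J \<subseteq> ?Q \<and> emeasure \<mu> (E \<inter> J) \<le> ennreal r * emeasure \<mu> J \<and>
      (\<exists>m x. m < 0 \<and> x \<in> ?Q \<and> J = cell p s (m + 1) x \<and> ?big m x)}"
    have S: "S \<subseteq> grid p s" by (auto simp: S_def)
    have B: "vol I \<le> ennreal (s ^ CARD('n))" if "I \<in> S" for I
    proof -
      have "vol I \<le> vol ?Q"
        using that by (intro emeasure_mono) (auto simp: S_def)
      then show ?thesis using emeasure_lebesgue_hcube[of s p] s by simp
    qed
    obtain T where T: "T \<subseteq> S" "countable T" "disjoint T" "\<Union>T = \<Union>S"
      using grid_maximal_family[OF s S B] by metis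
    have setsT: "T \<subseteq> sets lebesgue" using T(1) S s grid_lebesgue by blast
    have E1: "\<Union>T \<in> sets lebesgue" using T(2) setsT by auto
    have E1Q: "\<Union>T \<subseteq> ?Q" using T(1) by (auto simp: S_def)
    define E' where "E' = E - \<Union>T"
    have E': "E' \<in> sets lebesgue" "E' \<subseteq> ?Q" using E E1 by (auto simp: E'_def)
    \<comment> \<open>The uncovered part is \<mu>-null. If it had proportion above \<open>r\<close>
      in some cell around one of its points \<open>x\<close>, then climbing towards the root, where
      the proportion of \<open>E\<close> is at most \<open>r\<close>, the first ancestor with
      proportion at most \<open>r\<close> would belong to \<open>S\<close> and cover
      \<open>x\<close>. So all proportions are at most \<open>r\<close>, which gives the same bound
      for the measure of the set against itself.\<close>
    have "emeasure \<mu> E' \<le> ennreal r * emeasure \<mu> E'"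
    proof (rule emeasure_le_of_cells[OF s sets\<mu> \<mu> E'])
      fix I assume I: "I \<in> grid p s" "I \<subseteq> ?Q" "I \<inter> E' \<noteq> {}"
      then obtain x where x: "x \<in> I" "x \<in> E'" by blast
      then obtain m where m: "I = cell p s m x" using I grid_as_cell by blast
      have xQ: "x \<in> ?Q" using x E' by blast
      have Q0: "cell p s 0 x = ?Q" using xQ cell_eq[of x p s 0 p] by (simp add: hcube_eq_cell[OF s])
      have Q: "\<not> ?big 0 x" using False E(2) by (simp add: Q0 Int_absorb2)
      show "emeasure \<mu> (E' \<inter> I) \<le> ennreal r * emeasure \<mu> I"
      proof (rule ccontr)
        assume "\<not> ?thesis"
        then have "ennreal r * emeasure \<mu> I < emeasure \<mu> (E' \<inter> I)" by simp
        also have "\<dots> \<le> emeasure \<mu> (E \<inter> I)"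
          using E sets\<mu> grid_lebesgue[OF I(1) s] by (intro emeasure_mono) (auto simp: E'_def)
        finally have big: "?big m x" by (simp add: m)
        have "m < 0"
        proof (rule ccontr)
          assume "\<not> m < 0"
          then have "cell p s 0 x \<subseteq> cell p s m x" by (intro cell_mono) auto
          then have "cell p s m x = cell p s 0 x" using I(2) m Q0 by blast
          then show False using big Q by simp
        qed
        define q where "q = (LEAST k :: nat. \<not> ?big (m + int k) x)"
        have "\<not> ?big (m + int (nat (- m))) x" using Q \<open>m < 0\<close> by simp
        then have q: "\<not> ?big (m + int q) x" "q \<le> nat (- m)"
          unfolding q_def by (rule LeastI, rule Least_le)
        then obtain k where k: "q = Suc k" using big by (cases q) auto
        have bk: "?big (m + int k) x" using not_less_Least[of k "\<lambda>k. \<not> ?big (m + int k) x"] k unfolding q_def by auto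
        have neg: "m + int k < 0" using q(2) k \<open>m < 0\<close> by linarith
        have eq: "m + int q = m + int k + 1" using k by simp
        have "cell p s (m + int k + 1) x \<in> S"
          unfolding S_def using q(1) bk neg xQ cell_subset_hcube[OF s xQ, of "m + int k + 1"] unfolding eq
          by (auto simp: not_less)
        then have "x \<in> \<Union>T" using T(4) cell_self by blast
        then show False using x by (simp add: E'_def)
      qed
    qed
    moreover have "emeasure \<mu> E' < \<infinity>"
      using emeasure_mono[OF E'(2), of \<mu>] sets\<mu> ac_loc_finite_hcube[OF \<mu>, of p s] by (auto intro: le_less_trans)
    ultimately have "emeasure \<mu> E' = 0" using r ennreal_le_mult_self_imp_0 by blast
    then have "E' \<in> null_sets \<mu>" using E' sets\<mu> by (auto intro: null_setsI)
    then have "emeasure \<mu> ((E \<inter> \<Union>T) \<union> E') = emeasure \<mu> (E \<inter> \<Union>T)"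
      using E E1 sets\<mu> by (intro emeasure_Un_null_set) auto
    moreover have "(E \<inter> \<Union>T) \<union> E' = E" by (auto simp: E'_def)
    ultimately have "emeasure \<mu> E = emeasure \<mu> (E \<inter> \<Union>T)" by simp
    also have "\<dots> \<le> ennreal r * emeasure \<mu> (UNIV \<inter> \<Union>T)"
    proof (rule emeasure_Union_mono[OF T(2,3)])
      show "UNIV \<in> sets \<mu>" using sets.top[of \<mu>] sets_eq_imp_space_eq[OF sets\<mu>] by simp
    qed (use setsT sets\<mu> E T(1) in \<open>auto simp: S_def\<close>)
    finally have muE: "emeasure \<mu> E \<le> ennreal r * emeasure \<mu> (\<Union>T)" by simp
    have "ennreal (r ^ Suc j) * emeasure \<mu> ?Q < emeasure \<mu> (\<Union>T)"
    proof (rule ccontr)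
      assume "\<not> ?thesis"
      then have "ennreal r * emeasure \<mu> (\<Union>T) \<le> ennreal r * (ennreal (r ^ Suc j) * emeasure \<mu> ?Q)"
        by (intro mult_left_mono) auto
      also have "\<dots> = ennreal (r ^ Suc (Suc j)) * emeasure \<mu> ?Q"
        using r by (simp add: ennreal_mult[symmetric] mult.assoc[symmetric])
      finally show False using muE Suc.prems(3) by auto
    qed
    then have "emeasure \<nu> ?Q \<le> ennreal (C * (C * D) ^ j) * emeasure \<nu> (\<Union>T)"
      using Suc.IH[OF E1 E1Q] by blast
    also have "emeasure \<nu> (\<Union>T) = emeasure \<nu> (UNIV \<inter> \<Union>T)" by simp
    also have "\<dots> \<le> ennreal (C * D) * emeasure \<nu> (E \<inter> \<Union>T)"
    proof (rule emeasure_Union_mono[OF T(2,3)])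
      show "UNIV \<in> sets \<nu>" using sets.top[of \<nu>] sets_eq_imp_space_eq[OF \<nu>] by simp
      fix J assume "J \<in> T"
      then obtain m x where J: "m < 0" "x \<in> ?Q" "J = cell p s (m + 1) x" "?big m x"
        using T(1) by (auto simp: S_def)
      have "emeasure \<nu> (UNIV \<inter> J) \<le> ennreal D * emeasure \<nu> (cell p s m x)" using par J by simp
      also have "\<dots> \<le> ennreal D * (ennreal C * emeasure \<nu> (E \<inter> cell p s m x))"
        using H[of "cell p s m x" E] J E cell_subset_hcube[OF s J(2), of m] by (intro mult_left_mono) auto
      also have "\<dots> \<le> ennreal D * (ennreal C * emeasure \<nu> (E \<inter> J))"
        using E \<nu> J(3) cell_mono[of m "m + 1" p s x] s grid_lebesgue[of J p s]
        by (intro mult_left_mono emeasure_mono) auto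
      also have "\<dots> = ennreal (C * D) * emeasure \<nu> (E \<inter> J)"
        using C D by (simp add: ennreal_mult mult_ac)
      finally show "emeasure \<nu> (UNIV \<inter> J) \<le> ennreal (C * D) * emeasure \<nu> (E \<inter> J)" .
    qed (use setsT \<nu> E in auto)
    also have "\<dots> \<le> ennreal (C * D) * emeasure \<nu> E"
      using E \<nu> by (intro mult_left_mono emeasure_mono) auto
    finally have "emeasure \<nu> ?Q \<le> ennreal (C * (C * D) ^ j) * (ennreal (C * D) * emeasure \<nu> E)"
      by (simp add: mult_left_mono)
    also have "\<dots> = ennreal (C * (C * D) ^ Suc j) * emeasure \<nu> E"
    proof -
      have "C * (C * D) ^ Suc j = C * (C * D) ^ j * (C * D)" by simp
      moreover have "0 \<le> C * (C * D) ^ j" "0 \<le> C * D" using C CD by auto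
      ultimately show ?thesis by (metis ennreal_mult mult.assoc)
    qed
    finally show ?thesis .
  qed
qed

section \<open>Weights and quantitative comparison of measures\<close>

lemma sets_weighted [simp]: "sets (weighted w) = sets lebesgue"
  by (simp add: weighted_def)

lemma space_weighted [simp]: "space (weighted w) = UNIV"
  by (simp add: weighted_def)

lemma locally_integrable_measurable:
  fixes w :: "real ^ 'n \<Rightarrow> real"
  assumes "locally_integrable w"
  shows "w \<in> borel_measurable lebesgue"
proof -
  let ?f = "\<lambda>n::nat. \<lambda>x. indicator (cball 0 (real n)) x *\<^sub>R w x"
  have meas: "?f n \<in> borel_measurable lebesgue" for n
    using assms compact_cball[of 0 "real n"] unfolding locally_integrable_def set_integrable_def by blast
  have "(\<lambda>n. ?f n x) \<longlonglongrightarrow> w x" for x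
  proof -
    obtain N :: nat where "norm x \<le> real N" using real_arch_simple by blast
    then have "?f n x = w x" if "n \<ge> N" for n using that by auto
    then have "eventually (\<lambda>n. ?f n x = w x) sequentially" unfolding eventually_sequentially by blast
    then show ?thesis by (rule tendsto_eventually)
  qed
  then show ?thesis by (rule borel_measurable_LIMSEQ_real[OF _ meas])
qed

lemma weight_measurable: "weight w \<Longrightarrow> w \<in> borel_measurable lebesgue"
  by (simp add: weight_def locally_integrable_measurable)

lemma emeasure_weighted:
  assumes "w \<in> borel_measurable lebesgue" "E \<in> sets lebesgue"
  shows "emeasure (weighted w) E = (\<integral>\<^sup>+x\<in>E. ennreal (w x) \<partial>lebesgue)"
  unfolding weighted_def using assms by (intro emeasure_density) auto

lemma avg_eq:
  assumes "w \<in> borel_measurable lebesgue" "E \<in> sets lebesgue"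
  shows "avg E w = emeasure (weighted w) E / vol E"
  unfolding avg_def emeasure_weighted[OF assms] ..

lemma weight_ac_loc_finite:
  fixes w :: "real ^ 'n \<Rightarrow> real"
  assumes "weight w"
  shows "ac_loc_finite (weighted w)"
  unfolding ac_loc_finite_def
proof (intro conjI allI)
  have w: "w \<in> borel_measurable lebesgue" using weight_measurable[OF assms] .
  show "sets (weighted w) = sets lebesgue" by simp
  show "absolutely_continuous lebesgue (weighted w)"
    unfolding weighted_def using w by (intro absolutely_continuousI_density) auto
  fix a :: "real ^ 'n" and l
  let ?Q = "closed_cube a l"
  have "set_integrable lebesgue ?Q w"
    using assms compact_cbox by (auto simp: weight_def locally_integrable_def)
  then have "(\<integral>\<^sup>+x. ennreal (norm (indicator ?Q x *\<^sub>R w x)) \<partial>lebesgue) < \<infinity>"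
    unfolding set_integrable_def integrable_iff_bounded by blast
  moreover have "ennreal (norm (indicator ?Q x *\<^sub>R w x)) = ennreal (w x) * indicator ?Q x" for x
    using assms by (auto simp: weight_def indicator_def)
  ultimately have "emeasure (weighted w) ?Q < \<infinity>" using w by (subst emeasure_weighted) auto
  moreover have "emeasure (weighted w) (hcube a l) \<le> emeasure (weighted w) ?Q"
    by (intro emeasure_mono hcube_subset_cbox) auto
  ultimately show "emeasure (weighted w) (hcube a l) < \<infinity>" by (rule le_less_trans[rotated])
qed

lemma weight_emeasure_pos:
  assumes w: "weight w" and E: "E \<in> sets lebesgue" "0 < vol E"
  shows "0 < emeasure (weighted w) E"
proof (rule ccontr)
  assume "\<not> ?thesis"
  then have "(\<integral>\<^sup>+x. ennreal (w x) * indicator E x \<partial>lebesgue) = 0"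
    using emeasure_weighted[OF weight_measurable[OF w] E(1)] by simp
  then have "AE x in lebesgue. ennreal (w x) * indicator E x = 0"
    using weight_measurable[OF w] E(1) by (subst (asm) nn_integral_0_iff_AE) auto
  moreover have "AE x in lebesgue. 0 < w x" using w by (simp add: weight_def)
  ultimately have "AE x in lebesgue. x \<notin> E"
    by eventually_elim (auto simp: indicator_def split: if_splits)
  then have "vol E = 0" using E(1) by (subst (asm) AE_iff_measurable[of E]) auto
  then show False using E(2) by simp
qed

lemma weight_hcube_pos:
  assumes "weight w" "0 < l"
  shows "0 < emeasure (weighted w) (hcube a l)"
  by (rule weight_emeasure_pos) (use assms emeasure_lebesgue_hcube[of l a] in auto)

text \<open>The classical \<open>A\<^sub>\<infinity>\<close> condition for a single pair of
  parameters. All constants attached to \<open>v\<close> in the final estimate are derived from such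
  a pair, which is how uniformity in \<open>v\<close> is kept.\<close>

definition cube_Ainf :: "real \<Rightarrow> real \<Rightarrow> (real ^ 'n) measure \<Rightarrow> bool" where
  "cube_Ainf \<delta> \<theta> V \<longleftrightarrow> (\<forall>a l E. 0 < l \<longrightarrow> E \<in> sets lebesgue \<longrightarrow> E \<subseteq> hcube a l \<longrightarrow>
    vol E \<le> ennreal \<delta> * vol (hcube a l) \<longrightarrow>
    emeasure V E \<le> ennreal \<theta> * emeasure V (hcube a l))"

lemma cube_AinfD:
  "cube_Ainf \<delta> \<theta> V \<Longrightarrow> 0 < l \<Longrightarrow> E \<in> sets lebesgue \<Longrightarrow> E \<subseteq> hcube a l \<Longrightarrow>
    vol E \<le> ennreal \<delta> * vol (hcube a l) \<Longrightarrow>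
    emeasure V E \<le> ennreal \<theta> * emeasure V (hcube a l)"
  unfolding cube_Ainf_def by blast

lemma emeasure_split:
  assumes "sets V = sets lebesgue" "E \<in> sets lebesgue" "Q \<in> sets lebesgue" "E \<subseteq> Q"
  shows "emeasure V Q = emeasure V E + emeasure V (Q - E)"
  using assms plus_emeasure[of E V "Q - E"] by (simp add: Un_absorb1)

lemma ennreal_le_of_add_le:
  fixes x y z :: ennreal
  assumes "z = x + y" "y \<le> ennreal \<theta> * z" "z < \<infinity>" "\<theta> < 1" "0 \<le> \<theta>"
  shows "z \<le> ennreal (1 / (1 - \<theta>)) * x"
proof -
  obtain z' where z: "z = ennreal z'" "0 \<le> z'" using assms(3) by (cases z) auto
  obtain x' where x: "x = ennreal x'" "0 \<le> x'" using assms(1,3) by (cases x) auto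
  obtain y' where y: "y = ennreal y'" "0 \<le> y'" using assms(1,3) by (cases y) auto
  have "z' = x' + y'" using assms(1) x y z by (simp add: ennreal_plus[symmetric] del: ennreal_plus)
  moreover have "y' \<le> \<theta> * z'" using assms(2,5) y z by (simp add: ennreal_mult[symmetric])
  ultimately have "(1 - \<theta>) * z' \<le> x'" by (simp add: algebra_simps)
  then have "z' \<le> 1 / (1 - \<theta>) * x'" using assms(4) by (simp add: field_simps)
  then show ?thesis using x z assms(4) by (simp add: ennreal_mult[symmetric])
qed

lemma cube_Ainf_complement:
  assumes V: "cube_Ainf \<delta> \<theta> V" "ac_loc_finite V" and \<theta>: "0 \<le> \<theta>" "\<theta> < 1" and l: "0 < l"
    and E: "E \<in> sets lebesgue" "E \<subseteq> hcube a l"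
    and small: "vol (hcube a l - E) \<le> ennreal \<delta> * vol (hcube a l)"
  shows "emeasure V (hcube a l) \<le> ennreal (1 / (1 - \<theta>)) * emeasure V E"
proof (rule ennreal_le_of_add_le)
  show "emeasure V (hcube a l) = emeasure V E + emeasure V (hcube a l - E)"
    using emeasure_split[OF ac_loc_finite_sets[OF V(2)] E(1) _ E(2)] by simp
  show "emeasure V (hcube a l - E) \<le> ennreal \<theta> * emeasure V (hcube a l)"
    using cube_AinfD[OF V(1) l _ _ small] E(1) by auto
qed (use \<theta> ac_loc_finite_hcube[OF V(2)] in auto)

lemma hcube_subsetD:
  assumes "hcube a l \<subseteq> hcube b L" "0 < l"
  shows "b $ i \<le> a $ i" "a $ i + l \<le> b $ i + L"
proof -
  have "a \<in> hcube a l" using assms(2) by (simp add: hcube_def)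
  then have "a \<in> hcube b L" using assms(1) by blast
  then show "b $ i \<le> a $ i" by (simp add: hcube_def)
  show "a $ i + l \<le> b $ i + L"
  proof (rule ccontr)
    assume n: "\<not> ?thesis"
    define e where "e = max 0 (b $ i + L - a $ i)"
    have "(\<chi> j. if j = i then a $ i + e else a $ j) \<in> hcube a l"
      using n assms(2) by (auto simp: hcube_def e_def)
    then have "(\<chi> j. if j = i then a $ i + e else a $ j) \<in> hcube b L" using assms(1) by blast
    then have "a $ i + e < b $ i + L" unfolding hcube_def by (auto dest: spec[of _ i])
    then show False by (simp add: e_def)
  qed
qed

text \<open>The two cubes are joined by a chain of cubes, each filling most of the next.\<close>

lemma cube_Ainf_doubling:
  assumes \<delta>: "0 < \<delta>" and \<theta>: "0 \<le> \<theta>" "\<theta> < 1"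
  shows "\<exists>D\<ge>1. \<forall>V :: (real ^ 'n) measure. cube_Ainf \<delta> \<theta> V \<longrightarrow> ac_loc_finite V \<longrightarrow>
    (\<forall>a l b L. 0 < l \<longrightarrow> hcube a l \<subseteq> hcube b L \<longrightarrow> L \<le> 3 * l \<longrightarrow>
      emeasure V (hcube b L) \<le> ennreal D * emeasure V (hcube a l))"
proof -
  \<comment> \<open>One link of the chain lengthens the side by at most the factor
    \<open>1 + 2 / N\<close>, because the total increase is at most \<open>2 * l\<close>. For large
    \<open>N\<close> the volume added in a link is at most the fraction \<delta> of the larger
    cube.\<close>
  have "(\<lambda>N. (1 - \<delta>) * (1 + 2 * inverse (real (Suc N))) ^ CARD('n)) \<longlonglongrightarrow> (1 - \<delta>) * (1 + 2 * 0) ^ CARD('n)"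
    by (intro tendsto_intros LIMSEQ_inverse_real_of_nat)
  then have "eventually (\<lambda>N. (1 - \<delta>) * (1 + 2 * inverse (real (Suc N))) ^ CARD('n) < 1) sequentially"
    by (rule order_tendstoD(2)) (use \<delta> in simp)
  then obtain N0 where "(1 - \<delta>) * (1 + 2 * inverse (real (Suc N0))) ^ CARD('n) < 1"
    using eventually_happens trivial_limit_sequentially by blast
  then obtain N :: nat where N: "0 < N" "(1 - \<delta>) * (1 + 2 / real N) ^ CARD('n) < 1"
    by (metis divide_inverse zero_less_Suc)
  define c where "c = 1 / (1 - \<theta>)"
  have c: "1 \<le> c" using \<theta> by (simp add: c_def)
  show ?thesis
  proof (intro exI[of _ "c ^ N"] conjI allI impI)
    show "1 \<le> c ^ N" using c by simp
    fix V :: "(real ^ 'n) measure" and a b :: "real ^ 'n" and l L :: real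
    assume V: "cube_Ainf \<delta> \<theta> V" "ac_loc_finite V" and l: "0 < l" and sub: "hcube a l \<subseteq> hcube b L" and L: "L \<le> 3 * l"
    note ab = hcube_subsetD[OF sub l]
    have lL: "l \<le> L" using ab(1)[of undefined] ab(2)[of undefined] by linarith
    \<comment> \<open>Corner and side are interpolated linearly between the two cubes. The lower
      faces then move down and the upper faces up, so consecutive cubes are nested.\<close>
    define q :: "nat \<Rightarrow> real ^ 'n" where "q i = (\<chi> j. a $ j + real i / real N * (b $ j - a $ j))" for i
    define r where "r i = l + real i / real N * (L - l)" for i
    have step: "emeasure V (hcube (q (Suc i)) (r (Suc i))) \<le> ennreal c * emeasure V (hcube (q i) (r i))" for i
      unfolding c_def
    proof (rule cube_Ainf_complement[OF V \<theta>])
      have ri: "l \<le> r i" "r (Suc i) = r i + (L - l) / real N" using lL by (auto simp: r_def add_divide_distrib distrib_right)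
      have rSuc: "0 < r (Suc i)" using ri lL l by (simp add: add_pos_nonneg)
      then show "0 < r (Suc i)" .
      have le1: "q (Suc i) $ j \<le> q i $ j" for j
        using ab(1)[of j] N(1) by (simp add: q_def mult_right_mono_neg divide_right_mono)
      have le2: "q i $ j + r i \<le> q (Suc i) $ j + r (Suc i)" for j
      proof -
        have "q (Suc i) $ j + r (Suc i) - (q i $ j + r i) = (b $ j + L - (a $ j + l)) / real N"
          using N(1) by (simp add: q_def r_def field_simps)
        moreover have "0 \<le> (b $ j + L - (a $ j + l)) / real N" using ab(2)[of j] by simp
        ultimately show ?thesis by linarith
      qed
      show sub: "hcube (q i) (r i) \<subseteq> hcube (q (Suc i)) (r (Suc i))"
        using le1 le2 unfolding hcube_def by (auto; smt (verit))
      show "hcube (q i) (r i) \<in> sets lebesgue" by simp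
      have "r (Suc i) \<le> r i * (1 + 2 / real N)"
      proof -
        have "(L - l) / real N \<le> 2 * l / real N" using L by (intro divide_right_mono) auto
        also have "\<dots> \<le> r i * (2 / real N)" using ri by (simp add: divide_right_mono mult.commute)
        finally show ?thesis using ri by (simp add: distrib_left)
      qed
      then have "(1 - \<delta>) * r (Suc i) ^ CARD('n) \<le> r i ^ CARD('n)"
      proof (cases "\<delta> \<le> 1")
        case True
        have "r (Suc i) ^ CARD('n) \<le> (r i * (1 + 2 / real N)) ^ CARD('n)"
          using \<open>r (Suc i) \<le> _\<close> rSuc by (intro power_mono) auto
        then have "(1 - \<delta>) * r (Suc i) ^ CARD('n) \<le> (1 - \<delta>) * (r i * (1 + 2 / real N)) ^ CARD('n)"
          using True by (intro mult_left_mono) auto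
        also have "\<dots> = r i ^ CARD('n) * ((1 - \<delta>) * (1 + 2 / real N) ^ CARD('n))"
          by (simp add: power_mult_distrib)
        also have "\<dots> \<le> r i ^ CARD('n) * 1" using N(2) ri l by (intro mult_left_mono) auto
        finally show ?thesis by simp
      next
        case False
        then have "(1 - \<delta>) * r (Suc i) ^ CARD('n) \<le> 0" using rSuc by (intro mult_nonpos_nonneg) auto
        also have "\<dots> \<le> r i ^ CARD('n)" using ri l by simp
        finally show ?thesis .
      qed
      then have "r (Suc i) ^ CARD('n) - r i ^ CARD('n) \<le> \<delta> * r (Suc i) ^ CARD('n)"
        by (simp add: algebra_simps)
      moreover have "vol (hcube (q (Suc i)) (r (Suc i)) - hcube (q i) (r i)) =
        ennreal (r (Suc i) ^ CARD('n) - r i ^ CARD('n))"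
      proof -
        have "0 \<le> r i" "0 \<le> r (Suc i)" using ri l rSuc by linarith+
        note e = emeasure_lebesgue_hcube[OF this(1)] emeasure_lebesgue_hcube[OF this(2)]
        have "vol (hcube (q (Suc i)) (r (Suc i)) - hcube (q i) (r i)) =
          vol (hcube (q (Suc i)) (r (Suc i))) - vol (hcube (q i) (r i))"
          by (rule emeasure_Diff[OF _ _ _ sub]) (simp_all only: e hcube_lebesgue ennreal_neq_top infinity_ennreal_def not_False_eq_True)
        then show ?thesis unfolding e using \<open>0 \<le> r i\<close> by (simp add: ennreal_minus)
      qed
      ultimately show "vol (hcube (q (Suc i)) (r (Suc i)) - hcube (q i) (r i))
          \<le> ennreal \<delta> * vol (hcube (q (Suc i)) (r (Suc i)))"
        unfolding emeasure_lebesgue_hcube[OF less_imp_le[OF rSuc]]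
        using rSuc \<delta> by (simp add: ennreal_mult[symmetric] ennreal_leI)
    qed
    have "emeasure V (hcube (q i) (r i)) \<le> ennreal (c ^ i) * emeasure V (hcube (q 0) (r 0))" for i
    proof (induction i)
      case (Suc i)
      have "emeasure V (hcube (q (Suc i)) (r (Suc i))) \<le> ennreal c * emeasure V (hcube (q i) (r i))" by (rule step)
      also have "\<dots> \<le> ennreal c * (ennreal (c ^ i) * emeasure V (hcube (q 0) (r 0)))"
        using Suc by (intro mult_left_mono) auto
      finally show ?case using c by (simp add: ennreal_mult mult.assoc)
    qed simp
    from this[of N] show "emeasure V (hcube b L) \<le> ennreal (c ^ N) * emeasure V (hcube a l)"
      using N(1) by (simp add: q_def r_def)
  qed
qed

text \<open>The power form of the \<open>A\<^sub>\<infinity>\<close> relation: the \<mu>-proportion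
  of \<open>E\<close> is at most \<open>A\<close> times the \<epsilon>-th power of its
  \<nu>-proportion. The bound \<open>y\<close> stands in for the \<nu>-proportion, which avoids
  quotients and powers in \<open>ennreal\<close>.\<close>

definition power_dominated :: "real \<Rightarrow> real \<Rightarrow> (real ^ 'n) measure \<Rightarrow> (real ^ 'n) measure \<Rightarrow> bool" where
  "power_dominated A \<epsilon> \<mu> \<nu> \<longleftrightarrow> (\<forall>a l E y. 0 < l \<longrightarrow> E \<in> sets lebesgue \<longrightarrow> E \<subseteq> hcube a l \<longrightarrow> 0 \<le> y \<longrightarrow>
    emeasure \<nu> E \<le> ennreal y * emeasure \<nu> (hcube a l) \<longrightarrow>
    emeasure \<mu> E \<le> ennreal (A * y powr \<epsilon>) * emeasure \<mu> (hcube a l))"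

lemma power_dominatedD:
  "power_dominated A \<epsilon> \<mu> \<nu> \<Longrightarrow> 0 < l \<Longrightarrow> E \<in> sets lebesgue \<Longrightarrow> E \<subseteq> hcube a l \<Longrightarrow> 0 \<le> y \<Longrightarrow>
    emeasure \<nu> E \<le> ennreal y * emeasure \<nu> (hcube a l) \<Longrightarrow>
    emeasure \<mu> E \<le> ennreal (A * y powr \<epsilon>) * emeasure \<mu> (hcube a l)"
  unfolding power_dominated_def by blast

text \<open>The exponent is the one that turns \<open>1 / K ^ j\<close> into \<open>r ^ j\<close>.
  With \<open>j\<close> the first index for which \<open>K ^ j * y\<close> reaches 1,
  \<open>y\<close> is at least \<open>1 / K ^ j\<close>, while the decay hypothesis is available at
  the index before; the factor \<open>1 / r ^ 2\<close> absorbs this shift and the smallest values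
  of \<open>j\<close>.\<close>

lemma geometric_to_power:
  fixes x y K r :: real
  assumes K: "1 < K" and r: "0 < r" "r < 1" and x: "0 \<le> x" "x \<le> 1" and y: "0 \<le> y"
    and dec: "\<And>j. K ^ Suc j * y < 1 \<Longrightarrow> x \<le> r ^ Suc j"
  shows "x \<le> 1 / r ^ 2 * y powr (- ln r / ln K)"
proof -
  let ?e = "- ln r / ln K"
  have e: "0 < ?e" using K r by (simp add: ln_less_zero divide_neg_pos)
  have Ke: "(1 / K ^ j) powr ?e = r ^ j" for j
  proof -
    have "(1 / K ^ j) powr ?e = exp (real j * ln r)"
      using K by (simp add: powr_def ln_div ln_realpow)
    then show ?thesis using r by (simp add: exp_of_nat_mult)
  qed
  show ?thesis
  proof (cases "y = 0")
    case True
    \<comment> \<open>Since \<open>0 powr a = 0\<close>, the right-hand side vanishes here, so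
      \<open>x\<close> must be shown to be at most 0; all indices \<open>j\<close> are
      available.\<close>
    then have "x \<le> r ^ Suc j" for j using dec by simp
    moreover have "(\<lambda>j. r ^ Suc j) \<longlonglongrightarrow> 0" using r by (intro LIMSEQ_Suc LIMSEQ_realpow_zero) auto
    ultimately have "x \<le> 0" by (intro LIMSEQ_le_const) auto
    then show ?thesis using True by simp
  next
    case False
    then have y: "0 < y" using y by simp
    obtain k where "1 / y < K ^ k" using real_arch_pow[OF K] by blast
    then have ex: "1 \<le> K ^ k * y" using y by (simp add: field_simps)
    define j where "j = (LEAST k. 1 \<le> K ^ k * y)"
    have j: "1 \<le> K ^ j * y" unfolding j_def using ex by (rule LeastI)
    then have "1 / K ^ j \<le> y" using K by (simp add: field_simps)
    then have "(1 / K ^ j) powr ?e \<le> y powr ?e" using e K by (intro powr_mono2) auto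
    then have rj: "r ^ j \<le> y powr ?e" by (simp only: Ke)
    have "r ^ 2 * x \<le> r ^ j"
    proof (cases "j \<le> 2")
      case True
      have "r ^ 2 * x \<le> r ^ 2 * 1" using x by (intro mult_left_mono) auto
      also have "\<dots> \<le> r ^ j" using True r by (simp add: power_decreasing)
      finally show ?thesis .
    next
      case False
      then obtain i where i: "j = Suc (Suc i)" by (metis Suc_le_D nat_le_linear not_less_eq_eq numeral_2_eq_2)
      have "K ^ Suc i * y < 1" using not_less_Least[of "Suc i" "\<lambda>k. 1 \<le> K ^ k * y"] i by (simp add: j_def)
      then have "x \<le> r ^ Suc i" by (rule dec)
      also have "\<dots> \<le> r ^ i" using r by (intro power_decreasing) auto
      finally have "r ^ 2 * x \<le> r ^ 2 * r ^ i" using r by (intro mult_left_mono) auto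
      then show ?thesis using i by (simp add: power2_eq_square mult.assoc)
    qed
    then have "r ^ 2 * x \<le> y powr ?e" using rj by linarith
    then show ?thesis using r by (simp add: field_simps)
  qed
qed

text \<open>\<open>emeasure_power_decay\<close>, read contrapositively in the grid rooted at the
  given cube, says that a \<nu>-proportion below \<open>1 / (C * D) ^ Suc j\<close> forces a
  \<mu>-proportion of at most \<open>r ^ Suc j\<close>; \<open>geometric_to_power\<close>
  interpolates between these values. The strict bound on \<open>D\<close> makes the logarithm in the
  exponent positive.\<close>

lemma power_dominatedI:
  assumes \<mu>: "ac_loc_finite \<mu>" and r: "0 < r" "r < 1" and C: "1 \<le> C" and D: "1 < D"
    and pos: "\<And>a l. 0 < l \<Longrightarrow> 0 < emeasure \<nu> (hcube a l)"
    and \<nu>: "ac_loc_finite \<nu>"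
    and H: "\<And>a l E. 0 < l \<Longrightarrow> E \<in> sets lebesgue \<Longrightarrow> E \<subseteq> hcube a l \<Longrightarrow>
      ennreal r * emeasure \<mu> (hcube a l) < emeasure \<mu> E \<Longrightarrow> emeasure \<nu> (hcube a l) \<le> ennreal C * emeasure \<nu> E"
    and dbl: "\<And>a l b. 0 < l \<Longrightarrow> hcube a l \<subseteq> hcube b (2 * l) \<Longrightarrow>
      emeasure \<nu> (hcube b (2 * l)) \<le> ennreal D * emeasure \<nu> (hcube a l)"
  shows "power_dominated (1 / r ^ 2) (- ln r / ln (C * D)) \<mu> \<nu>"
  unfolding power_dominated_def
proof (intro allI impI)
  fix a :: "real ^ 'a" and l E y
  assume l: "0 < l" and E: "E \<in> sets lebesgue" "E \<subseteq> hcube a l" and y: "0 \<le> y"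
    and Ey: "emeasure \<nu> E \<le> ennreal y * emeasure \<nu> (hcube a l)"
  let ?Q = "hcube a l"
  note sets\<mu> = ac_loc_finite_sets[OF \<mu>]
  have EQ: "emeasure \<mu> E \<le> emeasure \<mu> ?Q" using E sets\<mu> by (intro emeasure_mono) auto
  have QF: "emeasure \<mu> ?Q < \<infinity>" "emeasure \<nu> ?Q < \<infinity>" using ac_loc_finite_hcube \<mu> \<nu> by auto
  obtain q where q: "emeasure \<mu> ?Q = ennreal q" "0 \<le> q" using QF(1) by (cases "emeasure \<mu> ?Q") auto
  obtain e where e: "emeasure \<mu> E = ennreal e" "0 \<le> e" using EQ QF(1) by (cases "emeasure \<mu> E") auto
  obtain n where n: "emeasure \<nu> ?Q = ennreal n" "0 \<le> n" using QF(2) by (cases "emeasure \<nu> ?Q") auto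
  have n0: "0 < n" using pos[OF l, of a] n by simp
  have eq: "e \<le> q" using EQ e q by simp
  have CD: "1 < C * D" using mult_strict_mono'[of 1 C 1 D] C D less_le_trans[OF D, of "C * D"] by (simp add: mult_right_mono[of 1 C D, simplified])
  have dec: "e \<le> r ^ Suc j * q" if j: "(C * D) ^ Suc j * y < 1" for j
  proof (rule ccontr)
    assume "\<not> ?thesis"
    then have "ennreal (r ^ Suc j) * emeasure \<mu> ?Q < emeasure \<mu> E"
      using e q r by (simp add: ennreal_mult[symmetric] ennreal_less_iff)
    then have "emeasure \<nu> ?Q \<le> ennreal (C * (C * D) ^ j) * emeasure \<nu> E"
    proof (rule emeasure_power_decay[OF l \<mu> ac_loc_finite_sets[OF \<nu>] r C less_imp_le[OF D] _ _ E, rotated -1])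
      fix I E
      assume I: "I \<in> grid a l" "I \<subseteq> ?Q" "E \<in> sets lebesgue"
        "ennreal r * emeasure \<mu> I < emeasure \<mu> (E \<inter> I)"
      obtain b k where b: "I = hcube b k" "0 < k" using gridE[OF I(1) l] .
      show "emeasure \<nu> I \<le> ennreal C * emeasure \<nu> (E \<inter> I)"
        unfolding b by (rule H) (use b I in auto)
    next
      fix m :: int and x assume "m < 0" "x \<in> ?Q"
      obtain b where b: "cell a l m x = hcube b (l * 2 powi m)" using l by (rule cell_hcubeE)
      obtain b' where b': "cell a l (m + 1) x = hcube b' (l * 2 powi (m + 1))" using l by (rule cell_hcubeE)
      have eq: "l * 2 powi (m + 1) = 2 * (l * 2 powi m)" by (simp add: power_int_add)
      have "hcube b (l * 2 powi m) \<subseteq> hcube b' (2 * (l * 2 powi m))"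
        using cell_mono[of m "m + 1" a l x] unfolding b b' eq by simp
      then show "emeasure \<nu> (cell a l (m + 1) x) \<le> ennreal D * emeasure \<nu> (cell a l m x)"
        unfolding b b' eq using l by (intro dbl) auto
    qed
    also have "\<dots> \<le> ennreal (C * (C * D) ^ j) * (ennreal y * ennreal n)"
      using Ey n by (intro mult_left_mono) auto
    also have "\<dots> = ennreal (C * (C * D) ^ j * y * n)" using C CD y n by (simp add: ennreal_mult mult.assoc)
    finally have "n \<le> C * (C * D) ^ j * y * n" using n C CD y by simp
    then have "1 \<le> C * (C * D) ^ j * y" using n0 by simp
    also have "\<dots> \<le> C * D * (C * D) ^ j * y"
      using C D CD y by (intro mult_right_mono) auto
    finally show False using j by simp
  qed
  have "e \<le> 1 / r ^ 2 * y powr (- ln r / ln (C * D)) * q"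
  proof (cases "q = 0")
    case False
    have "e / q \<le> 1 / r ^ 2 * y powr (- ln r / ln (C * D))"
    proof (rule geometric_to_power[OF CD r _ _ y])
      show "e / q \<le> r ^ Suc j" if "(C * D) ^ Suc j * y < 1" for j
        using dec[OF that] False q by (simp add: divide_le_eq)
    qed (use e q eq False in auto)
    then show ?thesis using q False by (simp add: divide_le_eq)
  qed (use eq in simp)
  then show "emeasure \<mu> E \<le> ennreal (1 / r ^ 2 * y powr (- ln r / ln (C * D))) * emeasure \<mu> ?Q"
    using e q r by (simp add: ennreal_mult[symmetric] ennreal_leI del: times_divide_eq_left)
qed

section \<open>The Fujii-Wilson constant\<close>

lemma ennreal_divide_le_iff_mult:
  fixes a b c :: ennreal
  assumes "0 < b" "b < \<infinity>"
  shows "a / b \<le> c \<longleftrightarrow> a \<le> c * b"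
proof -
  have eq: "(x * b) / b = x" "(x / b) * b = x" for x
    using assms by (simp_all add: ennreal_mult_divide_eq ennreal_divide_times)
  show ?thesis
    using divide_right_mono_ennreal[of a "c * b" b] mult_right_mono[of "a / b" c b] eq by auto
qed

section \<open>Averages over cubes, the maximal function and the \<open>A\<^sub>1\<close>
  condition\<close>

lemma ac_weighted:
  assumes "w \<in> borel_measurable lebesgue"
  shows "absolutely_continuous lebesgue (weighted w)"
  unfolding weighted_def using assms by (intro absolutely_continuousI_density) auto

lemma avg_cube:
  fixes a :: "real ^ 'n"
  assumes "w \<in> borel_measurable lebesgue"
  shows "avg (closed_cube a l) w = emeasure (weighted w) (hcube a l) / vol (hcube a l)"
  using assms avg_eq[OF assms, of "closed_cube a l"]
    emeasure_hcube_cbox[of "weighted w" a l] emeasure_hcube_cbox[of lebesgue a l] ac_weighted[OF assms]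
  by (simp add: absolutely_continuous_def)

lemma hcube_pos_finite:
  assumes "0 < l"
  shows "0 < vol (hcube a l)" "vol (hcube a l) < \<infinity>"
  using emeasure_lebesgue_hcube[of l a] assms by auto

lemma maximal_ge:
  fixes a :: "real ^ 'n"
  assumes f: "f \<in> borel_measurable lebesgue" and l: "0 < l" and x: "x \<in> hcube a l"
    and t: "ennreal t * vol (hcube a l) \<le> emeasure (weighted (\<lambda>y. \<bar>f y\<bar>)) (hcube a l)"
  shows "ennreal t \<le> maximal f x"
proof -
  let ?Q = "closed_cube a l"
  have "?Q \<in> {Q \<in> cubes. x \<in> Q}" using l x hcube_subset_cbox by (auto simp: cubes_def)
  then have "avg ?Q (\<lambda>y. \<bar>f y\<bar>) \<le> maximal f x" unfolding maximal_def by (rule SUP_upper)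
  moreover have "ennreal t \<le> avg ?Q (\<lambda>y. \<bar>f y\<bar>)"
  proof -
    have "ennreal t = ennreal t * vol (hcube a l) / vol (hcube a l)"
      using hcube_pos_finite[OF l, of a] by (simp add: ennreal_mult_divide_eq del: emeasure_completion)
    also have "\<dots> \<le> emeasure (weighted (\<lambda>y. \<bar>f y\<bar>)) (hcube a l) / vol (hcube a l)"
      using t by (rule divide_right_mono_ennreal)
    also have "\<dots> = avg ?Q (\<lambda>y. \<bar>f y\<bar>)" using f by (subst avg_cube) auto
    finally show ?thesis .
  qed
  ultimately show ?thesis by simp
qed

lemma maximal_ge_avg:
  fixes a :: "real ^ 'n"
  assumes f: "f \<in> borel_measurable lebesgue" and l: "0 < l" and x: "x \<in> hcube a l"
  shows "emeasure (weighted (\<lambda>y. \<bar>f y\<bar>)) (hcube a l) \<le> maximal f x * vol (hcube a l)"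
proof -
  let ?Q = "closed_cube a l"
  have "?Q \<in> {Q \<in> cubes. x \<in> Q}" using l x hcube_subset_cbox by (auto simp: cubes_def)
  then have "avg ?Q (\<lambda>y. \<bar>f y\<bar>) \<le> maximal f x" unfolding maximal_def by (rule SUP_upper)
  moreover have "avg ?Q (\<lambda>y. \<bar>f y\<bar>) = emeasure (weighted (\<lambda>y. \<bar>f y\<bar>)) (hcube a l) / vol (hcube a l)"
    using f by (subst avg_cube) auto
  ultimately show ?thesis
    using ennreal_divide_le_iff_mult[OF hcube_pos_finite[OF l, of a]] by metis
qed

lemma maximal_gtD:
  fixes f :: "real ^ 'n \<Rightarrow> real"
  assumes f: "f \<in> borel_measurable lebesgue" and t: "ennreal t < maximal f x"
  obtains a l where "0 < l" "x \<in> closed_cube a l"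
    "ennreal t * vol (closed_cube a l)
      < emeasure (weighted (\<lambda>y. \<bar>f y\<bar>)) (closed_cube a l)"
proof -
  obtain Q where "Q \<in> cubes" "x \<in> Q" and Q: "ennreal t < avg Q (\<lambda>y. \<bar>f y\<bar>)"
    using t unfolding maximal_def less_SUP_iff by auto
  then obtain a l where al: "Q = closed_cube a l" "0 < l" by (auto simp: cubes_def)
  have "avg Q (\<lambda>y. \<bar>f y\<bar>) = emeasure (weighted (\<lambda>y. \<bar>f y\<bar>)) Q / vol Q"
    using f al by (intro avg_eq) auto
  moreover have "0 < vol Q" "vol Q < \<infinity>"
    unfolding al(1) emeasure_lebesgue_cbox_cube[OF less_imp_le[OF al(2)]] using al(2) by auto
  ultimately have "\<not> emeasure (weighted (\<lambda>y. \<bar>f y\<bar>)) Q \<le> ennreal t * vol Q"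
    using Q ennreal_divide_le_iff_mult by (metis not_less)
  then show ?thesis using that[of l a] al \<open>x \<in> Q\<close> by (simp add: not_le)
qed

lemma A1_maximal:
  assumes u: "weight u" and A: "A1_const u = ennreal A"
  shows "AE x in lebesgue. 0 < u x \<and> maximal u x \<le> ennreal A * ennreal (u x)"
proof -
  have "AE x in lebesgue. maximal u x / ennreal (u x) \<le> ennreal A"
    using esssup_AE[of "\<lambda>x. maximal u x / ennreal (u x)" lebesgue] A by (simp add: A1_const_def)
  moreover have "AE x in lebesgue. 0 < u x" using u by (simp add: weight_def)
  ultimately show ?thesis
    by eventually_elim (auto simp: ennreal_divide_le_iff_mult)
qed

lemma weight_abs: "weight w \<Longrightarrow> (\<lambda>y. \<bar>w y\<bar>) = w"
  by (auto simp: weight_def)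

text \<open>At almost every point of \<open>E\<close> the average of \<open>u\<close> over the whole
  cube is at most \<open>maximal u x\<close>, hence at most \<open>A * u x\<close>. Integrating this
  over \<open>E\<close> gives the inequality, here with denominators cleared.\<close>

lemma A1_cube:
  fixes a :: "real ^ 'n"
  assumes u: "weight u" and A: "A1_const u = ennreal A" and l: "0 < l"
    and E: "E \<in> sets lebesgue" "E \<subseteq> hcube a l"
  shows "vol E * emeasure (weighted u) (hcube a l)
    \<le> ennreal A * vol (hcube a l) * emeasure (weighted u) E"
proof -
  let ?Q = "hcube a l"
  note um = weight_measurable[OF u]
  have "vol E * emeasure (weighted u) ?Q = (\<integral>\<^sup>+x. emeasure (weighted u) ?Q * indicator E x \<partial>lebesgue)"
    using E(1) by (subst nn_integral_cmult_indicator) (auto simp: mult.commute)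
  also have "\<dots> \<le> (\<integral>\<^sup>+x. (ennreal A * vol ?Q) * (ennreal (u x) * indicator E x) \<partial>lebesgue)"
  proof (rule nn_integral_mono_AE)
    show "AE x in lebesgue. emeasure (weighted u) ?Q * indicator E x
        \<le> (ennreal A * vol ?Q) * (ennreal (u x) * indicator E x)"
      using A1_maximal[OF u A]
    proof eventually_elim
      case (elim x)
      show ?case
      proof (cases "x \<in> E")
        case True
        have "emeasure (weighted u) ?Q \<le> maximal u x * vol ?Q"
          using maximal_ge_avg[OF um l, of x a] True E(2) weight_abs[OF u] by auto
        also have "\<dots> \<le> (ennreal A * ennreal (u x)) * vol ?Q"
          using elim by (intro mult_right_mono) auto
        finally show ?thesis using True by (simp add: mult_ac)
      qed auto
    qed
  qed
  also have "\<dots> = ennreal A * vol ?Q * emeasure (weighted u) E"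
    using um E(1) by (subst nn_integral_cmult) (auto simp: emeasure_weighted)
  finally show ?thesis .
qed

text \<open>Restricting \<open>V\<close> to the root makes its total mass finite. A stopping cell
  has positive restricted mass and so meets the root; if it were not inside, it would contain the
  root, and then its restricted average would be at most \<open>t\<close>.\<close>

lemma local_Calderon_Zygmund:
  fixes p :: "real ^ 'n"
  assumes s: "0 < s" and V: "ac_loc_finite V" and t: "0 < t"
    and le: "emeasure V (hcube p s) \<le> ennreal t * vol (hcube p s)"
  obtains T where "T \<subseteq> grid p s" "countable T" "disjoint T" "\<And>I. I \<in> T \<Longrightarrow> I \<subseteq> hcube p s"
    "\<And>I. I \<in> T \<Longrightarrow> ennreal t * vol I < emeasure V I"
    "\<And>I. I \<in> T \<Longrightarrow> emeasure V I \<le> ennreal (2 ^ CARD('n) * t) * vol I"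
    "\<And>J. J \<in> grid p s \<Longrightarrow> ennreal t * vol J < emeasure V (hcube p s \<inter> J) \<Longrightarrow> \<exists>I\<in>T. J \<subseteq> I"
proof -
  let ?Q = "hcube p s"
  note setsV = ac_loc_finite_sets[OF V]
  have spV: "space V = UNIV" using sets_eq_imp_space_eq[OF setsV] by simp
  define G where "G = density V (indicator ?Q)"
  have setsG: "sets G = sets lebesgue" by (simp add: G_def setsV)
  have G: "emeasure G X = emeasure V (?Q \<inter> X)" if "X \<in> sets lebesgue" for X
    unfolding G_def using that setsV by (intro emeasure_restricted) auto
  have Gfin: "emeasure G UNIV < \<infinity>" using G[of UNIV] ac_loc_finite_hcube[OF V, of p s] by simp
  obtain T where T: "T \<subseteq> grid p s" "countable T" "disjoint T"
    "\<And>I. I \<in> T \<Longrightarrow> ennreal t * vol I < emeasure G I"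
    "\<And>I. I \<in> T \<Longrightarrow> emeasure G I \<le> ennreal (2 ^ CARD('n) * t) * vol I"
    "\<And>J. J \<in> grid p s \<Longrightarrow> ennreal t * vol J < emeasure G J \<Longrightarrow> \<exists>I\<in>T. J \<subseteq> I"
    using Calderon_Zygmund[OF s setsG Gfin t, where p = p] by metis
  have sub: "I \<subseteq> ?Q" if I: "I \<in> T" for I
  proof (rule ccontr)
    assume n: "\<not> I \<subseteq> ?Q"
    have IG: "I \<in> grid p s" using I T(1) by blast
    then have IL: "I \<in> sets lebesgue" using s by (rule grid_lebesgue)
    have GI: "emeasure G I = emeasure V (?Q \<inter> I)" using G[OF IL] .
    have "?Q \<inter> I \<noteq> {}"
    proof
      assume "?Q \<inter> I = {}"
      then show False using T(4)[OF I] GI by simp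
    qed
    then have QI: "?Q \<subseteq> I" using grid_nested[OF IG hcube_in_grid[OF s, of p]] n by blast
    have "emeasure V (?Q \<inter> I) = emeasure V ?Q" using QI by (simp add: Int_absorb2)
    also note le
    also have "ennreal t * vol ?Q \<le> ennreal t * vol I"
      using QI IL by (intro mult_left_mono emeasure_mono) auto
    finally show False using T(4)[OF I] GI by simp
  qed
  have GV: "emeasure G I = emeasure V I" if "I \<in> T" for I
    using G[of I] sub[OF that] that T(1) grid_lebesgue[OF _ s, of I p] by (auto simp: Int_absorb1)
  show ?thesis
  proof (rule that[OF T(1-3) sub])
    fix J assume J: "J \<in> grid p s" "ennreal t * vol J < emeasure V (hcube p s \<inter> J)"
    then show "\<exists>I\<in>T. J \<subseteq> I" using T(6)[of J] G[OF grid_lebesgue[OF J(1) s]] by simp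
  qed (use T(4,5) GV in auto)
qed

lemma local_Calderon_Zygmund_levels:
  fixes p :: "real ^ 'n" and t :: "nat \<Rightarrow> real"
  assumes s: "0 < s" and V: "ac_loc_finite V" and t: "\<And>k. 0 < t k"
    and le: "\<And>k. emeasure V (hcube p s) \<le> ennreal (t k) * vol (hcube p s)"
  obtains T where "\<And>k. T k \<subseteq> grid p s" "\<And>k. countable (T k)" "\<And>k. disjoint (T k)"
    "\<And>k I. I \<in> T k \<Longrightarrow> I \<subseteq> hcube p s"
    "\<And>k I. I \<in> T k \<Longrightarrow> ennreal (t k) * vol I < emeasure V I"
    "\<And>k I. I \<in> T k \<Longrightarrow> emeasure V I \<le> ennreal (2 ^ CARD('n) * t k) * vol I"
    "\<And>k J. J \<in> grid p s \<Longrightarrow> ennreal (t k) * vol J < emeasure V (hcube p s \<inter> J) \<Longrightarrow> \<exists>I\<in>T k. J \<subseteq> I"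
    "\<And>k. T k \<subseteq> sets lebesgue" "\<And>k. \<Union>(T k) \<in> sets lebesgue"
proof -
  have "\<forall>k. \<exists>T. T \<subseteq> grid p s \<and> countable T \<and> disjoint T \<and> (\<forall>I\<in>T. I \<subseteq> hcube p s) \<and>
    (\<forall>I\<in>T. ennreal (t k) * vol I < emeasure V I) \<and>
    (\<forall>I\<in>T. emeasure V I \<le> ennreal (2 ^ CARD('n) * t k) * vol I) \<and>
    (\<forall>J\<in>grid p s. ennreal (t k) * vol J < emeasure V (hcube p s \<inter> J) \<longrightarrow> (\<exists>I\<in>T. J \<subseteq> I))"
    using local_Calderon_Zygmund[OF s V t le] by metis
  then obtain T where T: "\<And>k. T k \<subseteq> grid p s" "\<And>k. countable (T k)" "\<And>k. disjoint (T k)"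
    "\<And>k I. I \<in> T k \<Longrightarrow> I \<subseteq> hcube p s"
    "\<And>k I. I \<in> T k \<Longrightarrow> ennreal (t k) * vol I < emeasure V I"
    "\<And>k I. I \<in> T k \<Longrightarrow> emeasure V I \<le> ennreal (2 ^ CARD('n) * t k) * vol I"
    "\<And>k J. J \<in> grid p s \<Longrightarrow> ennreal (t k) * vol J < emeasure V (hcube p s \<inter> J) \<Longrightarrow> \<exists>I\<in>T k. J \<subseteq> I"
    by metis
  have setsT: "T k \<subseteq> sets lebesgue" for k using T(1) grid_lebesgue[OF _ s] by blast
  then have U: "\<Union>(T k) \<in> sets lebesgue" for k using T(2) by (intro sets.countable_Union) auto
  show ?thesis by (rule that[of T]) (fact T setsT U)+
qed

section \<open>From the Fujii-Wilson constant to the \<open>A\<^sub>\<infinity>\<close> condition on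
  cubes\<close>

lemma weighted_abs_indicator:
  assumes v: "weight v" and Q: "Q \<in> sets lebesgue" "E \<in> sets lebesgue"
  shows "emeasure (weighted (\<lambda>y. \<bar>v y * indicator Q y\<bar>)) E = emeasure (weighted v) (Q \<inter> E)"
proof -
  have "emeasure (weighted (\<lambda>y. \<bar>v y * indicator Q y\<bar>)) E
      = (\<integral>\<^sup>+x. ennreal \<bar>v x * indicator Q x\<bar> * indicator E x \<partial>lebesgue)"
    using weight_measurable[OF v] Q by (intro emeasure_weighted) auto
  also have "\<dots> = (\<integral>\<^sup>+x. ennreal (v x) * indicator (Q \<inter> E) x \<partial>lebesgue)"
    using v by (intro nn_integral_cong) (auto simp: weight_def indicator_def)
  also have "\<dots> = emeasure (weighted v) (Q \<inter> E)"
    using weight_measurable[OF v] Q by (intro emeasure_weighted[symmetric]) auto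
  finally show ?thesis .
qed

text \<open>Summing \<open>2 ^ k \<bar>\<Omega>\<^sub>k\<bar>\<close> over the level sets \<open>\<Omega>\<^sub>k\<close> of the dyadic maximal function bounds
  \<open>N v(\<Omega>\<^sub>N)\<close> by the integral of \<open>M(v \<chi>\<^sub>Q)\<close>.\<close>

lemma Ainf_const_imp_cube_Ainf:
  assumes K: "0 \<le> K"
  shows "\<exists>\<delta>>0. \<forall>v :: real ^ 'n \<Rightarrow> real. weight v \<longrightarrow> Ainf_const v \<le> ennreal K \<longrightarrow> cube_Ainf \<delta> (1 / 2) (weighted v)"
proof -
  \<comment> \<open>The summation over levels will give
    \<open>N * w \<le> 2 ^ (n + 1) * K * q\<close> for the mass \<open>w\<close> of the top level
    set; this choice of \<open>N\<close> turns it into \<open>w \<le> q / 4\<close>.\<close>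
  obtain N :: nat where N: "2 ^ (CARD('n) + 3) * K \<le> real N" "0 < N"
  proof -
    obtain N :: nat where "2 ^ (CARD('n) + 3) * K \<le> real N" using real_arch_simple by blast
    then show thesis by (intro that[of "Suc N"]) auto
  qed
  \<comment> \<open>Off the top level set the density is essentially at most
    \<open>t N = 2 ^ N * q / L\<close>, so a set of volume fraction \<delta> has mass at most
    \<open>q / 4\<close> there. With the quarter on the level set this makes \<theta> equal to
    \<open>1 / 2\<close>.\<close>
  define \<delta> :: real where "\<delta> = 1 / (4 * 2 ^ N)"
  have \<delta>: "0 < \<delta>" by (simp add: \<delta>_def)
  show ?thesis
  proof (intro exI[of _ \<delta>] conjI \<delta> allI impI)
    fix v :: "real ^ 'n \<Rightarrow> real"
    assume v: "weight v" and Kv: "Ainf_const v \<le> ennreal K"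
    let ?V = "weighted v"
    note vm = weight_measurable[OF v] and V = weight_ac_loc_finite[OF v]
    show "cube_Ainf \<delta> (1 / 2) ?V"
      unfolding cube_Ainf_def
    proof (intro allI impI)
      fix p :: "real ^ 'n" and s :: real and E
      assume s: "0 < s" and E: "E \<in> sets lebesgue" "E \<subseteq> hcube p s"
        and small: "vol E \<le> ennreal \<delta> * vol (hcube p s)"
      let ?Q = "hcube p s" and ?Q' = "closed_cube p s"
      let ?f = "\<lambda>y. v y * indicator ?Q' y"
      obtain q where q: "emeasure ?V ?Q = ennreal q" "0 < q"
        using ac_loc_finite_hcube[OF V, of p s] weight_hcube_pos[OF v s, of p] by (cases "emeasure ?V ?Q") auto
      define L where "L = s ^ CARD('n)"
      have L: "vol ?Q = ennreal L" "0 < L"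
        using emeasure_lebesgue_hcube[of s p] s by (auto simp: L_def)
      define t where "t k = 2 ^ k * (q / L)" for k :: nat
      have t: "0 < t k" for k using q L by (simp add: t_def)
      have le: "emeasure ?V ?Q \<le> ennreal (t k) * vol ?Q" for k
      proof -
        have "q \<le> t k * L" using q L by (simp add: t_def field_simps)
        then show ?thesis using q L t[of k] by (simp add: ennreal_mult[symmetric] del: emeasure_completion)
      qed
      obtain T where T: "\<And>k. T k \<subseteq> grid p s" "\<And>k. countable (T k)" "\<And>k. disjoint (T k)"
        "\<And>k I. I \<in> T k \<Longrightarrow> I \<subseteq> ?Q"
        "\<And>k I. I \<in> T k \<Longrightarrow> ennreal (t k) * vol I < emeasure ?V I"
        "\<And>k I. I \<in> T k \<Longrightarrow> emeasure ?V I \<le> ennreal (2 ^ CARD('n) * t k) * vol I"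
        "\<And>k J. J \<in> grid p s \<Longrightarrow> ennreal (t k) * vol J < emeasure ?V (?Q \<inter> J) \<Longrightarrow> \<exists>I\<in>T k. J \<subseteq> I"
        and setsT: "\<And>k. T k \<subseteq> sets lebesgue" and \<Omega>: "\<And>k. \<Union>(T k) \<in> sets lebesgue"
        using local_Calderon_Zygmund_levels[where t = t, OF s V t le] by blast
      have max: "ennreal (t k) \<le> maximal ?f x" if x: "x \<in> \<Union>(T k)" for k x
      proof -
        obtain I where I: "I \<in> T k" "x \<in> I" using x by blast
        obtain b r where b: "I = hcube b r" "0 < r" using gridE[of I p s] I T(1) s by blast
        have "?Q' \<inter> I = I" using T(4)[OF I(1)] hcube_subset_cbox by blast
        then have "emeasure (weighted (\<lambda>y. \<bar>?f y\<bar>)) (hcube b r) = emeasure ?V I"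
          using weighted_abs_indicator[OF v, of ?Q' "hcube b r"] b by simp
        then show ?thesis
          using T(5)[OF I(1)] b I borel_measurable_times[OF vm borel_measurable_indicator[of ?Q' lebesgue]]
          by (intro maximal_ge[of ?f r x b]) auto
      qed
      \<comment> \<open>At the highest level containing \<open>x\<close>, the sum of the halves
        \<open>t k / 2\<close> up to that level is geometric and at most \<open>t m\<close>, which
        is a lower bound for the maximal function. Higher levels contribute nothing.\<close>
      have sum_le: "(\<Sum>k<m. ennreal (t k / 2) * indicator (\<Union>(T k)) x) \<le> maximal ?f x" for m x
      proof (induction m)
        case (Suc m)
        show ?case
        proof (cases "x \<in> \<Union>(T m)")
          case True
          have "(\<Sum>k<Suc m. ennreal (t k / 2) * indicator (\<Union>(T k)) x) \<le> (\<Sum>k<Suc m. ennreal (t k / 2))"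
            by (intro sum_mono) (auto simp: indicator_def)
          also have "\<dots> = ennreal (\<Sum>k<Suc m. t k / 2)" using t by (intro sum_ennreal) (auto intro: less_imp_le)
          also have "\<dots> \<le> ennreal (t m)"
          proof (rule ennreal_leI)
            have "(\<Sum>k<n. 2 ^ k * c) = (2 ^ n - 1) * c" for n and c :: real
              by (induction n) (simp_all add: algebra_simps)
            from this[of "q / L" "Suc m"] have "(\<Sum>k<Suc m. t k) \<le> 2 ^ Suc m * (q / L)" using q L 
              unfolding t_def by (simp add: mult_right_mono del: times_divide_eq_right power_Suc sum.lessThan_Suc)
            then have "(\<Sum>k<Suc m. t k) \<le> 2 * t m" by (simp add: t_def)
            then show "(\<Sum>k<Suc m. t k / 2) \<le> t m" by (simp only: sum_divide_distrib[symmetric])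
          qed
          also have "\<dots> \<le> maximal ?f x" by (rule max[OF True])
          finally show ?thesis .
        next
          case False
          then show ?thesis using Suc by simp
        qed
      qed simp
      have int: "(\<Sum>k<N. ennreal (t k / 2) * vol (\<Union>(T k))) \<le> ennreal K * ennreal q"
      proof -
        have "(\<Sum>k<N. ennreal (t k / 2) * vol (\<Union>(T k)))
          = (\<Sum>k<N. (\<integral>\<^sup>+x. ennreal (t k / 2) * indicator (\<Union>(T k)) x \<partial>lebesgue))"
          using \<Omega> by (intro sum.cong refl nn_integral_cmult_indicator[symmetric]) auto
        also have "\<dots> = (\<integral>\<^sup>+x. (\<Sum>k<N. ennreal (t k / 2) * indicator (\<Union>(T k)) x) \<partial>lebesgue)"
          using \<Omega> by (intro nn_integral_sum[symmetric]) auto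
        also have "\<dots> \<le> (\<integral>\<^sup>+x\<in>?Q'. maximal ?f x \<partial>lebesgue)"
        proof (rule nn_integral_mono)
          fix x
          show "(\<Sum>k<N. ennreal (t k / 2) * indicator (\<Union>(T k)) x) \<le> maximal ?f x * indicator ?Q' x"
          proof (cases "x \<in> ?Q'")
            case False
            then have "x \<notin> \<Union>(T k)" for k using T(4) hcube_subset_cbox by blast
            then show ?thesis by simp
          qed (use sum_le[where m = N and x = x] in simp)
        qed
        also have "\<dots> \<le> ennreal K * ennreal q"
        proof -
          have cQ: "?Q' \<in> cubes" using s by (auto simp: cubes_def)
          have VQ': "(\<integral>\<^sup>+x\<in>?Q'. ennreal (v x) \<partial>lebesgue) = ennreal q"
            using emeasure_weighted[OF vm, of ?Q'] emeasure_hcube_cbox[of ?V p s] ac_weighted[OF vm] q by simp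
          define F where "F Q = (\<integral>\<^sup>+x\<in>Q. maximal (\<lambda>y. v y * indicator Q y) x \<partial>lebesgue)
            / (\<integral>\<^sup>+x\<in>Q. ennreal (v x) \<partial>lebesgue)" for Q
          have "F ?Q' \<le> (SUP Q\<in>cubes. F Q)" using cQ by (rule SUP_upper)
          also have "\<dots> \<le> ennreal K" using Kv unfolding Ainf_const_def F_def .
          finally have "(\<integral>\<^sup>+x\<in>?Q'. maximal ?f x \<partial>lebesgue) / ennreal q \<le> ennreal K"
            unfolding F_def VQ' .
          then show ?thesis using q(2) by (subst (asm) ennreal_divide_le_iff_mult) auto
        qed
        finally show ?thesis .
      qed
      let ?W = "\<Union>(T N)"
      have QF: "emeasure ?V X \<le> ennreal q" if "X \<subseteq> ?Q" for X
        using emeasure_mono[OF that, of ?V] q by simp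
      have WQ: "?W \<subseteq> ?Q" using T(4) by blast
      obtain w where w: "emeasure ?V ?W = ennreal w" "0 \<le> w"
        using QF[OF WQ] by (cases "emeasure ?V ?W") (auto simp: top_unique)
      \<comment> \<open>The level sets decrease in \<open>k\<close>, and each stopping cell at
        height \<open>t k\<close> has average at most \<open>2 ^ n * t k\<close>. So all
        \<open>N\<close> terms of the sum are bounded below by the same mass
        \<open>w\<close>.\<close>
      have Vk: "ennreal w \<le> ennreal (2 ^ CARD('n) * 2) * (ennreal (t k / 2) * vol (\<Union>(T k)))" if k: "k < N" for k
      proof -
        have "?W \<subseteq> \<Union>(T k)"
        proof
          fix x assume "x \<in> ?W"
          then obtain I where I: "I \<in> T N" "x \<in> I" by blast
          have "t k \<le> t N" using k q L by (simp add: t_def divide_right_mono mult_right_mono)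
          then have "ennreal (t k) * vol I \<le> ennreal (t N) * vol I"
            by (intro mult_right_mono ennreal_leI) auto
          also have "\<dots> < emeasure ?V (?Q \<inter> I)" using T(5)[OF I(1)] T(4)[OF I(1)] by (simp add: Int_absorb1)
          finally obtain J where "J \<in> T k" "I \<subseteq> J" using T(7) T(1) I(1) by blast
          then show "x \<in> \<Union>(T k)" using I by blast
        qed
        then have "ennreal w \<le> emeasure ?V (UNIV \<inter> \<Union>(T k))" using w \<Omega> by (simp add: emeasure_mono flip: w(1))
        also have "\<dots> \<le> ennreal (2 ^ CARD('n) * t k) * vol (UNIV \<inter> \<Union>(T k))"
          using setsT T(6) by (intro emeasure_Union_mono[OF T(2,3)]) (auto simp: subset_iff)
        also have "ennreal (2 ^ CARD('n) * t k) = ennreal (2 ^ CARD('n) * 2) * ennreal (t k / 2)"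
          using t[of k] by (subst ennreal_mult[symmetric]) auto
        finally show ?thesis by (simp add: mult.assoc)
      qed
      have "ennreal (real N * w) = (\<Sum>k<N. ennreal w)"
        using w by (simp add: ennreal_mult ennreal_of_nat_eq_real_of_nat)
      also have "\<dots> \<le> (\<Sum>k<N. ennreal (2 ^ CARD('n) * 2) * (ennreal (t k / 2) * vol (\<Union>(T k))))"
        by (intro sum_mono Vk) simp
      also have "\<dots> \<le> ennreal (2 ^ CARD('n) * 2) * (ennreal K * ennreal q)"
        unfolding sum_distrib_left[symmetric] using int by (intro mult_left_mono) auto
      also have "\<dots> = ennreal (2 ^ CARD('n) * 2 * (K * q))"
        using K q by (simp add: ennreal_mult[symmetric] mult.assoc)
      finally have "real N * w \<le> 2 ^ CARD('n) * 2 * (K * q)" using K q by (subst (asm) ennreal_le_iff) auto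
      moreover have "2 ^ (CARD('n) + 3) * K * q \<le> real N * q" using N(1) q by (intro mult_right_mono) auto
      ultimately have "real N * (4 * w) \<le> real N * q" by (simp add: power_add)
      then have w4: "w \<le> q / 4" using N(2) by simp
      \<comment> \<open>A cell that meets the complement of the top level set lies in no stopping
        cell, so its average is at most \<open>t N\<close>. This stands for the bound
        \<open>v \<le> t N\<close> almost everywhere off the level set.\<close>
      have "emeasure ?V (E - ?W) \<le> ennreal (t N) * vol (E - ?W)"
      proof (rule emeasure_le_of_cells[OF s _ ac_loc_finite_lebesgue])
        fix I assume I: "I \<in> grid p s" "I \<subseteq> ?Q" "I \<inter> (E - ?W) \<noteq> {}"
        have "\<not> ennreal (t N) * vol I < emeasure ?V (?Q \<inter> I)"
        proof
          assume "ennreal (t N) * vol I < emeasure ?V (?Q \<inter> I)"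
          then obtain J where "J \<in> T N" "I \<subseteq> J" using T(7)[OF I(1)] by blast
          then show False using I(3) by blast
        qed
        moreover have "emeasure ?V ((E - ?W) \<inter> I) \<le> emeasure ?V (?Q \<inter> I)"
          using E(2) grid_lebesgue[OF I(1) s] by (intro emeasure_mono) auto
        ultimately show "emeasure ?V ((E - ?W) \<inter> I) \<le> ennreal (t N) * vol I" by simp
      qed (use E \<Omega> in auto)
      also have "\<dots> \<le> ennreal (t N) * (ennreal \<delta> * ennreal L)"
      proof -
        have "vol (E - ?W) \<le> vol E" using E(1) by (intro emeasure_mono) auto
        then show ?thesis using small L(1) by (intro mult_left_mono) auto
      qed
      also have "\<dots> = ennreal (q / 4)"
        using t[of N] \<delta> L q by (simp add: ennreal_mult[symmetric]) (simp add: t_def \<delta>_def)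
      finally have "emeasure ?V (E - ?W) \<le> ennreal (q / 4)" .
      moreover have "emeasure ?V (E \<inter> ?W) \<le> ennreal (q / 4)"
      proof -
        have "emeasure ?V (E \<inter> ?W) \<le> emeasure ?V ?W" using \<Omega>[of N] by (intro emeasure_mono) auto
        also have "\<dots> \<le> ennreal (q / 4)" using w w4 by (simp add: ennreal_leI)
        finally show ?thesis .
      qed
      moreover have "emeasure ?V E = emeasure ?V (E \<inter> ?W) + emeasure ?V (E - ?W)"
        using emeasure_split[of ?V "E \<inter> ?W" E] E \<Omega>[of N] by (simp add: Diff_Int_distrib Int_commute Diff_Int)
      ultimately have "emeasure ?V E \<le> ennreal (q / 4) + ennreal (q / 4)" by (simp add: add_mono)
      also have "\<dots> = ennreal (1 / 2) * ennreal q"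
        using q by (subst ennreal_mult[symmetric]) (simp_all add: ennreal_plus[symmetric] del: ennreal_plus)
      finally show "emeasure ?V E \<le> ennreal (1 / 2) * emeasure ?V ?Q" by (simp add: q)
    qed
  qed
qed

text \<open>Chebyshev's inequality for \<open>v powr (- 1 / (p - 1))\<close> bounds \<open>v\<close> from below on half of each cube.\<close>

lemma Ap_imp_cube_Ainf:
  fixes v :: "real ^ 'n \<Rightarrow> real"
  assumes p: "1 < p" and v: "v \<in> Ap p"
  shows "\<exists>\<theta>. 0 \<le> \<theta> \<and> \<theta> < 1 \<and> cube_Ainf (1 / 2) \<theta> (weighted v)"
proof -
  have w: "weight v" and fin: "Ap_const p v < \<infinity>" using v by (auto simp: Ap_def)
  note vm = weight_measurable[OF w] and V = weight_ac_loc_finite[OF w]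
  let ?V = "weighted v"
  define \<sigma> where "\<sigma> x = v x powr (- 1 / (p - 1))" for x
  have \<sigma>m: "\<sigma> \<in> borel_measurable lebesgue" unfolding \<sigma>_def using vm by measurable
  have \<sigma>0: "0 \<le> \<sigma> x" for x by (simp add: \<sigma>_def)
  obtain A where A: "Ap_const p v = ennreal A" "0 \<le> A" using fin by (cases "Ap_const p v") auto
  \<comment> \<open>At least a quarter of the cube lies outside \<open>E\<close> and satisfies
    \<open>\<sigma> \<le> 4 * S\<close>, that is \<open>v \<ge> (4 * S) powr (- (p - 1))\<close>.
    The \<open>A\<^sub>p\<close> inequality bounds \<open>q\<close> by
    \<open>A * L * S powr (- (p - 1))\<close>, and comparing the two leaves exactly this factor;
    \<open>A + 1\<close> keeps the denominator positive.\<close>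
  define \<kappa> where "\<kappa> = 4 powr (- (p - 1)) / (4 * (A + 1))"
  have \<kappa>: "0 < \<kappa>" using A by (simp add: \<kappa>_def)
  show ?thesis
  \<comment> \<open>The maximum with 0 provides a non-negative \<theta> without comparing \<kappa>
    with 1.\<close>
  proof (intro exI[of _ "max 0 (1 - \<kappa>)"] conjI)
    show "0 \<le> max 0 (1 - \<kappa>)" "max 0 (1 - \<kappa>) < 1" using \<kappa> by auto
    show "cube_Ainf (1 / 2) (max 0 (1 - \<kappa>)) ?V"
      unfolding cube_Ainf_def
    proof (intro allI impI)
      fix a :: "real ^ 'n" and l E
      assume l: "0 < l" and E: "E \<in> sets lebesgue" "E \<subseteq> hcube a l"
        and small: "vol E \<le> ennreal (1 / 2) * vol (hcube a l)"
      let ?Q = "hcube a l" and ?Q' = "closed_cube a l"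
      obtain q where q: "emeasure ?V ?Q = ennreal q" "0 < q"
        using ac_loc_finite_hcube[OF V, of a l] weight_hcube_pos[OF w l, of a] by (cases "emeasure ?V ?Q") auto
      define L where "L = l ^ CARD('n)"
      have L: "vol ?Q = ennreal L" "0 < L"
        using emeasure_lebesgue_hcube[of l a] l by (auto simp: L_def)
      have cQ: "?Q' \<in> cubes" using l by (auto simp: cubes_def)
      have avgV: "avg ?Q' v = ennreal (q / L)"
        unfolding avg_cube[OF vm] q(1) L(1) using q L by (simp add: divide_ennreal)
      have avgS: "avg ?Q' \<sigma> = emeasure (weighted \<sigma>) ?Q / ennreal L"
        unfolding avg_cube[OF \<sigma>m] L(1) ..
      have prod: "avg ?Q' v * ennreal_pow (avg ?Q' \<sigma>) (p - 1) \<le> ennreal A"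
        using SUP_upper[OF cQ, of "\<lambda>Q. avg Q v * ennreal_pow (avg Q \<sigma>) (p - 1)"] A(1)
        unfolding Ap_const_def \<sigma>_def by simp
      have "avg ?Q' \<sigma> \<noteq> \<infinity>"
      proof
        assume "avg ?Q' \<sigma> = \<infinity>"
        then have "avg ?Q' v * ennreal_pow (avg ?Q' \<sigma>) (p - 1) = \<infinity>"
          using avgV q L by (simp add: ennreal_pow_def ennreal_mult_top)
        then show False using prod by (simp add: top_unique)
      qed
      then obtain S where S: "avg ?Q' \<sigma> = ennreal S" "0 \<le> S" by (cases "avg ?Q' \<sigma>") auto
      have intS: "emeasure (weighted \<sigma>) ?Q = ennreal (S * L)"
      proof -
        have "emeasure (weighted \<sigma>) ?Q = emeasure (weighted \<sigma>) ?Q / ennreal L * ennreal L"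
          using L(2) by (simp add: ennreal_divide_times ennreal_mult_divide_eq)
        then show ?thesis using S L avgS by (simp add: ennreal_mult)
      qed
      have Spos: "0 < S"
      proof (rule ccontr)
        assume "\<not> 0 < S"
        then have "(\<integral>\<^sup>+x\<in>?Q. ennreal (\<sigma> x) \<partial>lebesgue) = 0" using S intS emeasure_weighted[OF \<sigma>m, of ?Q] by simp
        then have "AE x in lebesgue. ennreal (\<sigma> x) * indicator ?Q x = 0"
          using \<sigma>m by (subst (asm) nn_integral_0_iff_AE) auto
        moreover have "AE x in lebesgue. 0 < v x" using w by (simp add: weight_def)
        ultimately have "AE x in lebesgue. x \<notin> ?Q"
          by eventually_elim (auto simp: indicator_def \<sigma>_def split: if_splits)
        then have "vol ?Q = 0" by (subst (asm) AE_iff_measurable[of ?Q]) auto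
        then show False using L by simp
      qed
      have qS: "q / L * S powr (p - 1) \<le> A"
        using prod unfolding avgV S ennreal_pow_def using S(2) q L A
        by (simp add: ennreal_mult[symmetric])
      define F where "F = ?Q - E"
      define B where "B = {x \<in> ?Q. 4 * S < \<sigma> x}"
      \<comment> \<open>Where \<open>v\<close> vanishes, the convention \<open>0 powr a = 0\<close>
        makes \<sigma> vanish too, so a small \<sigma> gives no lower bound for \<open>v\<close>
        there. This null set is removed separately.\<close>
      define Z where "Z = {x. \<not> 0 < v x}"
      have sF: "F \<in> sets lebesgue" using E by (auto simp: F_def)
      have sB: "B \<in> sets lebesgue" unfolding B_def using \<sigma>m by measurable
      have sZ: "Z \<in> sets lebesgue" 
      proof -
        have "Z = v -` {..0} \<inter> space lebesgue" by (auto simp: Z_def)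
        then show ?thesis using measurable_sets[OF vm, of "{..0}"] by simp
      qed
      have nZ: "vol Z = 0"
        using w sZ unfolding weight_def Z_def by (subst (asm) AE_iff_measurable[of Z]) (auto simp: Z_def)
      have "ennreal (4 * S) * vol B \<le> ennreal (S * L)"
      proof -
        have "ennreal (4 * S) * vol B = (\<integral>\<^sup>+x. ennreal (4 * S) * indicator B x \<partial>lebesgue)"
          using sB by (simp add: nn_integral_cmult_indicator)
        also have "\<dots> \<le> (\<integral>\<^sup>+x. ennreal (\<sigma> x) * indicator ?Q x \<partial>lebesgue)"
          by (intro nn_integral_mono) (auto simp: B_def indicator_def intro!: ennreal_leI)
        finally show ?thesis using intS emeasure_weighted[OF \<sigma>m, of ?Q] by simp
      qed
      moreover have BQ: "vol B \<le> ennreal L"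
        using emeasure_mono[of B ?Q lebesgue] L unfolding B_def by auto
      then obtain b where b: "vol B = ennreal b" "0 \<le> b" by (cases "vol B") (auto simp: top_unique)
      ultimately have b4: "b \<le> L / 4" using Spos L by (simp add: ennreal_mult[symmetric])
      define G where "G = F - B - Z"
      have sG: "G \<in> sets lebesgue" using sF sB sZ by (auto simp: G_def)
      have half: "ennreal (1 / 2) * ennreal L = ennreal (L / 2)"
        using L by (subst ennreal_mult[symmetric]) auto
      have EQ: "vol E \<le> ennreal (L / 2)" using small L half by simp
      have "vol ?Q \<le> vol (G \<union> B \<union> E \<union> Z)"
        using sG sB sZ E by (intro emeasure_mono) (auto simp: G_def F_def)
      also have "\<dots> \<le> vol G + vol B + vol E + vol Z"
        using sG sB sZ E by (intro order_trans[OF emeasure_subadditive] add_mono order_refl) auto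
      finally have Lle: "ennreal L \<le> vol G + ennreal b + vol E" using nZ b L by simp
      have "vol G \<le> vol ?Q"
        by (intro emeasure_mono) (auto simp: G_def F_def)
      then obtain g where g: "vol G = ennreal g" "0 \<le> g" using L by (cases "vol G") (auto simp: top_unique)
      have "ennreal L \<le> ennreal (g + b + L / 2)"
      proof -
        have "ennreal L \<le> ennreal g + ennreal b + ennreal (L / 2)"
          by (rule order_trans[OF Lle]) (simp only: g(1) add_left_mono[OF EQ])
        then show ?thesis using g b L by (simp add: ennreal_mult[symmetric] ennreal_plus[symmetric] del: ennreal_plus)
      qed
      then have gL: "L / 4 \<le> g" using b4 g b L by (subst (asm) ennreal_le_iff) auto
      define \<tau> where "\<tau> = (4 * S) powr (- (p - 1))"
      have "ennreal \<tau> * ennreal g \<le> emeasure ?V G"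
      proof -
        have "ennreal \<tau> * ennreal g = (\<integral>\<^sup>+x. ennreal \<tau> * indicator G x \<partial>lebesgue)"
          using sG g by (simp add: nn_integral_cmult_indicator)
        also have "\<dots> \<le> (\<integral>\<^sup>+x. ennreal (v x) * indicator G x \<partial>lebesgue)"
        proof (intro nn_integral_mono)
          fix x
          have "\<tau> \<le> v x" if "x \<in> G"
          proof -
            have x: "0 < v x" "\<sigma> x \<le> 4 * S" using that by (auto simp: G_def F_def B_def Z_def)
            have "- 1 / (p - 1) * - (p - 1) = 1" using p by (simp add: field_simps)
            then have "\<sigma> x powr (- (p - 1)) = v x" using x by (simp only: \<sigma>_def powr_powr) simp
            moreover have "\<tau> \<le> \<sigma> x powr (- (p - 1))"
              unfolding \<tau>_def using x p by (intro powr_mono2') (auto simp: \<sigma>_def)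
            ultimately show ?thesis by simp
          qed
          then show "ennreal \<tau> * indicator G x \<le> ennreal (v x) * indicator G x"
            by (auto simp: indicator_def intro!: ennreal_leI)
        qed
        finally show ?thesis using emeasure_weighted[OF vm sG] by simp
      qed
      also have "emeasure ?V G \<le> emeasure ?V F" using sF by (intro emeasure_mono) (auto simp: G_def)
      finally have VF: "ennreal (\<tau> * g) \<le> emeasure ?V F" using g by (simp add: ennreal_mult \<tau>_def)
      have "\<kappa> * q \<le> \<tau> * g"
      proof -
        have "q * S powr (p - 1) \<le> A * L" using qS L by (simp add: field_simps)
        then have "q * S powr (p - 1) * S powr (- (p - 1)) \<le> A * L * S powr (- (p - 1))"
          by (intro mult_right_mono) auto
        moreover have "S powr (p - 1) * S powr (- (p - 1)) = 1"
          using Spos by (simp add: powr_add[symmetric])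
        ultimately have qle: "q \<le> A * L * S powr (- (p - 1))" by (simp add: mult.assoc)
        have "\<kappa> * q \<le> \<kappa> * ((A + 1) * L * S powr (- (p - 1)))"
          using \<kappa> L Spos A by (intro mult_left_mono order_trans[OF qle] mult_right_mono) auto
        also have "\<dots> = 4 powr (- (p - 1)) * S powr (- (p - 1)) * (L / 4)"
          using A by (simp add: \<kappa>_def field_simps)
        also have "\<dots> = \<tau> * (L / 4)" using Spos by (simp add: \<tau>_def powr_mult)
        also have "\<dots> \<le> \<tau> * g" using gL by (intro mult_left_mono) (auto simp: \<tau>_def)
        finally show ?thesis .
      qed
      then have VFk: "ennreal (\<kappa> * q) \<le> emeasure ?V F" using VF by (meson ennreal_leI order_trans)
      have split: "ennreal q = emeasure ?V E + emeasure ?V F"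
        using emeasure_split[of ?V E ?Q] E q by (simp add: F_def)
      then obtain e where e: "emeasure ?V E = ennreal e" "0 \<le> e" by (cases "emeasure ?V E") auto
      obtain f where f: "emeasure ?V F = ennreal f" "0 \<le> f" using split by (cases "emeasure ?V F") auto
      have "q = e + f" using split e f q by (simp add: ennreal_plus[symmetric] del: ennreal_plus)
      moreover have "\<kappa> * q \<le> f" using VFk f by simp
      ultimately have "e \<le> (1 - \<kappa>) * q" by (simp add: algebra_simps)
      also have "\<dots> \<le> max 0 (1 - \<kappa>) * q" using q by (intro mult_right_mono) auto
      finally show "emeasure ?V E \<le> ennreal (max 0 (1 - \<kappa>)) * emeasure ?V ?Q"
        using e q by (simp add: ennreal_mult[symmetric] ennreal_leI)
    qed
  qed
qed

text \<open>Meant for triples: the sets \<open>f I\<close> may overlap, so the left side is only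
  subadditive, while the disjoint cells on the right add up exactly.\<close>

lemma emeasure_UN_le_Union:
  assumes T: "countable T" "disjoint T" and sets: "T \<subseteq> sets N" "\<And>I. I \<in> T \<Longrightarrow> f I \<in> sets M"
    and le: "\<And>I. I \<in> T \<Longrightarrow> emeasure M (f I) \<le> c * emeasure N I"
  shows "emeasure M (\<Union>I\<in>T. f I) \<le> c * emeasure N (\<Union>T)"
proof -
  have dis: "disjoint_family_on (\<lambda>I. I) T"
    using T(2) by (auto simp: disjoint_family_on_def disjoint_def)
  have sU: "(\<Union>I\<in>T. f I) \<in> sets M" using T(1) sets(2) by auto
  have "emeasure M (\<Union>I\<in>T. f I) = (\<integral>\<^sup>+x. indicator (\<Union>I\<in>T. f I) x \<partial>M)"
    using sU by simp
  also have "\<dots> \<le> (\<integral>\<^sup>+x. (\<integral>\<^sup>+I. indicator (f I) x \<partial>count_space T) \<partial>M)"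
  proof (rule nn_integral_mono)
    fix x
    show "indicator (\<Union>I\<in>T. f I) x \<le> (\<integral>\<^sup>+I. indicator (f I) x \<partial>count_space T)"
    proof (cases "x \<in> (\<Union>I\<in>T. f I)")
      case True
      then obtain J where J: "J \<in> T" "x \<in> f J" by blast
      have "(indicator (f J) x :: ennreal) \<le> (\<integral>\<^sup>+I. indicator (f I) x \<partial>count_space T)"
        using J(1) by (rule nn_integral_ge_point)
      then show ?thesis using True J by simp
    qed simp
  qed
  also have "\<dots> = (\<integral>\<^sup>+I. (\<integral>\<^sup>+x. indicator (f I) x \<partial>M) \<partial>count_space T)"
    using T(1) sets(2) by (intro nn_integral_count_space_nn_integral) auto
  also have "\<dots> = (\<integral>\<^sup>+I. emeasure M (f I) \<partial>count_space T)"
    using sets(2) by (intro nn_integral_cong) auto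
  also have "\<dots> \<le> (\<integral>\<^sup>+I. c * emeasure N I \<partial>count_space T)"
    by (intro nn_integral_mono) (use le in auto)
  also have "\<dots> = c * (\<integral>\<^sup>+I. emeasure N I \<partial>count_space T)" by (intro nn_integral_cmult) auto
  also have "(\<integral>\<^sup>+I. emeasure N I \<partial>count_space T) = emeasure N (\<Union>I\<in>T. I)"
    using sets(1) by (intro emeasure_UN_countable[symmetric] T dis) auto
  finally show ?thesis by simp
qed

lemma emeasure_triple_le:
  fixes p :: "real ^ 'n"
  assumes "I \<in> grid p s" "0 < s"
  shows "triple I \<in> sets lebesgue" "vol (triple I) \<le> ennreal (3 ^ CARD('n)) * vol I"
proof -
  obtain a l where I: "I = hcube a l" "0 < l" using assms by (rule gridE)
  show sets: "triple I \<in> sets lebesgue" unfolding I using open_triple_hcube[of a l] by (simp add: borel_open)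
  have "vol (triple I) \<le> vol (hcube (a - (\<chi> i. l)) (3 * l))"
    unfolding I by (intro emeasure_mono triple_hcube_subset) simp
  also have "\<dots> = ennreal (3 ^ CARD('n)) * vol I"
    unfolding I(1) emeasure_lebesgue_hcube[OF less_imp_le[OF I(2)]]
    using I(2) emeasure_lebesgue_hcube[of "3 * l" "a - (\<chi> i. l)"] by (simp add: power_mult_distrib ennreal_mult del: emeasure_completion)
  finally show "vol (triple I) \<le> ennreal (3 ^ CARD('n)) * vol I" .
qed

text \<open>The level sets of the dyadic maximal function of \<open>v \<chi>\<^sub>Q\<close> at the heights \<open>b ^ k\<close> lose a fixed
  proportion of their \<open>v\<close>-measure from one height to the next.\<close>

lemma cube_Ainf_imp_Ainf_const_finite:
  fixes v :: "real ^ 'n \<Rightarrow> real"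
  assumes v: "weight v" and P: "cube_Ainf \<delta> \<theta> (weighted v)" and \<delta>: "0 < \<delta>" "\<delta> \<le> 1" and \<theta>: "0 \<le> \<theta>" "\<theta> < 1"
  shows "Ainf_const v < \<infinity>"
proof -
  let ?V = "weighted v" and ?n = "CARD('n)"
  note vm = weight_measurable[OF v] and V = weight_ac_loc_finite[OF v]
  \<comment> \<open>Inside a stopping cell of height \<open>t k\<close>, whose average is at most
    \<open>2 ^ n * t k\<close>, the cells of height \<open>b * t k\<close> fill at most the volume
    fraction \<open>2 ^ n / b\<close>. This is \<delta>, so \<open>cube_Ainf\<close> yields the
    factor \<theta> from one level to the next.\<close>
  define b where "b = 2 ^ ?n / \<delta>"
  have b: "1 \<le> b"
  proof -
    have "\<delta> \<le> 2 ^ ?n" using \<delta>(2) one_le_power[of "2::real" ?n] by linarith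
    then show ?thesis using \<delta>(1) by (simp add: b_def)
  qed
  \<comment> \<open>The first term bounds the maximal function below the lowest height. In the
    second, \<open>12 ^ n\<close> is \<open>4 ^ n\<close> from \<open>cube_to_cell\<close> times
    \<open>3 ^ n\<close> from tripling, \<open>b\<close> is the ratio of consecutive heights, and
    \<open>1 / (1 - \<theta>)\<close> sums the decay of the level sets.\<close>
  define C where "C = 4 ^ ?n + 12 ^ ?n * b / (1 - \<theta>)"
  have C: "0 \<le> C" using b \<theta> by (simp add: C_def)
  have main: "(\<integral>\<^sup>+x\<in>Q. maximal (\<lambda>y. v y * indicator Q y) x \<partial>lebesgue) / (\<integral>\<^sup>+x\<in>Q. ennreal (v x) \<partial>lebesgue) \<le> ennreal C"
    if Q: "Q \<in> cubes" for Q
  proof -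
    obtain p s where Qp: "Q = closed_cube p s" and s: "0 < s" using Q by (auto simp: cubes_def)
    let ?Q = "hcube p s" and ?f = "\<lambda>y. v y * indicator Q y"
    have fm: "?f \<in> borel_measurable lebesgue"
      using borel_measurable_times[OF vm borel_measurable_indicator[of Q lebesgue]] Qp by simp
    define W where "W = weighted (\<lambda>y. \<bar>?f y\<bar>)"
    obtain q where q: "emeasure ?V ?Q = ennreal q" "0 < q"
      using ac_loc_finite_hcube[OF V, of p s] weight_hcube_pos[OF v s, of p] by (cases "emeasure ?V ?Q") auto
    define L where "L = s ^ ?n"
    have L: "vol ?Q = ennreal L" "0 < L"
      using emeasure_lebesgue_hcube[of s p] s by (auto simp: L_def)
    have nullQ: "Q - ?Q \<in> null_sets ?V"
      using ac_loc_finite_null[OF V cbox_diff_hcube_null] Qp by blast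
    have W: "emeasure W J = emeasure ?V (?Q \<inter> J)" if "J \<in> sets lebesgue" for J
    proof -
      have "emeasure W J = emeasure ?V (Q \<inter> J)"
        unfolding W_def using Qp that by (intro weighted_abs_indicator[OF v]) auto
      also have "Q \<inter> J = (?Q \<inter> J) \<union> (Q - ?Q) \<inter> J" using hcube_subset_cbox[of p s] Qp by blast
      also have "emeasure ?V \<dots> = emeasure ?V (?Q \<inter> J)"
        using that nullQ by (intro emeasure_Un_null_set null_set_Int2) auto
      finally show ?thesis .
    qed
    define t where "t k = b ^ k * (q / L)" for k :: nat
    have t: "0 < t k" for k using q L b by (simp add: t_def)
    have tmono: "t 0 \<le> t k" for k using q L one_le_power[OF b, of k] by (simp add: t_def divide_right_mono)
    have le: "emeasure ?V ?Q \<le> ennreal (t k) * vol ?Q" for k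
    proof -
      have "q = t 0 * L" using L by (simp add: t_def)
      also have "\<dots> \<le> t k * L" using tmono[of k] L by simp
      finally show ?thesis unfolding q L using t[of k] L by (simp add: ennreal_mult[symmetric] ennreal_leI)
    qed
    obtain T where T: "\<And>k. T k \<subseteq> grid p s" "\<And>k. countable (T k)" "\<And>k. disjoint (T k)"
      "\<And>k I. I \<in> T k \<Longrightarrow> I \<subseteq> ?Q"
      "\<And>k I. I \<in> T k \<Longrightarrow> ennreal (t k) * vol I < emeasure ?V I"
      "\<And>k I. I \<in> T k \<Longrightarrow> emeasure ?V I \<le> ennreal (2 ^ CARD('n) * t k) * vol I"
      "\<And>k J. J \<in> grid p s \<Longrightarrow> ennreal (t k) * vol J < emeasure ?V (?Q \<inter> J) \<Longrightarrow> \<exists>I\<in>T k. J \<subseteq> I"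
      and setsT: "\<And>k. T k \<subseteq> sets lebesgue" and \<Omega>: "\<And>k. \<Union>(T k) \<in> sets lebesgue"
      using local_Calderon_Zygmund_levels[where t = t, OF s V t le] by blast
    have tSuc: "t (Suc k) = b * t k" for k by (simp add: t_def)
    have up: "\<exists>I\<in>T k. J \<subseteq> I" if J: "J \<in> T (Suc k)" for J k
    proof -
      have "t k \<le> t (Suc k)" using b t[of k] by (simp add: tSuc)
      then have "ennreal (t k) * vol J \<le> ennreal (t (Suc k)) * vol J"
        by (intro mult_right_mono ennreal_leI) auto
      also have "\<dots> < emeasure ?V (?Q \<inter> J)" using T(5)[OF J] T(4)[OF J] by (simp add: Int_absorb1)
      finally show ?thesis using T(7) T(1) J by blast
    qed
    have decay1: "emeasure ?V (\<Union>(T (Suc k)) \<inter> I) \<le> ennreal \<theta> * emeasure ?V I" if I: "I \<in> T k" for I k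
    proof -
      have IL: "I \<in> sets lebesgue" using I setsT by blast
      have "vol (I \<inter> \<Union>(T (Suc k))) \<le> ennreal (1 / t (Suc k)) * emeasure ?V (I \<inter> \<Union>(T (Suc k)))"
      proof (rule emeasure_Union_mono[OF T(2,3)])
        fix J assume J: "J \<in> T (Suc k)"
        show "vol (I \<inter> J) \<le> ennreal (1 / t (Suc k)) * emeasure ?V (I \<inter> J)"
        proof (cases "I \<inter> J = {}")
          case False
          obtain I' where I': "I' \<in> T k" "J \<subseteq> I'" using up[OF J] by blast
          then have "I' = I" using T(3)[of k] I False unfolding disjoint_def by blast
          then have IJ: "I \<inter> J = J" using I' by blast
          have "ennreal (1 / t (Suc k)) * (ennreal (t (Suc k)) * vol J) \<le> ennreal (1 / t (Suc k)) * emeasure ?V J"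
            using T(5)[OF J] by (intro mult_left_mono) (auto intro: less_imp_le)
          moreover have "ennreal (1 / t (Suc k)) * ennreal (t (Suc k)) = 1"
            using t[of "Suc k"] by (subst ennreal_mult[symmetric]) auto
          ultimately show ?thesis unfolding IJ by (simp add: mult.assoc[symmetric])
        qed simp
      qed (use setsT IL in auto)
      also have "\<dots> \<le> ennreal (1 / t (Suc k)) * emeasure ?V I"
        using IL by (intro mult_left_mono emeasure_mono) auto
      also have "\<dots> \<le> ennreal (1 / t (Suc k)) * (ennreal (2 ^ ?n * t k) * vol I)"
        using T(6)[OF I] by (intro mult_left_mono) auto
      also have "\<dots> = ennreal \<delta> * vol I"
      proof -
        have "1 / t (Suc k) * (2 ^ ?n * t k) = \<delta>" using t[of k] \<delta> by (simp add: tSuc b_def)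
        moreover have "ennreal (1 / t (Suc k)) * ennreal (2 ^ ?n * t k) = ennreal (1 / t (Suc k) * (2 ^ ?n * t k))"
          using t[of k] t[of "Suc k"] by (intro ennreal_mult[symmetric]) auto
        ultimately show ?thesis by (simp only: mult.assoc[symmetric])
      qed
      finally have small: "vol (\<Union>(T (Suc k)) \<inter> I) \<le> ennreal \<delta> * vol I"
        by (simp only: Int_commute)
      obtain c r where c: "I = hcube c r" "0 < r" using gridE[of I p s] I T(1) s by blast
      show ?thesis using cube_AinfD[OF P c(2), of "\<Union>(T (Suc k)) \<inter> I" c] small \<Omega> IL unfolding c(1) by auto
    qed
    have decay: "emeasure ?V (\<Union>(T k)) \<le> ennreal (\<theta> ^ k) * ennreal q" for k
    proof (induction k)
      case 0
      have "emeasure ?V (\<Union>(T 0)) \<le> emeasure ?V ?Q" using T(4) by (intro emeasure_mono) auto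
      then show ?case using q by simp
    next
      case (Suc k)
      have "\<Union>(T (Suc k)) = \<Union>(T (Suc k)) \<inter> \<Union>(T k)" using up by blast
      then have "emeasure ?V (\<Union>(T (Suc k))) = emeasure ?V (\<Union>(T (Suc k)) \<inter> \<Union>(T k))" by simp
      also have "\<dots> \<le> ennreal \<theta> * emeasure ?V (UNIV \<inter> \<Union>(T k))"
        using decay1 \<Omega> setsT by (intro emeasure_Union_mono[OF T(2,3)]) auto
      also have "\<dots> \<le> ennreal \<theta> * (ennreal (\<theta> ^ k) * ennreal q)" using Suc by (intro mult_left_mono) auto
      finally show ?case using \<theta> by (simp add: ennreal_mult mult.assoc)
    qed
    define A where "A k = (\<Union>I\<in>T k. triple I)" for k
    have sA: "A k \<in> sets lebesgue" for k
      unfolding A_def using T(1,2) emeasure_triple_le(1)[OF _ s] by (intro sets.countable_UN') blast+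
    have mA: "ennreal (4 ^ ?n * t (Suc k)) * vol (A k) \<le> ennreal (12 ^ ?n * b * q) * ennreal (\<theta> ^ k)" for k
    proof -
      have "vol (A k) \<le> ennreal (3 ^ ?n / t k) * emeasure ?V (\<Union>(T k))"
        unfolding A_def
      proof (rule emeasure_UN_le_Union[OF T(2,3)])
        fix I assume I: "I \<in> T k"
        then have IG: "I \<in> grid p s" using T(1) by blast
        show "triple I \<in> sets lebesgue" by (rule emeasure_triple_le(1)[OF IG s])
        have "vol (triple I) \<le> ennreal (3 ^ ?n) * vol I" by (rule emeasure_triple_le(2)[OF IG s])
        also have "\<dots> = ennreal (3 ^ ?n / t k) * (ennreal (t k) * vol I)"
        proof -
          have "ennreal (3 ^ ?n / t k) * ennreal (t k) = ennreal (3 ^ ?n)"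
            using t[of k] by (subst ennreal_mult[symmetric]) auto
          then show ?thesis by (simp only: mult.assoc[symmetric])
        qed
        also have "\<dots> \<le> ennreal (3 ^ ?n / t k) * emeasure ?V I"
          using T(5)[OF I] by (intro mult_left_mono) auto
        finally show "vol (triple I) \<le> ennreal (3 ^ ?n / t k) * emeasure ?V I" .
      qed (use setsT in auto)
      also have "\<dots> \<le> ennreal (3 ^ ?n / t k) * (ennreal (\<theta> ^ k) * ennreal q)"
        using decay by (intro mult_left_mono) auto
      finally have "ennreal (4 ^ ?n * t (Suc k)) * vol (A k)
        \<le> ennreal (4 ^ ?n * t (Suc k)) * (ennreal (3 ^ ?n / t k) * (ennreal (\<theta> ^ k) * ennreal q))"
        by (rule mult_left_mono) simp
      also have "\<dots> = ennreal (4 ^ ?n * t (Suc k) * (3 ^ ?n / t k) * q * \<theta> ^ k)"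
        using t[of k] t[of "Suc k"] q \<theta> by (simp add: ennreal_mult mult_ac del: times_divide_eq_right times_divide_eq_left)
      also have "4 ^ ?n * t (Suc k) * (3 ^ ?n / t k) * q * \<theta> ^ k = 12 ^ ?n * b * q * \<theta> ^ k"
        using t[of k] power_mult_distrib[of "4::real" 3 ?n] by (simp add: tSuc)
      also have "ennreal (12 ^ ?n * b * q * \<theta> ^ k) = ennreal (12 ^ ?n * b * q) * ennreal (\<theta> ^ k)"
        using q b \<theta> by (intro ennreal_mult) auto
      finally show ?thesis .
    qed
    have inA: "x \<in> A k" if big: "ennreal (4 ^ ?n * t k) < maximal ?f x" for x k
    proof -
      obtain a l where al: "0 < l" "x \<in> closed_cube a l"
        "ennreal (4 ^ ?n * t k) * vol (closed_cube a l) < emeasure W (closed_cube a l)"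
        using maximal_gtD[OF fm big] unfolding W_def by blast
      obtain J where J: "J \<in> grid p s" "ennreal (t k) * vol J < emeasure W J"
        "closed_cube a l \<subseteq> triple J"
        using cube_to_cell[OF s al(1) _ less_imp_le[OF t[of k]] al(3), of p] unfolding W_def by auto
      then obtain I where "I \<in> T k" "J \<subseteq> I" using T(7)[OF J(1)] W grid_lebesgue[OF J(1) s] by metis
      then show ?thesis using J(3) al(2) triple_mono[of J I] unfolding A_def by blast
    qed
    \<comment> \<open>If the maximal function first falls below \<open>4 ^ n * t k\<close> at a
      positive \<open>k\<close>, then \<open>x\<close> lies in \<open>A (k - 1)\<close>, whose term
      in the series has precisely this height. If it never does, then \<open>x\<close> lies in every
      \<open>A k\<close> and the series diverges.\<close>
    have point: "maximal ?f x \<le> ennreal (4 ^ ?n * t 0) + (\<Sum>k. ennreal (4 ^ ?n * t (Suc k)) * indicator (A k) x)" for x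
    proof (cases "\<exists>k. maximal ?f x \<le> ennreal (4 ^ ?n * t k)")
      case True
      define k where "k = (LEAST k. maximal ?f x \<le> ennreal (4 ^ ?n * t k))"
      have k: "maximal ?f x \<le> ennreal (4 ^ ?n * t k)" unfolding k_def using True by (rule LeastI_ex)
      show ?thesis
      proof (cases k)
        case 0
        then show ?thesis using k by (intro order_trans[OF k]) (simp add: add_increasing2)
      next
        case (Suc j)
        have "\<not> maximal ?f x \<le> ennreal (4 ^ ?n * t j)"
          using not_less_Least[of j "\<lambda>k. maximal ?f x \<le> ennreal (4 ^ ?n * t k)"] Suc unfolding k_def by auto
        then have xA: "x \<in> A j" using inA by auto
        define F where "F k = ennreal (4 ^ ?n * t (Suc k)) * indicator (A k) x" for k
        have "sum F {j} \<le> suminf F" by (intro sum_le_suminf) auto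
        then have "F j \<le> suminf F" by simp
        then have "ennreal (4 ^ ?n * t (Suc j)) * indicator (A j) x \<le> (\<Sum>k. ennreal (4 ^ ?n * t (Suc k)) * indicator (A k) x)"
          unfolding F_def[abs_def] .
        then show ?thesis using k Suc xA by (auto intro: order_trans add_increasing)
      qed
    next
      case False
      then have xA: "x \<in> A k" for k using inA[of k x] by (auto simp: not_le)
      have "(\<Sum>k. ennreal (4 ^ ?n * t 0)) \<le> (\<Sum>k. ennreal (4 ^ ?n * t (Suc k)) * indicator (A k) x)"
        using xA tmono by (intro suminf_le) (auto intro!: ennreal_leI)
      moreover have "(\<Sum>k. ennreal (4 ^ ?n * t 0)) = \<infinity>"
      proof -
        have "of_nat N * ennreal (4 ^ ?n * t 0) \<le> (\<Sum>k. ennreal (4 ^ ?n * t 0))" for N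
          using sum_le_suminf[of "\<lambda>k. ennreal (4 ^ ?n * t 0)" "{..<N}"] by auto
        then have "(SUP N. of_nat N * ennreal (4 ^ ?n * t 0)) \<le> (\<Sum>k. ennreal (4 ^ ?n * t 0))" by (intro SUP_least)
        moreover have "(SUP N. of_nat N * ennreal (4 ^ ?n * t 0)) = \<infinity>"
          using t[of 0] by (simp add: SUP_mult_right_ennreal[symmetric] ennreal_SUP_of_nat_eq_top ennreal_top_mult)
        ultimately show ?thesis by (simp add: top_unique)
      qed
      ultimately show ?thesis by (simp add: top_unique)
    qed
    have VQ: "(\<integral>\<^sup>+x\<in>Q. ennreal (v x) \<partial>lebesgue) = ennreal q"
      using emeasure_weighted[OF vm, of Q] emeasure_hcube_cbox[of ?V p s] ac_weighted[OF vm] q Qp by simp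
    have LQ: "vol Q = ennreal L"
      using emeasure_lebesgue_cbox_cube[of s p] s Qp by (simp add: L_def)
    have "(\<integral>\<^sup>+x\<in>Q. maximal ?f x \<partial>lebesgue) \<le>
      (\<integral>\<^sup>+x. ennreal (4 ^ ?n * t 0) * indicator Q x + (\<Sum>k. ennreal (4 ^ ?n * t (Suc k)) * indicator (A k) x) \<partial>lebesgue)"
    proof (rule nn_integral_mono)
      fix x
      show "maximal ?f x * indicator Q x \<le> ennreal (4 ^ ?n * t 0) * indicator Q x + (\<Sum>k. ennreal (4 ^ ?n * t (Suc k)) * indicator (A k) x)"
        using point[of x] by (auto simp: indicator_def[of Q])
    qed
    also have "\<dots> = (\<integral>\<^sup>+x. ennreal (4 ^ ?n * t 0) * indicator Q x \<partial>lebesgue)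
      + (\<Sum>k. (\<integral>\<^sup>+x. ennreal (4 ^ ?n * t (Suc k)) * indicator (A k) x \<partial>lebesgue))"
    proof -
      have [measurable]: "Q \<in> sets lebesgue" "A k \<in> sets lebesgue" for k using sA Qp by auto
      show ?thesis by (subst nn_integral_add) (auto simp: nn_integral_suminf)
    qed
    also have "\<dots> = ennreal (4 ^ ?n * t 0) * ennreal L + (\<Sum>k. ennreal (4 ^ ?n * t (Suc k)) * vol (A k))"
      using sA LQ Qp by (simp add: nn_integral_cmult_indicator del: emeasure_completion)
    also have "\<dots> \<le> ennreal (4 ^ ?n * t 0) * ennreal L + (\<Sum>k. ennreal (12 ^ ?n * b * q) * ennreal (\<theta> ^ k))"
      by (intro add_left_mono suminf_le mA) auto
    also have "(\<Sum>k. ennreal (12 ^ ?n * b * q) * ennreal (\<theta> ^ k)) = ennreal (12 ^ ?n * b * q) * ennreal (1 / (1 - \<theta>))"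
    proof -
      have "(\<Sum>k. ennreal (\<theta> ^ k)) = ennreal (\<Sum>k. \<theta> ^ k)"
        using \<theta> by (intro suminf_ennreal2) auto
      also have "\<dots> = ennreal (1 / (1 - \<theta>))" using suminf_geometric[of \<theta>] \<theta> by simp
      finally show ?thesis by (simp only: ennreal_suminf_cmult)
    qed
    also have "ennreal (4 ^ ?n * t 0) * ennreal L + ennreal (12 ^ ?n * b * q) * ennreal (1 / (1 - \<theta>)) = ennreal (C * q)"
    proof -
      have "4 ^ ?n * t 0 * L + 12 ^ ?n * b * q * (1 / (1 - \<theta>)) = C * q"
        using L by (simp add: C_def t_def distrib_right)
      moreover have "0 \<le> 4 ^ ?n * t 0" "0 \<le> 12 ^ ?n * b * q" "0 \<le> 1 / (1 - \<theta>)" using t[of 0] b q \<theta> by auto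
      ultimately show ?thesis using L(2) by (metis ennreal_mult ennreal_plus less_imp_le mult_nonneg_nonneg)
    qed
    finally have "(\<integral>\<^sup>+x\<in>Q. maximal ?f x \<partial>lebesgue) \<le> ennreal C * ennreal q" using C q by (simp add: ennreal_mult)
    then show ?thesis unfolding VQ using q(2) by (subst ennreal_divide_le_iff_mult) auto
  qed
  have "Ainf_const v \<le> ennreal C" unfolding Ainf_const_def by (intro SUP_least main)
  then show ?thesis by (auto simp: le_less_trans)
qed

section \<open>Sparse families of cells\<close>

lemma finite_grid_maximal_family:
  fixes p :: "real ^ 'n"
  assumes s: "0 < s" and F: "finite F" "F \<subseteq> grid p s"
  obtains T where "T \<subseteq> F" "countable T" "disjoint T" "\<Union>T = \<Union>F"
proof -
  have "(\<Sum>I\<in>F. vol I) < \<infinity>"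
    using F emeasure_grid_finite[OF _ s ac_loc_finite_lebesgue] by (auto simp: ennreal_sum_less_top simp del: emeasure_completion)
  then obtain B where B: "(\<Sum>I\<in>F. vol I) = ennreal B" "0 \<le> B" by (cases "\<Sum>I\<in>F. vol I") auto
  have "vol I \<le> ennreal B" if "I \<in> F" for I
    unfolding B(1)[symmetric] using F(1) that by (intro member_le_sum) auto
  then show ?thesis using grid_maximal_family[OF s F(2), of B] that by metis
qed

lemma ennreal_mult_le_imp_le:
  assumes "0 < x" "ennreal x * a \<le> b"
  shows "a \<le> ennreal (1 / x) * b"
proof -
  have "ennreal (1 / x) * (ennreal x * a) \<le> ennreal (1 / x) * b" using assms(2) by (rule mult_left_mono) simp
  moreover have "ennreal (1 / x) * ennreal x = 1" using assms(1) by (subst ennreal_mult[symmetric]) auto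
  ultimately show ?thesis by (simp add: mult.assoc[symmetric])
qed

text \<open>The application has \<open>c = 4 ^ (-n)\<close>, the constant lost in \<open>cube_to_cell\<close>.\<close>

definition stopping_cells ::
  "real ^ 'n \<Rightarrow> real \<Rightarrow> (real ^ 'n) measure \<Rightarrow> (real ^ 'n) measure \<Rightarrow> real \<Rightarrow> real \<Rightarrow> int \<Rightarrow>
    (real ^ 'n) set set \<Rightarrow> ((real ^ 'n) set \<Rightarrow> int) \<Rightarrow> bool" where
  "stopping_cells p s G V \<beta> c l F k \<longleftrightarrow> finite F \<and> F \<subseteq> grid p s \<and>
    (\<forall>I\<in>F. ennreal (c * \<beta> powi k I) * vol I < emeasure G I \<and>
      (\<forall>J\<in>grid p s. ennreal (c * \<beta> powi k I) * vol J < emeasure G J \<longrightarrow> I \<subseteq> J \<longrightarrow> J = I) \<and>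
      ennreal (\<beta> powi k I * 2 powi l) * vol I \<le> emeasure V I \<and>
      emeasure V I \<le> ennreal (\<beta> powi k I * 2 powi (l + 1)) * vol I)"

lemma stopping_cells_subset:
  "stopping_cells p s G V \<beta> c l F k \<Longrightarrow> F' \<subseteq> F \<Longrightarrow> stopping_cells p s G V \<beta> c l F' k"
  unfolding stopping_cells_def by (meson finite_subset order_trans subsetD)

text \<open>The cells are \<open>V\<close>-sparse: removing from each the smaller ones leaves pairwise disjoint sets that
  carry a fixed proportion of the \<open>V\<close>-measure.\<close>

lemma stopping_cells_Carleson:
  fixes p :: "real ^ 'n"
  assumes s: "0 < s" and F: "stopping_cells p s G V \<beta> c l F k"
    and G: "sets G = sets lebesgue" and V: "ac_loc_finite V" "cube_Ainf \<delta> \<theta> V"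
    and \<delta>: "0 < \<delta>" and \<theta>: "0 \<le> \<theta>" "\<theta> < 1" and \<beta>: "2 \<le> \<beta>" "2 / \<delta> \<le> \<beta>" and c: "0 < c"
  shows "(\<Sum>I\<in>F. emeasure V I) \<le> ennreal (2 powi (l + 1) / (c * (1 - \<theta>))) * emeasure G (\<Union>F)"
proof -
  have fin: "finite F" and Fg: "F \<subseteq> grid p s"
    and F1: "\<And>I. I \<in> F \<Longrightarrow> ennreal (c * \<beta> powi k I) * vol I < emeasure G I"
    and F2: "\<And>I J. I \<in> F \<Longrightarrow> J \<in> grid p s \<Longrightarrow> ennreal (c * \<beta> powi k I) * vol J < emeasure G J \<Longrightarrow> I \<subseteq> J \<Longrightarrow> J = I"
    and F3: "\<And>I. I \<in> F \<Longrightarrow> ennreal (\<beta> powi k I * 2 powi l) * vol I \<le> emeasure V I"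
    and F4: "\<And>I. I \<in> F \<Longrightarrow> emeasure V I \<le> ennreal (\<beta> powi k I * 2 powi (l + 1)) * vol I"
    using F unfolding stopping_cells_def by blast+
  note setsV = ac_loc_finite_sets[OF V(1)]
  have FL: "I \<in> sets lebesgue" if "I \<in> F" for I using Fg that grid_lebesgue[OF _ s] by blast
  have \<beta>0: "0 < \<beta>" using \<beta> by simp
  \<comment> \<open>Were the height of the inner cell not larger, the outer cell would also exceed
    it, contradicting the maximality of the inner cell at its own height.\<close>
  have mono: "k I < k J" if IJ: "I \<in> F" "J \<in> F" "J \<subset> I" for I J
  proof (rule ccontr)
    assume "\<not> k I < k J"
    then have "\<beta> powi k J \<le> \<beta> powi k I" using \<beta> by (intro power_int_increasing) auto
    then have "ennreal (c * \<beta> powi k J) * vol I \<le> ennreal (c * \<beta> powi k I) * vol I"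
      using c by (intro mult_right_mono ennreal_leI) auto
    also have "\<dots> < emeasure G I" by (rule F1[OF IJ(1)])
    finally have "I = J" using F2[OF IJ(2), of I] IJ Fg by blast
    then show False using IJ by blast
  qed
  define X where "X I = I - \<Union>{J \<in> F. J \<subset> I}" for I
  have XL: "X I \<in> sets lebesgue" if "I \<in> F" for I
    unfolding X_def using FL that fin by (intro sets.Diff sets.finite_Union) auto
  have dis: "disjoint_family_on X F"
    unfolding disjoint_family_on_def
  proof (intro ballI impI)
    fix I J assume IJ: "I \<in> F" "J \<in> F" "I \<noteq> J"
    show "X I \<inter> X J = {}"
    proof (cases "I \<inter> J = {}")
      case False
      then have "I \<subset> J \<or> J \<subset> I" using grid_nested[of I p s J] IJ Fg by blast
      then show ?thesis using IJ unfolding X_def by blast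
    qed (auto simp: X_def)
  qed
  have Xbig: "emeasure V I \<le> ennreal (1 / (1 - \<theta>)) * emeasure V (X I)" if I: "I \<in> F" for I
  proof -
    let ?S = "{J \<in> F. J \<subset> I}"
    obtain T where T: "T \<subseteq> ?S" "countable T" "disjoint T" "\<Union>T = \<Union>?S"
      using finite_grid_maximal_family[OF s, of ?S p] fin Fg by auto
    \<comment> \<open>Smaller cells have height at least \<open>k I + 1\<close>, so their
      \<open>V\<close>-averages are at least \<open>h\<close>, against at most
      \<open>\<beta> powi k I * 2 powi (l + 1)\<close> for \<open>I\<close>. They fill at most the
      volume fraction \<open>2 / \<beta> \<le> \<delta>\<close> of \<open>I\<close>.\<close>
    define h where "h = \<beta> powi (k I + 1) * 2 powi l"
    have h: "0 < h" using \<beta>0 by (simp add: h_def)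
    have setsT: "T \<subseteq> sets lebesgue" using T(1) FL by blast
    have "vol (UNIV \<inter> \<Union>T) \<le> ennreal (1 / h) * emeasure V (UNIV \<inter> \<Union>T)"
    proof (rule emeasure_Union_mono[OF T(2,3)])
      fix J assume J: "J \<in> T"
      then have JF: "J \<in> F" "J \<subset> I" using T(1) by auto
      have "\<beta> powi (k I + 1) \<le> \<beta> powi k J" using mono[OF I JF] \<beta> by (intro power_int_increasing) auto
      then have "h \<le> \<beta> powi k J * 2 powi l" unfolding h_def by (intro mult_right_mono) auto
      then have "ennreal h * vol J \<le> ennreal (\<beta> powi k J * 2 powi l) * vol J"
        by (intro mult_right_mono ennreal_leI) auto
      also have "\<dots> \<le> emeasure V J" by (rule F3[OF JF(1)])
      finally show "vol (UNIV \<inter> J) \<le> ennreal (1 / h) * emeasure V (UNIV \<inter> J)"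
        using ennreal_mult_le_imp_le[OF h] by simp
    qed (use setsT setsV in auto)
    also have "\<dots> \<le> ennreal (1 / h) * emeasure V I"
      using FL[OF I] T(1) setsV by (intro mult_left_mono emeasure_mono) auto
    also have "\<dots> \<le> ennreal (1 / h) * (ennreal (\<beta> powi k I * 2 powi (l + 1)) * vol I)"
      by (intro mult_left_mono F4[OF I]) auto
    also have "\<dots> = ennreal (2 / \<beta>) * vol I"
    proof -
      have "1 / h * (\<beta> powi k I * 2 powi (l + 1)) = 2 / \<beta>"
        using \<beta>0 by (simp add: h_def power_int_add)
      moreover have "ennreal (1 / h) * ennreal (\<beta> powi k I * 2 powi (l + 1)) = ennreal (1 / h * (\<beta> powi k I * 2 powi (l + 1)))"
        using h \<beta>0 by (intro ennreal_mult[symmetric]) auto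
      ultimately show ?thesis by (simp only: mult.assoc[symmetric])
    qed
    also have "\<dots> \<le> ennreal \<delta> * vol I"
      using \<beta> \<delta> \<beta>0 by (intro mult_right_mono ennreal_leI) (auto simp: field_simps)
    finally have small: "vol (\<Union>?S) \<le> ennreal \<delta> * vol I" using T(4) by simp
    obtain b r where b: "I = hcube b r" "0 < r" using gridE[of I p s] I Fg s by blast
    have "I - X I = \<Union>?S" by (auto simp: X_def)
    then show ?thesis
      using cube_Ainf_complement[OF V(2,1) \<theta> b(2), of "X I" b] small XL[OF I] unfolding b(1)[symmetric]
      by (auto simp: X_def)
  qed
  have UX: "(\<Union>I\<in>F. X I) \<in> sets V" using XL fin setsV by auto
  have "(\<Sum>I\<in>F. emeasure V I) \<le> (\<Sum>I\<in>F. ennreal (1 / (1 - \<theta>)) * emeasure V (X I))"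
    by (intro sum_mono Xbig)
  also have "\<dots> = ennreal (1 / (1 - \<theta>)) * emeasure V (\<Union>I\<in>F. X I)"
    unfolding sum_distrib_left[symmetric] using XL setsV by (subst sum_emeasure[OF _ dis fin]) auto
  also have "\<dots> \<le> ennreal (1 / (1 - \<theta>)) * emeasure V (\<Union>F)"
    using FL fin setsV by (intro mult_left_mono emeasure_mono) (auto simp: X_def)
  \<comment> \<open>On a single stopping cell both averages are tied to the same height: the one of
    \<open>G\<close> exceeds \<open>c * \<beta> powi k I\<close> and the one of \<open>V\<close> is
    at most \<open>2 powi (l + 1) * \<beta> powi k I\<close>. The maximal cells transfer this to the
    union.\<close>
  also have "\<dots> \<le> ennreal (1 / (1 - \<theta>)) * (ennreal (2 powi (l + 1) / c) * emeasure G (\<Union>F))"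
  proof (rule mult_left_mono)
    obtain T where T: "T \<subseteq> F" "countable T" "disjoint T" "\<Union>T = \<Union>F"
      using finite_grid_maximal_family[OF s fin Fg] by auto
    have "emeasure V (UNIV \<inter> \<Union>T) \<le> ennreal (2 powi (l + 1) / c) * emeasure G (UNIV \<inter> \<Union>T)"
    proof (rule emeasure_Union_mono[OF T(2,3)])
      fix I assume "I \<in> T"
      then have I: "I \<in> F" using T(1) by blast
      have "\<beta> powi k I * 2 powi (l + 1) = 2 powi (l + 1) / c * (c * \<beta> powi k I)" using c by simp
      then have eq: "ennreal (\<beta> powi k I * 2 powi (l + 1)) = ennreal (2 powi (l + 1) / c) * ennreal (c * \<beta> powi k I)"
        using c \<beta>0 by (subst ennreal_mult[symmetric]) auto
      have "emeasure V I \<le> ennreal (2 powi (l + 1) / c) * (ennreal (c * \<beta> powi k I) * vol I)"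
        using F4[OF I] unfolding eq by (simp only: mult.assoc)
      also have "\<dots> \<le> ennreal (2 powi (l + 1) / c) * emeasure G I"
        using F1[OF I] by (intro mult_left_mono) auto
      finally show "emeasure V (UNIV \<inter> I) \<le> ennreal (2 powi (l + 1) / c) * emeasure G (UNIV \<inter> I)" by simp
    next
      show "T \<subseteq> sets V" "T \<subseteq> sets G" using T(1) FL setsV G by auto
      show "UNIV \<in> sets V" "UNIV \<in> sets G" using setsV G by auto
    qed
    then show "emeasure V (\<Union>F) \<le> ennreal (2 powi (l + 1) / c) * emeasure G (\<Union>F)" using T(4) by simp
  qed simp
  also have "\<dots> = ennreal (2 powi (l + 1) / (c * (1 - \<theta>))) * emeasure G (\<Union>F)"
  proof -
    have "ennreal (1 / (1 - \<theta>)) * ennreal (2 powi (l + 1) / c) = ennreal (1 / (1 - \<theta>) * (2 powi (l + 1) / c))"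
      using \<theta> c by (intro ennreal_mult[symmetric]) auto
    moreover have "1 / (1 - \<theta>) * (2 powi (l + 1) / c) = 2 powi (l + 1) / (c * (1 - \<theta>))" by simp
    ultimately show ?thesis by (simp only: mult.assoc[symmetric])
  qed
  finally show ?thesis .
qed

text \<open>Distinct powers of 2 add up to less than twice the largest one. It turns a sum over the
  levels of \<open>u\<close> at a point into a multiple of \<open>maximal u\<close>.\<close>

lemma sum_two_powi_le:
  fixes X :: "int set" and y :: real
  assumes "finite X" "\<And>m. m \<in> X \<Longrightarrow> 2 powi m \<le> y" "0 \<le> y"
  shows "(\<Sum>m\<in>X. 2 powi m) \<le> 2 * y"
proof (cases "X = {}")
  case False
  have "\<forall>M. (\<forall>m\<in>X. m \<le> M) \<longrightarrow> (\<Sum>m\<in>X. 2 powi m) \<le> (2::real) powi (M + 1)"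
    using assms(1)
  proof (induction rule: finite_linorder_max_induct)
    case (insert b A)
    have "(\<Sum>m\<in>A. 2 powi m) \<le> (2::real) powi b" using insert(2) insert(3)[rule_format, of "b - 1"] by auto
    then have "(\<Sum>m\<in>insert b A. 2 powi m) \<le> (2::real) powi (b + 1)"
      using insert(1,2) by (subst sum.insert) (auto simp: power_int_add)
    moreover have "(2::real) powi (b + 1) \<le> 2 powi (M + 1)" if "b \<le> M" for M
      using that by (intro power_int_increasing) auto
    ultimately show ?case by (meson insertI1 order_trans)
  qed simp
  then have "(\<Sum>m\<in>X. 2 powi m) \<le> (2::real) powi (Max X + 1)" using assms(1) by simp
  also have "\<dots> = 2 * 2 powi (Max X)" by (simp add: power_int_add)
  also have "\<dots> \<le> 2 * y" using assms(2)[of "Max X"] Max_in[OF assms(1) False] by simp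
  finally show ?thesis .
qed (use assms in auto)

lemma dyadic_level:
  assumes "0 < x" "1 < (b :: real)"
  shows "\<exists>m::int. b powi m \<le> x \<and> x < b powi (m + 1)"
proof (intro exI[of _ "\<lfloor>log b x\<rfloor>"] conjI)
  have e: "b powr real_of_int m = b powi m" for m using assms by (simp add: powr_real_of_int')
  have x: "b powr log b x = x" using assms by simp
  have "b powr real_of_int \<lfloor>log b x\<rfloor> \<le> b powr log b x" using assms by (intro powr_mono) auto
  then show "b powi \<lfloor>log b x\<rfloor> \<le> x" unfolding e x .
  have "b powr log b x < b powr real_of_int (\<lfloor>log b x\<rfloor> + 1)" using assms by (intro powr_less_mono) linarith+
  then show "x < b powi (\<lfloor>log b x\<rfloor> + 1)" unfolding e x .
qed

lemma cell_average_level: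
  assumes I: "I \<in> grid p s" "0 < s" and V: "ac_loc_finite V" "0 < emeasure V I" and h: "0 < h"
  shows "\<exists>m::int. ennreal (h * 2 powi m) * vol I \<le> emeasure V I \<and>
    emeasure V I \<le> ennreal (h * 2 powi (m + 1)) * vol I"
proof -
  obtain x where x: "emeasure V I = ennreal x" "0 < x"
    using emeasure_grid_finite[OF I V(1)] V(2) by (cases "emeasure V I") auto
  obtain y where y: "vol I = ennreal y" "0 < y"
    using emeasure_grid_finite[OF I ac_loc_finite_lebesgue] emeasure_grid_pos[OF I] by (cases "vol I") auto
  obtain m where "2 powi m \<le> x / (h * y)" "x / (h * y) < 2 powi (m + 1)"
    using dyadic_level[of "x / (h * y)" 2] x y h by auto
  then have "h * 2 powi m * y \<le> x" "x \<le> h * 2 powi (m + 1) * y"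
    using h y by (auto simp: field_simps)
  moreover have "ennreal (h * 2 powi m) * ennreal y = ennreal (h * 2 powi m * y)" for m
    using h y by (intro ennreal_mult[symmetric]) auto
  ultimately show ?thesis unfolding x y by (metis ennreal_leI)
qed

text \<open>The bound is independent of \<open>l\<close> by a cancellation: replacing
  \<open>\<beta> powi k I * vol I\<close> by the \<open>V\<close>-measure of \<open>I\<close> costs
  \<open>2 powi (- l)\<close>, and the Carleson estimate returns
  \<open>2 powi (l + 1)\<close>.\<close>

lemma stopping_cells_sum:
  fixes p :: "real ^ 'n"
  assumes s: "0 < s" and F: "stopping_cells p s (weighted g) V \<beta> c l F k"
    and g: "g \<in> borel_measurable lebesgue" "\<And>x. 0 \<le> g x" and V: "ac_loc_finite V" "cube_Ainf \<delta> \<theta> V"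
    and \<delta>: "0 < \<delta>" and \<theta>: "0 \<le> \<theta>" "\<theta> < 1" and \<beta>: "2 \<le> \<beta>" "2 / \<delta> \<le> \<beta>" and c: "0 < c"
    and u: "weight u" "A1_const u = ennreal A" "0 \<le> A"
  shows "(\<Sum>I\<in>F. ennreal (\<beta> powi k I) * emeasure (weighted u) I)
    \<le> ennreal (8 * A / (c * (1 - \<theta>))) * (\<integral>\<^sup>+x. ennreal (g x) * ennreal (u x) \<partial>lebesgue)"
proof -
  let ?U = "weighted u" and ?G = "weighted g"
  have fin: "finite F" and Fg: "F \<subseteq> grid p s"
    and F3: "\<And>I. I \<in> F \<Longrightarrow> ennreal (\<beta> powi k I * 2 powi l) * vol I \<le> emeasure V I"
    using F unfolding stopping_cells_def by blast+
  have \<beta>0: "0 < \<beta>" using \<beta> by simp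
  note um = weight_measurable[OF u(1)] and U = weight_ac_loc_finite[OF u(1)]
  have FL: "I \<in> sets lebesgue" if "I \<in> F" for I using Fg that grid_lebesgue[OF _ s] by blast
  have "\<exists>m::int. ennreal (2 powi m) * vol I \<le> emeasure ?U I \<and>
      emeasure ?U I \<le> ennreal (2 powi (m + 1)) * vol I" if "I \<in> F" for I
  proof -
    have I: "I \<in> grid p s" using that Fg by blast
    then have "0 < emeasure ?U I" using weight_emeasure_pos[OF u(1)] emeasure_grid_pos[OF I s] grid_lebesgue[OF I s] by blast
    then show ?thesis using cell_average_level[OF I s U, of 1] by simp
  qed
  then obtain m :: "(real ^ 'n) set \<Rightarrow> int" where m:
    "\<And>I. I \<in> F \<Longrightarrow> ennreal (2 powi m I) * vol I \<le> emeasure ?U I"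
    "\<And>I. I \<in> F \<Longrightarrow> emeasure ?U I \<le> ennreal (2 powi (m I + 1)) * vol I"
    by metis
  \<comment> \<open>The 4 is one factor 2 for rounding the averages of \<open>u\<close> and one for
    rounding those of \<open>V\<close>. Summing the powers of 2 over the levels of \<open>u\<close>
    doubles it to the 8 of the claim.\<close>
  define K where "K = 4 / (c * (1 - \<theta>))"
  have K: "0 \<le> K" using c \<theta> by (simp add: K_def)
  define L where "L j = {I \<in> F. m I = j}" for j
  have layer: "(\<Sum>I\<in>L j. ennreal (\<beta> powi k I) * emeasure ?U I) \<le> ennreal (K * 2 powi j) * emeasure ?G (\<Union>(L j))" for j
  proof -
    have "(\<Sum>I\<in>L j. ennreal (\<beta> powi k I) * emeasure ?U I) \<le> (\<Sum>I\<in>L j. ennreal (2 powi (j + 1) / 2 powi l) * emeasure V I)"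
    proof (rule sum_mono)
      fix I assume "I \<in> L j"
      then have I: "I \<in> F" "m I = j" by (auto simp: L_def)
      have "ennreal (\<beta> powi k I) * emeasure ?U I \<le> ennreal (\<beta> powi k I) * (ennreal (2 powi (j + 1)) * vol I)"
        using m(2)[OF I(1)] I(2) by (intro mult_left_mono) auto
      also have "\<dots> = ennreal (2 powi (j + 1) / 2 powi l) * (ennreal (\<beta> powi k I * 2 powi l) * vol I)"
      proof -
        have "ennreal (\<beta> powi k I) * ennreal (2 powi (j + 1)) = ennreal (2 powi (j + 1) / 2 powi l) * ennreal (\<beta> powi k I * 2 powi l)"
          using \<beta>0 by (simp add: ennreal_mult[symmetric])
        then show ?thesis by (simp only: mult.assoc[symmetric])
      qed
      also have "\<dots> \<le> ennreal (2 powi (j + 1) / 2 powi l) * emeasure V I"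
        by (intro mult_left_mono F3[OF I(1)]) simp
      finally show "ennreal (\<beta> powi k I) * emeasure ?U I \<le> ennreal (2 powi (j + 1) / 2 powi l) * emeasure V I" .
    qed
    also have "\<dots> \<le> ennreal (2 powi (j + 1) / 2 powi l) * (ennreal (2 powi (l + 1) / (c * (1 - \<theta>))) * emeasure ?G (\<Union>(L j)))"
      unfolding sum_distrib_left[symmetric]
      by (intro mult_left_mono stopping_cells_Carleson[OF s stopping_cells_subset[OF F] _ V \<delta> \<theta> \<beta> c])
         (auto simp: L_def)
    also have "\<dots> = ennreal (K * 2 powi j) * emeasure ?G (\<Union>(L j))"
    proof -
      have "2 powi (j + 1) / 2 powi l * (2 powi (l + 1) / (c * (1 - \<theta>))) = K * 2 powi j"
        by (simp add: K_def power_int_add)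
      moreover have "ennreal (2 powi (j + 1) / 2 powi l) * ennreal (2 powi (l + 1) / (c * (1 - \<theta>)))
        = ennreal (2 powi (j + 1) / 2 powi l * (2 powi (l + 1) / (c * (1 - \<theta>))))"
        using c \<theta> by (intro ennreal_mult[symmetric]) auto
      ultimately show ?thesis by (simp only: mult.assoc[symmetric])
    qed
    finally show ?thesis .
  qed
  have UL: "\<Union>(L j) \<in> sets lebesgue" for j
    using FL fin by (intro sets.finite_Union) (auto simp: L_def)
  have "(\<Sum>I\<in>F. ennreal (\<beta> powi k I) * emeasure ?U I) = (\<Sum>j\<in>m ` F. \<Sum>I\<in>L j. ennreal (\<beta> powi k I) * emeasure ?U I)"
    unfolding L_def by (rule sum.image_gen[OF fin])
  also have "\<dots> \<le> (\<Sum>j\<in>m ` F. ennreal (K * 2 powi j) * emeasure ?G (\<Union>(L j)))"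
    by (intro sum_mono layer)
  also have "\<dots> = (\<Sum>j\<in>m ` F. (\<integral>\<^sup>+x. ennreal (K * 2 powi j) * (ennreal (g x) * indicator (\<Union>(L j)) x) \<partial>lebesgue))"
    using UL g by (intro sum.cong refl) (subst nn_integral_cmult, auto simp: emeasure_weighted)
  also have "\<dots> = (\<integral>\<^sup>+x. (\<Sum>j\<in>m ` F. ennreal (K * 2 powi j) * (ennreal (g x) * indicator (\<Union>(L j)) x)) \<partial>lebesgue)"
    using UL g by (intro nn_integral_sum[symmetric]) auto
  also have "\<dots> \<le> (\<integral>\<^sup>+x. ennreal (2 * K * A) * (ennreal (g x) * ennreal (u x)) \<partial>lebesgue)"
  proof (rule nn_integral_mono_AE)
    show "AE x in lebesgue. (\<Sum>j\<in>m ` F. ennreal (K * 2 powi j) * (ennreal (g x) * indicator (\<Union>(L j)) x))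
      \<le> ennreal (2 * K * A) * (ennreal (g x) * ennreal (u x))"
      using A1_maximal[OF u(1,2)]
    proof eventually_elim
      case (elim x)
      define Y where "Y = {j \<in> m ` F. x \<in> \<Union>(L j)}"
      have Y: "finite Y" using fin by (simp add: Y_def)
      \<comment> \<open>A cell of level \<open>j\<close> around \<open>x\<close> has
        \<open>u\<close>-average at least \<open>2 powi j\<close>, so it witnesses this lower bound
        for \<open>maximal u x\<close>.\<close>
      have "2 powi j \<le> A * u x" if "j \<in> Y" for j
      proof -
        obtain I where I: "I \<in> F" "m I = j" "x \<in> I" using \<open>j \<in> Y\<close> by (auto simp: Y_def L_def)
        obtain b r where b: "I = hcube b r" "0 < r" using gridE[of I p s] I Fg s by blast
        have "ennreal (2 powi j) \<le> maximal u x"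
          using maximal_ge[OF um b(2), of x b "2 powi j"] m(1)[OF I(1)] I weight_abs[OF u(1)] unfolding b(1) by simp
        also have "\<dots> \<le> ennreal (A * u x)" using elim u(3) by (simp add: ennreal_mult)
        finally show ?thesis using elim u(3) by (subst (asm) ennreal_le_iff) auto
      qed
      then have sum: "(\<Sum>j\<in>Y. 2 powi j) \<le> 2 * (A * u x)"
        using Y u(3) elim by (intro sum_two_powi_le) auto
      have "(\<Sum>j\<in>m ` F. ennreal (K * 2 powi j) * (ennreal (g x) * indicator (\<Union>(L j)) x))
        = (\<Sum>j\<in>Y. ennreal (K * 2 powi j) * ennreal (g x))"
        using fin by (intro sum.mono_neutral_cong_right) (auto simp: Y_def)
      also have "\<dots> = ennreal (\<Sum>j\<in>Y. K * 2 powi j) * ennreal (g x)"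
        using K by (simp add: sum_distrib_right[symmetric] sum_ennreal)
      also have "(\<Sum>j\<in>Y. K * 2 powi j) = K * (\<Sum>j\<in>Y. 2 powi j)" by (rule sum_distrib_left[symmetric])
      also have "ennreal (K * (\<Sum>j\<in>Y. 2 powi j)) * ennreal (g x) \<le> ennreal (K * (2 * (A * u x))) * ennreal (g x)"
        using K sum by (intro mult_right_mono ennreal_leI mult_left_mono) auto
      also have "\<dots> = ennreal (2 * K * A) * (ennreal (g x) * ennreal (u x))"
      proof -
        have "0 \<le> u x" using elim by simp
        then show ?thesis using K u(3) g(2)[of x] by (simp add: ennreal_mult[symmetric] mult_ac)
      qed
      finally show ?case .
    qed
  qed
  also have "\<dots> = ennreal (2 * K * A) * (\<integral>\<^sup>+x. ennreal (g x) * ennreal (u x) \<partial>lebesgue)"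
    using g um by (intro nn_integral_cmult) auto
  also have "2 * K * A = 8 * A / (c * (1 - \<theta>))" by (simp add: K_def)
  finally show ?thesis .
qed

section \<open>Decay on the level sets of the weight\<close>

text \<open>If \<open>E\<close> fills more than \<open>1 - \<delta>\<close> of a cube, its
  complement is small in volume and hence carries at most \<theta> of the \<open>V\<close>-mass. So
  the hypothesis of \<open>power_dominatedI\<close> holds with \<open>r = 1 - \<delta>\<close> and
  \<open>C = 1 / (1 - \<theta>)\<close>. This reverses the direction of \<open>cube_Ainf\<close>: it
  bounds volume by \<open>V\<close>.\<close>

lemma cube_Ainf_power_dominated:
  assumes \<delta>: "0 < \<delta>" "\<delta> < 1" and \<theta>: "0 \<le> \<theta>" "\<theta> < 1"
  shows "\<exists>B \<epsilon>. 0 \<le> B \<and> 0 < \<epsilon> \<and> (\<forall>V :: (real ^ 'n) measure. cube_Ainf \<delta> \<theta> V \<longrightarrow> ac_loc_finite V \<longrightarrow>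
    (\<forall>a l. 0 < l \<longrightarrow> 0 < emeasure V (hcube a l)) \<longrightarrow> power_dominated B \<epsilon> lebesgue V)"
proof -
  obtain D where D: "1 \<le> D" "\<And>V :: (real ^ 'n) measure. cube_Ainf \<delta> \<theta> V \<Longrightarrow> ac_loc_finite V \<Longrightarrow>
    (\<forall>a l b L. 0 < l \<longrightarrow> hcube a l \<subseteq> hcube b L \<longrightarrow> L \<le> 3 * l \<longrightarrow>
      emeasure V (hcube b L) \<le> ennreal D * emeasure V (hcube a l))"
    using cube_Ainf_doubling[OF \<delta>(1) \<theta>, where 'n = 'n] by blast
  define r C where "r = 1 - \<delta>" and "C = 1 / (1 - \<theta>)"
  have r: "0 < r" "r < 1" using \<delta> by (auto simp: r_def)
  have C: "1 \<le> C" using \<theta> by (simp add: C_def)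
  \<comment> \<open>Only \<open>1 \<le> D\<close> is known; \<open>D + 1\<close> gives a base above
    1 and so a positive exponent.\<close>
  have "1 < 1 * (D + 1)" using D(1) by simp
  also have "\<dots> \<le> C * (D + 1)" using C D(1) by (intro mult_right_mono) auto
  finally have "1 < C * (D + 1)" .
  then have "0 < - ln r / ln (C * (D + 1))" using r by (simp add: divide_neg_pos ln_less_zero)
  moreover have "power_dominated (1 / r ^ 2) (- ln r / ln (C * (D + 1))) lebesgue V"
    if V: "cube_Ainf \<delta> \<theta> V" "ac_loc_finite V" "\<forall>a l. 0 < l \<longrightarrow> 0 < emeasure V (hcube a l)" for V :: "(real ^ 'n) measure"
  proof (rule power_dominatedI[OF ac_loc_finite_lebesgue r C _ _ V(2)])
    show "1 < D + 1" using D by simp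
    show "0 < emeasure V (hcube a l)" if "0 < l" for a l using V(3) that by blast
    fix a :: "real ^ 'n" and l :: real
    assume l: "0 < l"
    show "emeasure V (hcube a l) \<le> ennreal C * emeasure V E"
      if E: "E \<in> sets lebesgue" "E \<subseteq> hcube a l" and big: "ennreal r * vol (hcube a l) < vol E" for E
      unfolding C_def
    proof (rule cube_Ainf_complement[OF V(1,2) \<theta> l E])
      obtain q where q: "vol (hcube a l) = ennreal q" "0 \<le> q"
        using hcube_pos_finite[OF l, of a] by (cases "vol (hcube a l)") auto
      have split: "ennreal q = vol E + vol (hcube a l - E)"
        using emeasure_split[OF refl E(1) _ E(2)] q by simp
      obtain e where e: "vol E = ennreal e" "0 \<le> e" using split by (cases "vol E") auto
      obtain f where f: "vol (hcube a l - E) = ennreal f" "0 \<le> f"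
        using split by (cases "vol (hcube a l - E)") auto
      have "q = e + f" using split e f q by (simp add: ennreal_plus[symmetric] del: ennreal_plus)
      moreover have "r * q < e" using big e q r unfolding q(1) e(1) by (simp add: ennreal_mult[symmetric] ennreal_less_iff)
      ultimately have "f \<le> \<delta> * q" by (simp add: r_def algebra_simps)
      then show "vol (hcube a l - E) \<le> ennreal \<delta> * vol (hcube a l)"
        unfolding f q using \<delta> q by (simp add: ennreal_mult[symmetric] ennreal_leI)
    qed
    fix b assume "hcube a l \<subseteq> hcube b (2 * l)"
    then have "emeasure V (hcube b (2 * l)) \<le> ennreal D * emeasure V (hcube a l)"
      using D(2)[OF V(1,2)] l by simp
    also have "\<dots> \<le> ennreal (D + 1) * emeasure V (hcube a l)" by (intro mult_right_mono ennreal_leI) auto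
    finally show "emeasure V (hcube b (2 * l)) \<le> ennreal (D + 1) * emeasure V (hcube a l)" .
  qed
  ultimately show ?thesis by (intro exI[of _ "1 / r ^ 2"] exI[of _ "- ln r / ln (C * (D + 1))"]) auto
qed

text \<open>If \<open>E\<close> carries more than the fraction \<open>r\<close> of the
  \<open>u\<close>-mass, its complement carries less than \<open>1 / (2 * (A + 1))\<close> of it. By
  \<open>A1_cube\<close> the complement then has at most half of the volume, so
  \<open>power_dominatedI\<close> applies with \<open>C = 2\<close>.\<close>

lemma A1_power_dominated:
  assumes A: "0 \<le> A"
  shows "\<exists>B \<epsilon>. 0 \<le> B \<and> 0 < \<epsilon> \<and> (\<forall>u :: real ^ 'n \<Rightarrow> real. weight u \<longrightarrow> A1_const u = ennreal A \<longrightarrow>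
    power_dominated B \<epsilon> (weighted u) lebesgue)"
proof -
  define r where "r = 1 - 1 / (2 * (A + 1))"
  have r: "0 < r" "r < 1" using A by (auto simp: r_def field_simps)
  let ?D = "2 ^ CARD('n) :: real"
  have D: "1 < ?D" by (simp add: one_less_power)
  then have "0 < ln (2 * ?D)" by (intro ln_gt_zero) linarith
  then have "0 < - ln r / ln (2 * ?D)" using r by (intro divide_pos_pos) (simp_all add: ln_less_zero)
  moreover have "power_dominated (1 / r ^ 2) (- ln r / ln (2 * ?D)) (weighted u) lebesgue"
    if u: "weight u" "A1_const u = ennreal A" for u :: "real ^ 'n \<Rightarrow> real"
  proof (rule power_dominatedI[OF weight_ac_loc_finite[OF u(1)] r _ D _ ac_loc_finite_lebesgue])
    fix a :: "real ^ 'n" and l :: real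
    assume l: "0 < l"
    let ?Q = "hcube a l" and ?U = "weighted u"
    show "0 < vol ?Q" using hcube_pos_finite(1)[OF l] .
    show "vol ?Q \<le> ennreal 2 * vol E"
      if E: "E \<in> sets lebesgue" "E \<subseteq> ?Q" and big: "ennreal r * emeasure ?U ?Q < emeasure ?U E" for E
    proof -
      obtain q where q: "emeasure ?U ?Q = ennreal q" "0 < q"
        using ac_loc_finite_hcube[OF weight_ac_loc_finite[OF u(1)], of a l] weight_hcube_pos[OF u(1) l, of a]
        by (cases "emeasure ?U ?Q") auto
      have split: "ennreal q = emeasure ?U E + emeasure ?U (?Q - E)"
        using emeasure_split[OF _ E(1) _ E(2), of ?U] q by simp
      obtain e where e: "emeasure ?U E = ennreal e" "0 \<le> e" using split by (cases "emeasure ?U E") auto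
      obtain f where f: "emeasure ?U (?Q - E) = ennreal f" "0 \<le> f"
        using split by (cases "emeasure ?U (?Q - E)") auto
      have "q = e + f" using split e f q by (simp add: ennreal_plus[symmetric] del: ennreal_plus)
      moreover have "r * q < e" using big e q r by (simp add: ennreal_mult[symmetric] ennreal_less_iff)
      ultimately have "f \<le> q / (2 * (A + 1))" by (simp add: r_def algebra_simps)
      then have "A * f \<le> A * (q / (2 * (A + 1)))" using A by (rule mult_left_mono)
      also have "\<dots> \<le> q / 2" using A q by (simp add: field_simps)
      finally have Af: "A * f \<le> q / 2" .
      obtain h where h: "vol ?Q = ennreal h" "0 < h"
        using hcube_pos_finite[OF l, of a] by (cases "vol ?Q") auto
      have splitL: "ennreal h = vol E + vol (?Q - E)"
        using emeasure_split[OF refl E(1) _ E(2)] h by simp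
      obtain d where d: "vol (?Q - E) = ennreal d" "0 \<le> d"
        using splitL by (cases "vol (?Q - E)") auto
      have "vol (?Q - E) * emeasure ?U ?Q \<le> ennreal A * vol ?Q * emeasure ?U (?Q - E)"
        by (rule A1_cube[OF u l]) (use E in auto)
      then have "d * q \<le> A * h * f"
        unfolding d q h f using A d q h f by (simp add: ennreal_mult[symmetric])
      also have "\<dots> \<le> h * (q / 2)" using mult_left_mono[OF Af, of h] h by (simp add: mult_ac)
      finally have "d \<le> 1 / 2 * h" using q by simp
      then have "vol (?Q - E) \<le> ennreal (1 / 2) * ennreal h"
        unfolding d using h by (subst ennreal_mult[symmetric]) (auto intro: ennreal_leI)
      from ennreal_le_of_add_le[OF splitL this] show ?thesis unfolding h by simp
    qed
    fix b :: "real ^ 'n"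
    show "vol (hcube b (2 * l)) \<le> ennreal ?D * vol ?Q"
      using emeasure_lebesgue_hcube[of "2 * l" b] emeasure_lebesgue_hcube[of l a] l
      by (simp add: power_mult_distrib ennreal_mult del: emeasure_completion)
  qed simp
  ultimately show ?thesis by (intro exI[of _ "1 / r ^ 2"] exI[of _ "- ln r / ln (2 * ?D)"]) auto
qed

section \<open>Decay for a single cube and a single layer\<close>

lemma powr_powi: "(2 powi m :: real) powr e = 2 powr (real_of_int m * e)"
  by (simp add: powr_real_of_int'[symmetric] powr_powr)

lemma emeasure_le_of_density_ge:
  assumes v: "v \<in> borel_measurable lebesgue" and E: "E \<in> sets lebesgue" and h: "\<And>x. x \<in> E \<Longrightarrow> h \<le> v x"
  shows "ennreal h * vol E \<le> emeasure (weighted v) E"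
proof -
  have "ennreal h * vol E = (\<integral>\<^sup>+x. ennreal h * indicator E x \<partial>lebesgue)"
    using E by (simp add: nn_integral_cmult_indicator del: emeasure_completion)
  also have "\<dots> \<le> (\<integral>\<^sup>+x. ennreal (v x) * indicator E x \<partial>lebesgue)"
    by (intro nn_integral_mono) (auto simp: indicator_def intro!: ennreal_leI h)
  finally show ?thesis using emeasure_weighted[OF v E] by simp
qed

lemma emeasure_le_of_density_le:
  assumes v: "v \<in> borel_measurable lebesgue" and E: "E \<in> sets lebesgue" and h: "\<And>x. x \<in> E \<Longrightarrow> v x \<le> h"
  shows "emeasure (weighted v) E \<le> ennreal h * vol E"
proof -
  have "emeasure (weighted v) E = (\<integral>\<^sup>+x. ennreal (v x) * indicator E x \<partial>lebesgue)"
    by (rule emeasure_weighted[OF v E])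
  also have "\<dots> \<le> (\<integral>\<^sup>+x. ennreal h * indicator E x \<partial>lebesgue)"
    by (intro nn_integral_mono) (auto simp: indicator_def intro!: ennreal_leI h)
  finally show ?thesis using E by (simp add: nn_integral_cmult_indicator del: emeasure_completion)
qed

text \<open>If the average of \<open>v\<close> over \<open>I\<close> is far from the value of \<open>v\<close> on a subset, that subset is small.\<close>

lemma level_piece_decay:
  fixes p :: "real ^ 'n"
  assumes s: "0 < s" and I: "I \<in> grid p s" and u: "weight u" "A1_const u = ennreal A" "0 \<le> A"
    and v: "weight v" and D: "1 \<le> D"
      "\<And>a l b L. 0 < l \<Longrightarrow> hcube a l \<subseteq> hcube b L \<Longrightarrow> L \<le> 3 * l \<Longrightarrow>
        emeasure (weighted v) (hcube b L) \<le> ennreal D * emeasure (weighted v) (hcube a l)"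
    and pv: "power_dominated Bv \<epsilon>1 lebesgue (weighted v)" "0 \<le> Bv" "0 < \<epsilon>1"
    and pu: "power_dominated Bu \<epsilon>2 (weighted u) lebesgue" "0 \<le> Bu" "0 < \<epsilon>2"
    and \<beta>: "2 \<le> \<beta>"
    and lev: "ennreal (\<beta> powi k * 2 powi l) * vol I \<le> emeasure (weighted v) I"
      "emeasure (weighted v) I \<le> ennreal (\<beta> powi k * 2 powi (l + 1)) * vol I"
    and E: "E \<in> sets lebesgue" "E \<subseteq> triple I" "\<And>x. x \<in> E \<Longrightarrow> \<beta> powi k \<le> v x \<and> v x \<le> \<beta> powi (k + 1)"
  defines "n \<equiv> CARD('n)"
  shows "emeasure (weighted u) E \<le>
    ennreal (3 ^ n * A * Bu * ((2 * D) powr \<epsilon>2 + (Bv * (\<beta> * 3 ^ n) powr \<epsilon>1) powr \<epsilon>2) *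
      (2 powr - min \<epsilon>2 (\<epsilon>1 * \<epsilon>2)) ^ nat \<bar>l\<bar>) * emeasure (weighted u) I"
proof -
  let ?U = "weighted u" and ?V = "weighted v"
  note um = weight_measurable[OF u(1)] and U = weight_ac_loc_finite[OF u(1)]
  note vm = weight_measurable[OF v] and V = weight_ac_loc_finite[OF v]
  \<comment> \<open>The two decay rates: for negative \<open>l\<close> only the power \<epsilon>2 of
    \<open>u\<close> acts, for the other \<open>l\<close> the powers of both weights are
    composed.\<close>
  define \<gamma> where "\<gamma> = min \<epsilon>2 (\<epsilon>1 * \<epsilon>2)"
  have \<beta>0: "0 < \<beta>" using \<beta> by simp
  obtain a r where a: "I = hcube a r" "0 < r" using I s by (rule gridE)
  define b where "b = a - (\<chi> i. r)"
  let ?Q = "hcube b (3 * r)"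
  have Q: "triple I \<subseteq> ?Q" unfolding a b_def by (rule triple_hcube_subset)
  have EQ: "E \<subseteq> ?Q" using E(2) Q by blast
  have IQ: "I \<subseteq> ?Q" unfolding a b_def hcube_def by (auto; smt (verit) a(2))
  have r3: "0 < 3 * r" using a(2) by simp
  define w where "w = r ^ n"
  have w: "0 < w" "vol I = ennreal w" "vol ?Q = ennreal (3 ^ n * w)"
    using a(2) emeasure_lebesgue_hcube[of r a] emeasure_lebesgue_hcube[of "3 * r" b]
    by (auto simp: w_def n_def a(1) power_mult_distrib simp del: emeasure_completion)
  have VQ: "emeasure ?V ?Q \<le> ennreal D * emeasure ?V I"
    unfolding a(1) using IQ a by (intro D(2)) auto
  \<comment> \<open>The \<open>A\<^sub>1\<close> inequality with \<open>E = I\<close> is a doubling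
    property: it returns from the cube around the triple to \<open>I\<close> itself.\<close>
  have UQ: "emeasure ?U ?Q \<le> ennreal (3 ^ n * A) * emeasure ?U I"
  proof -
    have "vol I * emeasure ?U ?Q \<le> ennreal A * vol ?Q * emeasure ?U I"
      using A1_cube[OF u(1,2) r3, of I b] IQ a(1) by simp
    then have "ennreal w * emeasure ?U ?Q \<le> ennreal (A * (3 ^ n * w)) * emeasure ?U I"
      unfolding w(2,3) using u(3) w(1) by (simp add: ennreal_mult)
    then have "emeasure ?U ?Q \<le> ennreal (1 / w) * (ennreal (A * (3 ^ n * w)) * emeasure ?U I)"
      by (rule ennreal_mult_le_imp_le[OF w(1)])
    also have "ennreal (1 / w) * (ennreal (A * (3 ^ n * w)) * emeasure ?U I) = ennreal (3 ^ n * A) * emeasure ?U I"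
    proof -
      have "ennreal (1 / w) * ennreal (A * (3 ^ n * w)) = ennreal (3 ^ n * A)"
        using u(3) w(1) by (subst ennreal_mult[symmetric]) auto
      then show ?thesis by (simp only: mult.assoc[symmetric])
    qed
    finally show ?thesis .
  qed
  define \<Phi>1 \<Phi>2 where "\<Phi>1 = (2 * D) powr \<epsilon>2" and "\<Phi>2 = (Bv * (\<beta> * 3 ^ n) powr \<epsilon>1) powr \<epsilon>2"
  have "\<exists>y\<ge>0. vol E \<le> ennreal y * vol ?Q \<and>
    y powr \<epsilon>2 \<le> (\<Phi>1 + \<Phi>2) * (2 powr - \<gamma>) ^ nat \<bar>l\<bar>"
  proof (cases "l < 0")
    case True
    \<comment> \<open>Here \<open>v\<close> is much larger on \<open>E\<close> than its average over
      \<open>I\<close>. Chebyshev's inequality bounds the volume of \<open>E\<close> by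
      \<open>V\<close> of the enlarged cube, and doubling brings back the small average over
      \<open>I\<close>.\<close>
    define y where "y = D * 2 powi (l + 1)"
    have y: "0 \<le> y" using D by (simp add: y_def)
    have "ennreal (\<beta> powi k) * vol E \<le> emeasure ?V E"
      using E by (intro emeasure_le_of_density_ge[OF vm]) auto
    also have "\<dots> \<le> emeasure ?V ?Q" using EQ by (intro emeasure_mono) auto
    also note VQ
    also have "ennreal D * emeasure ?V I \<le> ennreal D * (ennreal (\<beta> powi k * 2 powi (l + 1)) * vol ?Q)"
      using IQ by (intro mult_left_mono order_trans[OF lev(2)] emeasure_mono) auto
    also have "\<dots> = ennreal (\<beta> powi k) * (ennreal y * vol ?Q)"
    proof -
      have "ennreal D * ennreal (\<beta> powi k * 2 powi (l + 1)) = ennreal (\<beta> powi k) * ennreal y"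
        using D \<beta>0 by (simp add: y_def ennreal_mult[symmetric] mult_ac)
      then show ?thesis by (simp only: mult.assoc[symmetric])
    qed
    finally have "vol E \<le> ennreal (1 / \<beta> powi k) * (ennreal (\<beta> powi k) * (ennreal y * vol ?Q))"
      using \<beta>0 by (intro ennreal_mult_le_imp_le) auto
    also have "\<dots> = ennreal y * vol ?Q"
    proof -
      have "ennreal (1 / \<beta> powi k) * ennreal (\<beta> powi k) = 1" using \<beta>0 by (subst ennreal_mult[symmetric]) auto
      then show ?thesis by (simp only: mult.assoc[symmetric] mult_1_left)
    qed
    finally have "vol E \<le> ennreal y * vol ?Q" .
    moreover have "y powr \<epsilon>2 \<le> (\<Phi>1 + \<Phi>2) * (2 powr - \<gamma>) ^ nat \<bar>l\<bar>"
    proof -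
      have "y = 2 * D * 2 powi l" by (simp add: y_def power_int_add)
      then have "y powr \<epsilon>2 = \<Phi>1 * 2 powr (real_of_int l * \<epsilon>2)"
        using D by (simp add: powr_mult powr_powi \<Phi>1_def)
      also have "\<dots> \<le> (\<Phi>1 + \<Phi>2) * 2 powr (- \<gamma> * real (nat \<bar>l\<bar>))"
      proof -
        have "\<gamma> * \<bar>real_of_int l\<bar> \<le> \<epsilon>2 * \<bar>real_of_int l\<bar>" by (intro mult_right_mono) (auto simp: \<gamma>_def)
        then have "real_of_int l * \<epsilon>2 \<le> - \<gamma> * real (nat \<bar>l\<bar>)" using True by (simp add: mult.commute)
        then have "2 powr (real_of_int l * \<epsilon>2) \<le> (2::real) powr (- \<gamma> * real (nat \<bar>l\<bar>))" by (rule powr_mono) simp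
        then show ?thesis by (intro mult_mono) (auto simp: \<Phi>1_def \<Phi>2_def)
      qed
      also have "2 powr (- \<gamma> * real (nat \<bar>l\<bar>)) = (2 powr - \<gamma>) ^ nat \<bar>l\<bar>"
        by (subst powr_powr[symmetric], subst powr_realpow) auto
      finally show ?thesis .
    qed
    ultimately show ?thesis using y by blast
  next
    case False
    \<comment> \<open>Here \<open>v\<close> is much smaller on \<open>E\<close> than its average
      over \<open>I\<close>, so \<open>E\<close> carries only the fraction \<open>z\<close> of the
      \<open>V\<close>-mass. The factor \<beta> is the width of the layer and \<open>3 ^ n\<close>
      the enlargement of the cube. Passing from \<open>V\<close> to volume costs the exponent
      \<epsilon>1.\<close>
    define z where "z = \<beta> * 3 ^ n * 2 powi (- l)"
    have z: "0 \<le> z" using \<beta>0 by (simp add: z_def)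
    have "emeasure ?V E \<le> ennreal (\<beta> powi (k + 1)) * vol E"
      using E by (intro emeasure_le_of_density_le[OF vm]) auto
    also have "\<dots> \<le> ennreal (\<beta> powi (k + 1)) * vol ?Q"
      using EQ by (intro mult_left_mono emeasure_mono) auto
    also have "\<dots> = ennreal z * (ennreal (\<beta> powi k * 2 powi l) * vol I)"
    proof -
      have "\<beta> powi (k + 1) * (3 ^ n * w) = z * (\<beta> powi k * 2 powi l * w)"
        using \<beta>0 by (simp add: z_def power_int_add power_int_minus)
      then show ?thesis unfolding w(2,3) using \<beta>0 z w(1) by (simp add: ennreal_mult[symmetric])
    qed
    also have "\<dots> \<le> ennreal z * emeasure ?V ?Q"
      using IQ by (intro mult_left_mono order_trans[OF lev(1)] emeasure_mono) auto
    finally have "vol E \<le> ennreal (Bv * z powr \<epsilon>1) * vol ?Q"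
      by (rule power_dominatedD[OF pv(1) r3 E(1) EQ z])
    moreover have "(Bv * z powr \<epsilon>1) powr \<epsilon>2 \<le> (\<Phi>1 + \<Phi>2) * (2 powr - \<gamma>) ^ nat \<bar>l\<bar>"
    proof -
      have "z powr \<epsilon>1 = (\<beta> * 3 ^ n) powr \<epsilon>1 * 2 powr (- real_of_int l * \<epsilon>1)"
        using \<beta>0 unfolding z_def by (subst powr_mult) (auto simp: powr_powi)
      then have "(Bv * z powr \<epsilon>1) powr \<epsilon>2 = (Bv * (\<beta> * 3 ^ n) powr \<epsilon>1 * 2 powr (- real_of_int l * \<epsilon>1)) powr \<epsilon>2"
        by (simp add: mult.assoc)
      also have "\<dots> = \<Phi>2 * 2 powr (- real_of_int l * \<epsilon>1 * \<epsilon>2)"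
        unfolding \<Phi>2_def using pv(2) by (subst powr_mult) (auto simp: powr_powr)
      also have "\<dots> \<le> (\<Phi>1 + \<Phi>2) * 2 powr (- \<gamma> * real (nat \<bar>l\<bar>))"
      proof -
        have "\<gamma> * \<bar>real_of_int l\<bar> \<le> \<epsilon>1 * \<epsilon>2 * \<bar>real_of_int l\<bar>" by (intro mult_right_mono) (auto simp: \<gamma>_def)
        then have "- real_of_int l * \<epsilon>1 * \<epsilon>2 \<le> - \<gamma> * real (nat \<bar>l\<bar>)" using False by (simp add: mult_ac)
        then have "2 powr (- real_of_int l * \<epsilon>1 * \<epsilon>2) \<le> (2::real) powr (- \<gamma> * real (nat \<bar>l\<bar>))" by (rule powr_mono) simp
        then show ?thesis by (intro mult_mono) (auto simp: \<Phi>1_def \<Phi>2_def)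
      qed
      also have "2 powr (- \<gamma> * real (nat \<bar>l\<bar>)) = (2 powr - \<gamma>) ^ nat \<bar>l\<bar>"
        by (subst powr_powr[symmetric], subst powr_realpow) auto
      finally show ?thesis .
    qed
    moreover have "0 \<le> Bv * z powr \<epsilon>1" using pv(2) by simp
    ultimately show ?thesis by blast
  qed
  then obtain y where y: "0 \<le> y" "vol E \<le> ennreal y * vol ?Q"
    "y powr \<epsilon>2 \<le> (\<Phi>1 + \<Phi>2) * (2 powr - \<gamma>) ^ nat \<bar>l\<bar>" by blast
  have "emeasure ?U E \<le> ennreal (Bu * y powr \<epsilon>2) * emeasure ?U ?Q"
    by (rule power_dominatedD[OF pu(1) r3 E(1) EQ y(1,2)])
  also have "\<dots> \<le> ennreal (Bu * ((\<Phi>1 + \<Phi>2) * (2 powr - \<gamma>) ^ nat \<bar>l\<bar>)) * (ennreal (3 ^ n * A) * emeasure ?U I)"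
    using y(3) pu(2) UQ by (intro mult_mono ennreal_leI mult_left_mono) auto
  also have "\<dots> = ennreal (3 ^ n * A * Bu * (\<Phi>1 + \<Phi>2) * (2 powr - \<gamma>) ^ nat \<bar>l\<bar>) * emeasure ?U I"
  proof -
    have "0 \<le> \<Phi>1 + \<Phi>2" by (simp add: \<Phi>1_def \<Phi>2_def)
    then have "ennreal (Bu * ((\<Phi>1 + \<Phi>2) * (2 powr - \<gamma>) ^ nat \<bar>l\<bar>)) * ennreal (3 ^ n * A) =
      ennreal (Bu * ((\<Phi>1 + \<Phi>2) * (2 powr - \<gamma>) ^ nat \<bar>l\<bar>) * (3 ^ n * A))"
      using pu(2) u(3) by (intro ennreal_mult[symmetric]) auto
    also have "Bu * ((\<Phi>1 + \<Phi>2) * (2 powr - \<gamma>) ^ nat \<bar>l\<bar>) * (3 ^ n * A) = 3 ^ n * A * Bu * (\<Phi>1 + \<Phi>2) * (2 powr - \<gamma>) ^ nat \<bar>l\<bar>"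
      by (simp only: mult_ac)
    finally show ?thesis by (simp only: mult.assoc[symmetric])
  qed
  finally show ?thesis unfolding \<Phi>1_def \<Phi>2_def \<gamma>_def .
qed

lemma sum_two_sided_geometric_le:
  fixes X :: "int set" and r :: real
  assumes X: "finite X" and r: "0 \<le> r" "r < 1"
  shows "(\<Sum>l\<in>X. r ^ nat \<bar>l\<bar>) \<le> 2 / (1 - r)"
proof -
  have sm: "summable (\<lambda>n. r ^ n)" using r by (intro summable_geometric) auto
  have half: "(\<Sum>l\<in>Y. r ^ nat \<bar>l\<bar>) \<le> 1 / (1 - r)" if Y: "finite Y" "inj_on (\<lambda>l. nat \<bar>l\<bar>) Y" for Y :: "int set"
  proof -
    have "(\<Sum>l\<in>Y. r ^ nat \<bar>l\<bar>) = (\<Sum>n\<in>(\<lambda>l. nat \<bar>l\<bar>) ` Y. r ^ n)"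
      using Y(2) by (simp add: sum.reindex)
    also have "\<dots> \<le> (\<Sum>n. r ^ n)" using Y(1) r by (intro sum_le_suminf sm) auto
    also have "\<dots> = 1 / (1 - r)" using r by (intro suminf_geometric) auto
    finally show ?thesis .
  qed
  have "(\<Sum>l\<in>X. r ^ nat \<bar>l\<bar>) = (\<Sum>l\<in>X \<inter> {0..}. r ^ nat \<bar>l\<bar>) + (\<Sum>l\<in>X - {0..}. r ^ nat \<bar>l\<bar>)"
    by (rule sum.Int_Diff[OF X])
  also have "\<dots> \<le> 1 / (1 - r) + 1 / (1 - r)"
    using X by (intro add_mono half) (auto simp: inj_on_def)
  finally show ?thesis by simp
qed

text \<open>Reduces the countable cover of the level set to finite subfamilies, for which
  \<open>stopping_cells\<close> is formulated.\<close>

lemma emeasure_countable_UN_le: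
  assumes \<Gamma>: "countable \<Gamma>" and B: "\<And>i. i \<in> \<Gamma> \<Longrightarrow> B i \<in> sets M"
    and le: "\<And>F. finite F \<Longrightarrow> F \<subseteq> \<Gamma> \<Longrightarrow> (\<Sum>i\<in>F. emeasure M (B i)) \<le> c"
  shows "emeasure M (\<Union>i\<in>\<Gamma>. B i) \<le> c"
proof (cases "\<Gamma> = {}")
  case False
  define e where "e = from_nat_into \<Gamma>"
  have e: "range e = \<Gamma>" unfolding e_def using False \<Gamma> by (rule range_from_nat_into)
  have "(\<Union>i\<in>\<Gamma>. B i) = (\<Union>n. \<Union>i\<in>e ` {..<n}. B i)" using e by auto
  also have "emeasure M \<dots> = (SUP n. emeasure M (\<Union>i\<in>e ` {..<n}. B i))"
    using e B by (intro SUP_emeasure_incseq[symmetric]) (auto simp: incseq_def, meson lessThan_iff less_le_trans)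
  also have "\<dots> \<le> c"
  proof (rule SUP_least)
    fix n
    have sub: "e ` {..<n} \<subseteq> \<Gamma>" using e by auto
    have "emeasure M (\<Union>i\<in>e ` {..<n}. B i) \<le> (\<Sum>i\<in>e ` {..<n}. emeasure M (B i))"
      using sub B by (intro emeasure_subadditive_finite) auto
    also have "\<dots> \<le> c" using sub by (intro le) auto
    finally show "emeasure M (\<Union>i\<in>e ` {..<n}. B i) \<le> c" .
  qed
  finally show ?thesis .
qed simp

section \<open>The mixed weak-type inequality\<close>

lemma emeasure_weighted_mult_le:
  assumes u: "u \<in> borel_measurable lebesgue" "\<And>x. 0 \<le> u x" and v: "v \<in> borel_measurable lebesgue"
    and B: "B \<in> sets lebesgue" "\<And>x. x \<in> B \<Longrightarrow> v x \<le> h" and h: "0 \<le> h"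
  shows "emeasure (weighted (\<lambda>x. u x * v x)) B \<le> ennreal h * emeasure (weighted u) B"
proof -
  have "emeasure (weighted (\<lambda>x. u x * v x)) B = (\<integral>\<^sup>+x. ennreal (u x * v x) * indicator B x \<partial>lebesgue)"
    using u v B by (intro emeasure_weighted borel_measurable_times)
  also have "\<dots> \<le> (\<integral>\<^sup>+x. ennreal h * (ennreal (u x) * indicator B x) \<partial>lebesgue)"
  proof (rule nn_integral_mono)
    fix x
    have "u x * v x \<le> h * u x" if "x \<in> B" using mult_left_mono[OF B(2)[OF that] u(2)] by (simp add: mult.commute)
    then show "ennreal (u x * v x) * indicator B x \<le> ennreal h * (ennreal (u x) * indicator B x)"
      using h u(2) by (cases "x \<in> B") (auto simp: ennreal_mult[symmetric] intro!: ennreal_leI)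
  qed
  also have "\<dots> = ennreal h * (\<integral>\<^sup>+x. ennreal (u x) * indicator B x \<partial>lebesgue)"
    using u(1) B(1) by (intro nn_integral_cmult) auto
  finally show ?thesis using emeasure_weighted[OF u(1) B(1)] by simp
qed

text \<open>The level set \<open>{x. v x < maximal g x}\<close> is covered by a measurable set, which makes it unnecessary
  to discuss its measurability.\<close>

definition level_cover ::
  "real \<Rightarrow> (real ^ 'n \<Rightarrow> real) \<Rightarrow> (real ^ 'n \<Rightarrow> real) \<Rightarrow> (real ^ 'n \<Rightarrow> real) \<Rightarrow> bool" where
  "level_cover C u v g \<longleftrightarrow> (\<exists>S\<in>sets lebesgue.
    (\<forall>x a l. 0 < v x \<longrightarrow> 0 < l \<longrightarrow> x \<in> closed_cube a l \<longrightarrow>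
      ennreal (v x) * vol (closed_cube a l)
        < emeasure (weighted g) (closed_cube a l) \<longrightarrow> x \<in> S) \<and>
    emeasure (weighted (\<lambda>x. u x * v x)) S \<le> ennreal C * (\<integral>\<^sup>+x. ennreal (g x) * ennreal (u x) \<partial>lebesgue))"

lemma mixed_weak_type_integrable:
  fixes u v g :: "real ^ 'n \<Rightarrow> real"
  assumes u: "weight u" "A1_const u = ennreal A" "0 \<le> A"
    and v: "weight v" "cube_Ainf \<delta> \<theta> (weighted v)"
    and \<delta>: "0 < \<delta>" and \<theta>: "0 \<le> \<theta>" "\<theta> < 1" and \<beta>: "2 < \<beta>" "2 / \<delta> \<le> \<beta>"
    and D: "1 \<le> D"
      "\<And>a l b L. 0 < l \<Longrightarrow> hcube a l \<subseteq> hcube b L \<Longrightarrow> L \<le> 3 * l \<Longrightarrow>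
        emeasure (weighted v) (hcube b L) \<le> ennreal D * emeasure (weighted v) (hcube a l)"
    and pv: "power_dominated Bv \<epsilon>1 lebesgue (weighted v)" "0 \<le> Bv" "0 < \<epsilon>1"
    and pu: "power_dominated Bu \<epsilon>2 (weighted u) lebesgue" "0 \<le> Bu" "0 < \<epsilon>2"
    and g: "g \<in> borel_measurable lebesgue" "\<And>x. 0 \<le> g x" "emeasure (weighted g) UNIV < \<infinity>"
  defines "n \<equiv> CARD('n)"
  defines "\<Phi> \<equiv> 3 ^ n * A * Bu * ((2 * D) powr \<epsilon>2 + (Bv * (\<beta> * 3 ^ n) powr \<epsilon>1) powr \<epsilon>2)"
    and "\<rho> \<equiv> 2 powr - min \<epsilon>2 (\<epsilon>1 * \<epsilon>2)"
  shows "level_cover (\<beta> * \<Phi> * (2 / (1 - \<rho>)) * (8 * A * 4 ^ n / (1 - \<theta>))) u v g"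
proof -
  let ?U = "weighted u" and ?V = "weighted v" and ?G = "weighted g" and ?M = "weighted (\<lambda>x. u x * v x)"
  let ?p = "0 :: real ^ 'n"
  define X where "X = (\<integral>\<^sup>+x. ennreal (g x) * ennreal (u x) \<partial>lebesgue)"
  note um = weight_measurable[OF u(1)] and U = weight_ac_loc_finite[OF u(1)]
  note vm = weight_measurable[OF v(1)] and V = weight_ac_loc_finite[OF v(1)]
  have \<beta>0: "0 < \<beta>" and \<beta>2: "2 \<le> \<beta>" using \<beta> by auto
  define c :: real where "c = 1 / 4 ^ n"
  have c: "0 < c" by (simp add: c_def)
  have \<Phi>: "0 \<le> \<Phi>" using u(3) pu(2) by (simp add: \<Phi>_def)
  have "0 < min \<epsilon>2 (\<epsilon>1 * \<epsilon>2)" using pu(3) pv(3) by simp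
  then have "\<rho> < 2 powr 0" unfolding \<rho>_def by (intro powr_less_mono) auto
  then have \<rho>: "0 \<le> \<rho>" "\<rho> < 1" by (simp_all add: \<rho>_def)
  have setsG: "sets ?G = sets lebesgue" by simp
  have "\<forall>k :: int. \<exists>T. T \<subseteq> grid ?p 1 \<and> countable T \<and>
    (\<forall>I\<in>T. ennreal (c * \<beta> powi k) * vol I < emeasure ?G I) \<and>
    (\<forall>J\<in>grid ?p 1. ennreal (c * \<beta> powi k) * vol J < emeasure ?G J \<longrightarrow> (\<exists>I\<in>T. J \<subseteq> I)) \<and>
    (\<forall>I\<in>T. \<forall>J\<in>grid ?p 1. ennreal (c * \<beta> powi k) * vol J < emeasure ?G J \<longrightarrow> I \<subseteq> J \<longrightarrow> J = I)"
  proof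
    fix k :: int
    have t: "0 < c * \<beta> powi k" using c \<beta>0 by simp
    show "\<exists>T. T \<subseteq> grid ?p 1 \<and> countable T \<and>
      (\<forall>I\<in>T. ennreal (c * \<beta> powi k) * vol I < emeasure ?G I) \<and>
      (\<forall>J\<in>grid ?p 1. ennreal (c * \<beta> powi k) * vol J < emeasure ?G J \<longrightarrow> (\<exists>I\<in>T. J \<subseteq> I)) \<and>
      (\<forall>I\<in>T. \<forall>J\<in>grid ?p 1. ennreal (c * \<beta> powi k) * vol J < emeasure ?G J \<longrightarrow> I \<subseteq> J \<longrightarrow> J = I)"
    proof (rule Calderon_Zygmund[OF zero_less_one setsG g(3) t, of ?p])
      fix T
      assume T: "T \<subseteq> grid ?p 1" "countable T"
        "\<And>I. I \<in> T \<Longrightarrow> ennreal (c * \<beta> powi k) * vol I < emeasure ?G I"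
        "\<And>J. J \<in> grid ?p 1 \<Longrightarrow> ennreal (c * \<beta> powi k) * vol J < emeasure ?G J \<Longrightarrow> \<exists>I\<in>T. J \<subseteq> I"
        "\<And>I J. I \<in> T \<Longrightarrow> J \<in> grid ?p 1 \<Longrightarrow> ennreal (c * \<beta> powi k) * vol J < emeasure ?G J \<Longrightarrow> I \<subseteq> J \<Longrightarrow> J = I"
      show ?thesis
        by (rule exI[of _ T], intro conjI ballI impI) (rule T; assumption)+
    qed
  qed
  then obtain T where T: "\<And>k. T k \<subseteq> grid ?p 1" "\<And>k. countable (T k)"
    "\<And>k I. I \<in> T k \<Longrightarrow> ennreal (c * \<beta> powi k) * vol I < emeasure ?G I"
    "\<And>k J. J \<in> grid ?p 1 \<Longrightarrow> ennreal (c * \<beta> powi k) * vol J < emeasure ?G J \<Longrightarrow> \<exists>I\<in>T k. J \<subseteq> I"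
    "\<And>k I J. I \<in> T k \<Longrightarrow> J \<in> grid ?p 1 \<Longrightarrow> ennreal (c * \<beta> powi k) * vol J < emeasure ?G J \<Longrightarrow> I \<subseteq> J \<Longrightarrow> J = I"
    by metis
  have TG: "I \<in> grid ?p 1" if "I \<in> T k" for I k using T(1) that by blast
  define \<Gamma> where "\<Gamma> = (SIGMA k:UNIV. T k)"
  have \<Gamma>c: "countable \<Gamma>" unfolding \<Gamma>_def using T(2) by (intro countable_SIGMA) auto
  define W where "W k = {x. \<beta> powi k < v x \<and> v x \<le> \<beta> powi (k + 1)}" for k :: int
  have WL: "W k \<in> sets lebesgue" for k
  proof -
    have "W k = v -` {\<beta> powi k<..\<beta> powi (k + 1)} \<inter> space lebesgue" by (auto simp: W_def)
    then show ?thesis using measurable_sets[OF vm, of "{\<beta> powi k<..\<beta> powi (k + 1)}"] by simp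
  qed
  define B where "B = (\<lambda>(k, I). triple I \<inter> W k)"
  have BL: "B i \<in> sets lebesgue" if i\<Gamma>: "i \<in> \<Gamma>" for i
  proof -
    obtain k I where i: "i = (k, I)" "I \<in> T k" using i\<Gamma> by (auto simp: \<Gamma>_def)
    then have "triple I \<in> sets lebesgue" using T(1) by (intro emeasure_triple_le(1)[OF _ zero_less_one]) blast
    then show ?thesis using WL by (simp add: B_def i(1))
  qed
  have "\<exists>l :: int. ennreal (\<beta> powi fst i * 2 powi l) * vol (snd i) \<le> emeasure ?V (snd i) \<and>
    emeasure ?V (snd i) \<le> ennreal (\<beta> powi fst i * 2 powi (l + 1)) * vol (snd i)" if "i \<in> \<Gamma>" for i
  proof -
    have I: "snd i \<in> grid ?p 1" using that TG by (auto simp: \<Gamma>_def)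
    have "0 < emeasure ?V (snd i)"
      using weight_emeasure_pos[OF v(1) grid_lebesgue[OF I zero_less_one]] emeasure_grid_pos[OF I zero_less_one] by blast
    then show ?thesis using \<beta>0 by (intro cell_average_level[OF I zero_less_one V]) auto
  qed
  then obtain l :: "int \<times> (real ^ 'n) set \<Rightarrow> int" where l:
    "\<And>i. i \<in> \<Gamma> \<Longrightarrow> ennreal (\<beta> powi fst i * 2 powi l i) * vol (snd i) \<le> emeasure ?V (snd i)"
    "\<And>i. i \<in> \<Gamma> \<Longrightarrow> emeasure ?V (snd i) \<le> ennreal (\<beta> powi fst i * 2 powi (l i + 1)) * vol (snd i)"
    by metis
  define K where "K = 8 * A / (c * (1 - \<theta>))"
  have K: "0 \<le> K" using u(3) c \<theta> by (simp add: K_def)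
  have layer: "(\<Sum>i\<in>F. ennreal (\<beta> powi fst i) * emeasure ?U (snd i)) \<le> ennreal K * X"
    if F: "finite F" "F \<subseteq> \<Gamma>" "\<And>i. i \<in> F \<Longrightarrow> l i = j" for F j
  proof -
    \<comment> \<open>For fixed \<open>l\<close> the average of \<open>v\<close> over a cube
      determines \<open>\<beta> powi k\<close> up to a factor 2, and \<open>\<beta> > 2\<close>
      leaves room for one \<open>k\<close> only. So each cube occurs once, and its height can be
      treated as a function of the cube, as \<open>stopping_cells\<close> requires.\<close>
    have inj: "inj_on snd F"
    proof (rule inj_onI)
      have no: "\<not> k < k'" if i: "(k, I) \<in> F" "(k', I) \<in> F" for k k' I
      proof
        assume "k < k'"
        have I: "I \<in> grid ?p 1" using i(1) F(2) TG by (auto simp: \<Gamma>_def)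
        obtain w where w: "vol I = ennreal w" "0 < w"
          using emeasure_grid_finite[OF I zero_less_one ac_loc_finite_lebesgue] emeasure_grid_pos[OF I zero_less_one]
          by (cases "vol I") auto
        have "ennreal (\<beta> powi k' * 2 powi j) * ennreal w \<le> ennreal (\<beta> powi k * 2 powi (j + 1)) * ennreal w"
          using order_trans[OF l(1)[OF subsetD[OF F(2) i(2)]]] l(2)[OF subsetD[OF F(2) i(1)]]
          by (simp add: F(3)[OF i(1)] F(3)[OF i(2)] w(1))
        then have "\<beta> powi k' * 2 powi j * w \<le> \<beta> powi k * 2 powi (j + 1) * w"
          using \<beta>0 w by (simp add: ennreal_mult[symmetric])
        then have "\<beta> powi k' \<le> 2 * \<beta> powi k" using w by (simp add: power_int_add)
        moreover have "\<beta> powi (k + 1) \<le> \<beta> powi k'" using \<open>k < k'\<close> \<beta> by (intro power_int_increasing) auto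
        moreover have "\<beta> powi (k + 1) = \<beta> * \<beta> powi k" using \<beta>0 by (simp add: power_int_add)
        ultimately have "\<beta> * \<beta> powi k \<le> 2 * \<beta> powi k" by linarith
        then show False using \<beta> \<beta>0 by simp
      qed
      fix x y assume "x \<in> F" "y \<in> F" "snd x = snd y"
      then show "x = y" using no[of "fst x" "snd x" "fst y"] no[of "fst y" "snd x" "fst x"]
        by (cases x; cases y) force
    qed
    define k where "k I = fst (the_inv_into F snd I)" for I
    have k: "k (snd i) = fst i" if "i \<in> F" for i
      using the_inv_into_f_f[OF inj that] by (simp add: k_def)
    have "stopping_cells ?p 1 ?G ?V \<beta> c j (snd ` F) k"
      unfolding stopping_cells_def
    proof (intro conjI ballI)
      show "finite (snd ` F)" using F by simp
      show "snd ` F \<subseteq> grid ?p 1" using F TG by (auto simp: \<Gamma>_def)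
      fix I assume "I \<in> snd ` F"
      then obtain i where i: "i \<in> F" "I = snd i" by blast
      have iT: "I \<in> T (fst i)" using i F(2) by (auto simp: \<Gamma>_def)
      have i\<Gamma>: "i \<in> \<Gamma>" using i F by blast
      show "ennreal (c * \<beta> powi k I) * vol I < emeasure ?G I"
        using T(3)[OF iT] k[OF i(1)] i(2) by simp
      show "ennreal (\<beta> powi k I * 2 powi j) * vol I \<le> emeasure ?V I"
        "emeasure ?V I \<le> ennreal (\<beta> powi k I * 2 powi (j + 1)) * vol I"
        using l[OF i\<Gamma>] k[OF i(1)] i(2) F(3)[OF i(1)] by simp_all
      fix J assume J: "J \<in> grid ?p 1"
      show "ennreal (c * \<beta> powi k I) * vol J < emeasure ?G J \<longrightarrow> I \<subseteq> J \<longrightarrow> J = I"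
        using T(5)[OF iT J] k[OF i(1)] i(2) by simp
    qed
    then have "(\<Sum>I\<in>snd ` F. ennreal (\<beta> powi k I) * emeasure ?U I) \<le> ennreal K * X"
      unfolding K_def X_def by (rule stopping_cells_sum[OF zero_less_one _ g(1,2) V v(2) \<delta> \<theta> \<beta>2 \<beta>(2) c u])
    moreover have "(\<Sum>I\<in>snd ` F. ennreal (\<beta> powi k I) * emeasure ?U I) = (\<Sum>i\<in>F. ennreal (\<beta> powi fst i) * emeasure ?U (snd i))"
      using k by (simp add: sum.reindex[OF inj])
    ultimately show ?thesis by simp
  qed
  \<comment> \<open>On the layer \<open>v\<close> is at most \<open>\<beta> powi (k + 1)\<close>,
    which costs one factor \<beta>; the rest is the decay in \<open>\<bar>l\<bar>\<close> relative
    to \<open>I\<close>.\<close>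
  have piece: "emeasure ?M (B i) \<le> ennreal (\<beta> * \<Phi> * \<rho> ^ nat \<bar>l i\<bar>) * (ennreal (\<beta> powi fst i) * emeasure ?U (snd i))"
    if i: "i \<in> \<Gamma>" for i
  proof -
    obtain k I where kI: "i = (k, I)" by (cases i)
    have I: "I \<in> grid ?p 1" using i TG by (auto simp: \<Gamma>_def kI)
    have "emeasure ?M (B i) \<le> ennreal (\<beta> powi (k + 1)) * emeasure ?U (B i)"
      using u(1) \<beta>0 BL[OF i]
      by (intro emeasure_weighted_mult_le[OF um _ vm]) (auto simp: weight_def B_def W_def kI)
    also have "\<dots> \<le> ennreal (\<beta> powi (k + 1)) * (ennreal (\<Phi> * \<rho> ^ nat \<bar>l i\<bar>) * emeasure ?U I)"
      unfolding \<Phi>_def \<rho>_def n_def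
      by (intro mult_left_mono level_piece_decay[OF zero_less_one I u v(1) D pv pu \<beta>2, of k "l i"])
         (use l[OF i] BL[OF i] in \<open>auto simp: kI B_def W_def\<close>)
    also have "\<dots> = ennreal (\<beta> * \<Phi> * \<rho> ^ nat \<bar>l i\<bar>) * (ennreal (\<beta> powi k) * emeasure ?U I)"
    proof -
      have "\<beta> powi (k + 1) * (\<Phi> * \<rho> ^ nat \<bar>l i\<bar>) = \<beta> * \<Phi> * \<rho> ^ nat \<bar>l i\<bar> * \<beta> powi k"
        using \<beta>0 by (simp add: power_int_add)
      then have "ennreal (\<beta> powi (k + 1)) * ennreal (\<Phi> * \<rho> ^ nat \<bar>l i\<bar>) = ennreal (\<beta> * \<Phi> * \<rho> ^ nat \<bar>l i\<bar>) * ennreal (\<beta> powi k)"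
        using \<beta>0 \<Phi> \<rho> by (simp add: ennreal_mult[symmetric])
      then show ?thesis by (simp only: mult.assoc[symmetric])
    qed
    finally show ?thesis by (simp add: kI)
  qed
  define S where "S = (\<Union>i\<in>\<Gamma>. B i)"
  have SL: "S \<in> sets lebesgue" unfolding S_def using \<Gamma>c BL by (intro sets.countable_UN') auto
  have "emeasure ?M S \<le> ennreal (\<beta> * \<Phi> * (2 / (1 - \<rho>)) * K) * X"
    unfolding S_def
  proof (rule emeasure_countable_UN_le[OF \<Gamma>c])
    show "B i \<in> sets ?M" if "i \<in> \<Gamma>" for i using BL[OF that] by simp
    fix F assume F: "finite F" "F \<subseteq> \<Gamma>"
    let ?F = "\<lambda>j. {i \<in> F. l i = j}"
    have "(\<Sum>i\<in>F. emeasure ?M (B i)) \<le> (\<Sum>i\<in>F. ennreal (\<beta> * \<Phi> * \<rho> ^ nat \<bar>l i\<bar>) * (ennreal (\<beta> powi fst i) * emeasure ?U (snd i)))"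
      using F(2) by (intro sum_mono piece) auto
    also have "\<dots> = (\<Sum>j\<in>l ` F. \<Sum>i\<in>?F j. ennreal (\<beta> * \<Phi> * \<rho> ^ nat \<bar>l i\<bar>) * (ennreal (\<beta> powi fst i) * emeasure ?U (snd i)))"
      by (rule sum.image_gen[OF F(1)])
    also have "\<dots> = (\<Sum>j\<in>l ` F. ennreal (\<beta> * \<Phi> * \<rho> ^ nat \<bar>j\<bar>) * (\<Sum>i\<in>?F j. ennreal (\<beta> powi fst i) * emeasure ?U (snd i)))"
      by (intro sum.cong refl) (simp add: sum_distrib_left)
    also have "\<dots> \<le> (\<Sum>j\<in>l ` F. ennreal (\<beta> * \<Phi> * \<rho> ^ nat \<bar>j\<bar>) * (ennreal K * X))"
      using F by (intro sum_mono mult_left_mono layer) auto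
    also have "\<dots> = ennreal (\<Sum>j\<in>l ` F. \<beta> * \<Phi> * \<rho> ^ nat \<bar>j\<bar>) * (ennreal K * X)"
      using \<beta>0 \<Phi> \<rho> by (simp add: sum_distrib_right[symmetric] sum_ennreal)
    also have "\<dots> \<le> ennreal (\<beta> * \<Phi> * (2 / (1 - \<rho>))) * (ennreal K * X)"
    proof (intro mult_right_mono ennreal_leI)
      have "(\<Sum>j\<in>l ` F. \<beta> * \<Phi> * \<rho> ^ nat \<bar>j\<bar>) = \<beta> * \<Phi> * (\<Sum>j\<in>l ` F. \<rho> ^ nat \<bar>j\<bar>)" by (rule sum_distrib_left[symmetric])
      also have "\<dots> \<le> \<beta> * \<Phi> * (2 / (1 - \<rho>))"
        using \<beta>0 \<Phi> F(1) by (intro mult_left_mono sum_two_sided_geometric_le \<rho>) auto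
      finally show "(\<Sum>j\<in>l ` F. \<beta> * \<Phi> * \<rho> ^ nat \<bar>j\<bar>) \<le> \<beta> * \<Phi> * (2 / (1 - \<rho>))" .
    qed simp
    also have "\<dots> = ennreal (\<beta> * \<Phi> * (2 / (1 - \<rho>)) * K) * X"
    proof -
      have "ennreal (\<beta> * \<Phi> * (2 / (1 - \<rho>))) * ennreal K = ennreal (\<beta> * \<Phi> * (2 / (1 - \<rho>)) * K)"
        using \<beta>0 \<Phi> \<rho> K by (intro ennreal_mult[symmetric]) auto
      then show ?thesis by (simp only: mult.assoc[symmetric])
    qed
    finally show "(\<Sum>i\<in>F. emeasure ?M (B i)) \<le> ennreal (\<beta> * \<Phi> * (2 / (1 - \<rho>)) * K) * X" .
  qed
  moreover have "K = 8 * A * 4 ^ n / (1 - \<theta>)" by (simp add: K_def c_def)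
  moreover have "x \<in> S" if x: "0 < v x" "0 < r" "x \<in> closed_cube a r"
    "ennreal (v x) * vol (closed_cube a r) < emeasure ?G (closed_cube a r)" for x a r
  proof -
    let ?Q = "closed_cube a r"
    \<comment> \<open>\<open>dyadic_level\<close> produces intervals closed on the left, while the
      layers are closed on the right; taking reciprocals exchanges the ends.\<close>
    have "\<exists>k::int. \<beta> powi k < v x \<and> v x \<le> \<beta> powi (k + 1)"
    proof -
      obtain m :: int where m: "\<beta> powi m \<le> 1 / v x" "1 / v x < \<beta> powi (m + 1)"
        using dyadic_level[of "1 / v x" \<beta>] x(1) \<beta> by auto
      have "v x \<le> 1 / \<beta> powi m" "1 / \<beta> powi (m + 1) < v x"
        using m x(1) \<beta>0 by (simp_all add: field_simps)
      moreover have "1 / \<beta> powi m = \<beta> powi (- (m + 1) + 1)"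
        by (simp add: power_int_minus inverse_eq_divide)
      moreover have "1 / \<beta> powi (m + 1) = \<beta> powi (- (m + 1))"
        by (simp only: power_int_minus inverse_eq_divide)
      ultimately show ?thesis by metis
    qed
    then obtain k :: int where k: "\<beta> powi k < v x" "v x \<le> \<beta> powi (k + 1)" by blast
    \<comment> \<open>The constant \<open>c\<close> was chosen so that the loss in
      \<open>cube_to_cell\<close> leads exactly to the stopping height of layer
      \<open>k\<close>.\<close>
    have "4 ^ CARD('n) * (c * \<beta> powi k) = \<beta> powi k" by (simp add: c_def n_def)
    then have "4 ^ CARD('n) * (c * \<beta> powi k) \<le> v x" using k(1) by linarith
    then have "ennreal (4 ^ CARD('n) * (c * \<beta> powi k)) * vol ?Q \<le> ennreal (v x) * vol ?Q"
      by (intro mult_right_mono ennreal_leI) auto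
    also note x(4)
    finally obtain J where J: "J \<in> grid ?p 1" "ennreal (c * \<beta> powi k) * vol J < emeasure ?G J" "?Q \<subseteq> triple J"
      using cube_to_cell[OF zero_less_one x(2) setsG, of "c * \<beta> powi k" a ?p] c \<beta>0 by auto
    obtain I where I: "I \<in> T k" "J \<subseteq> I" using T(4)[OF J(1,2)] by blast
    have "x \<in> B (k, I)" using J(3) x(3) triple_mono[OF I(2)] k by (auto simp: B_def W_def)
    then show ?thesis using I(1) unfolding S_def \<Gamma>_def by blast
  qed
  ultimately show ?thesis using SL unfolding X_def level_cover_def by (intro bexI[of _ S]) auto
qed

lemma mixed_weak_type:
  assumes A: "0 \<le> A" and K: "0 \<le> K"
  shows "\<exists>C\<ge>0. \<forall>u v :: real ^ 'n \<Rightarrow> real. weight u \<longrightarrow> A1_const u = ennreal A \<longrightarrow>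
    weight v \<longrightarrow> Ainf_const v = ennreal K \<longrightarrow>
    (\<forall>g. g \<in> borel_measurable lebesgue \<longrightarrow> (\<forall>x. 0 \<le> g x) \<longrightarrow> emeasure (weighted g) UNIV < \<infinity> \<longrightarrow>
      level_cover C u v g)"
proof -
  obtain \<delta>0 where \<delta>0: "0 < \<delta>0" "\<And>v :: real ^ 'n \<Rightarrow> real. weight v \<Longrightarrow> Ainf_const v \<le> ennreal K \<Longrightarrow> cube_Ainf \<delta>0 (1 / 2) (weighted v)"
    using Ainf_const_imp_cube_Ainf[OF K, where 'n = 'n] by blast
  \<comment> \<open>Shrinking \<delta> below 1 preserves the condition and keeps
    \<open>1 - \<delta>\<close>, the threshold in \<open>cube_Ainf_power_dominated\<close>,
    positive.\<close>
  define \<delta> where "\<delta> = min \<delta>0 (1 / 2)"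
  have \<delta>: "0 < \<delta>" "\<delta> < 1" using \<delta>0(1) by (auto simp: \<delta>_def)
  have \<theta>: "(0::real) \<le> 1 / 2" "(1 / 2 :: real) < 1" by auto
  have cA: "cube_Ainf \<delta> (1 / 2) (weighted v)" if "weight v" "Ainf_const v = ennreal K" for v :: "real ^ 'n \<Rightarrow> real"
    unfolding cube_Ainf_def
  proof (intro allI impI)
    fix a :: "real ^ 'n" and l :: real and E
    assume *: "0 < l" "E \<in> sets lebesgue" "E \<subseteq> hcube a l" "vol E \<le> ennreal \<delta> * vol (hcube a l)"
    have "vol E \<le> ennreal \<delta>0 * vol (hcube a l)"
      by (rule order_trans[OF *(4)]) (intro mult_right_mono ennreal_leI, auto simp: \<delta>_def)
    then show "emeasure (weighted v) E \<le> ennreal (1 / 2) * emeasure (weighted v) (hcube a l)"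
      using cube_AinfD[OF \<delta>0(2)[OF that(1)] *(1-3)] that(2) by simp
  qed
  obtain D where D: "1 \<le> D" "\<And>V :: (real ^ 'n) measure. cube_Ainf \<delta> (1 / 2) V \<Longrightarrow> ac_loc_finite V \<Longrightarrow>
    (\<forall>a l b L. 0 < l \<longrightarrow> hcube a l \<subseteq> hcube b L \<longrightarrow> L \<le> 3 * l \<longrightarrow>
      emeasure V (hcube b L) \<le> ennreal D * emeasure V (hcube a l))"
    using cube_Ainf_doubling[OF \<delta>(1) \<theta>, where 'n = 'n] by blast
  obtain Bv \<epsilon>1 where Bv: "0 \<le> Bv" "0 < \<epsilon>1" "\<And>V :: (real ^ 'n) measure. cube_Ainf \<delta> (1 / 2) V \<Longrightarrow> ac_loc_finite V \<Longrightarrow>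
    (\<forall>a l. 0 < l \<longrightarrow> 0 < emeasure V (hcube a l)) \<Longrightarrow> power_dominated Bv \<epsilon>1 lebesgue V"
    using cube_Ainf_power_dominated[OF \<delta> \<theta>, where 'n = 'n] by blast
  obtain Bu \<epsilon>2 where Bu: "0 \<le> Bu" "0 < \<epsilon>2" "\<And>u :: real ^ 'n \<Rightarrow> real. weight u \<Longrightarrow> A1_const u = ennreal A \<Longrightarrow>
    power_dominated Bu \<epsilon>2 (weighted u) lebesgue"
    using A1_power_dominated[OF A, where 'n = 'n] by blast
  \<comment> \<open>Being above 2 separates the heights of a given cube; being at least
    \<open>2 / \<delta>\<close> gives sparseness.\<close>
  define \<beta> where "\<beta> = max 3 (2 / \<delta>)"
  have \<beta>: "2 < \<beta>" "2 / \<delta> \<le> \<beta>" by (auto simp: \<beta>_def)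
  define \<Phi> where "\<Phi> = 3 ^ CARD('n) * A * Bu * ((2 * D) powr \<epsilon>2 + (Bv * (\<beta> * 3 ^ CARD('n)) powr \<epsilon>1) powr \<epsilon>2)"
  define \<rho> :: real where "\<rho> = 2 powr - min \<epsilon>2 (\<epsilon>1 * \<epsilon>2)"
  define C where "C = \<beta> * \<Phi> * (2 / (1 - \<rho>)) * (8 * A * 4 ^ CARD('n) / (1 - 1 / 2))"
  have "0 < min \<epsilon>2 (\<epsilon>1 * \<epsilon>2)" using Bv(2) Bu(2) by simp
  then have "\<rho> < 2 powr 0" unfolding \<rho>_def by (intro powr_less_mono) auto
  then have "\<rho> < 1" by simp
  then have "0 \<le> C" using \<beta> A Bu(1) unfolding C_def \<Phi>_def by (intro mult_nonneg_nonneg) auto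
  moreover have "level_cover C u v g"
    if u: "weight u" "A1_const u = ennreal A" and v: "weight v" "Ainf_const v = ennreal K"
      and g: "g \<in> borel_measurable lebesgue" "\<forall>x. 0 \<le> g x" "emeasure (weighted g) UNIV < \<infinity>"
    for u v g :: "real ^ 'n \<Rightarrow> real"
    unfolding C_def \<Phi>_def \<rho>_def
  proof (rule mixed_weak_type_integrable[OF u A v(1) cA[OF v] \<delta>(1) \<theta> \<beta> D(1) _ _ Bv(1,2) Bu(3)[OF u] Bu(1,2) g(1) _ g(3)])
    show "emeasure (weighted v) (hcube b L) \<le> ennreal D * emeasure (weighted v) (hcube a l)"
      if "0 < l" "hcube a l \<subseteq> hcube b L" "L \<le> 3 * l" for a l b L
      using D(2)[OF cA[OF v] weight_ac_loc_finite[OF v(1)]] that by blast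
    show "power_dominated Bv \<epsilon>1 lebesgue (weighted v)"
      using weight_hcube_pos[OF v(1)] by (intro Bv(3) cA v weight_ac_loc_finite) auto
    show "0 \<le> g x" for x using g(2) by blast
  qed
  ultimately show ?thesis by (intro exI[of _ C] conjI allI impI) auto
qed

section \<open>Truncation and the passage to general functions\<close>

lemma emeasure_weighted_cmult:
  assumes f: "f \<in> borel_measurable lebesgue" "\<And>x. 0 \<le> f x" and c: "0 \<le> c" and E: "E \<in> sets lebesgue"
    and h: "\<And>x. x \<in> E \<Longrightarrow> h x = c * f x" "h \<in> borel_measurable lebesgue"
  shows "emeasure (weighted h) E = ennreal c * emeasure (weighted f) E"
proof -
  have "emeasure (weighted h) E = (\<integral>\<^sup>+x. ennreal (h x) * indicator E x \<partial>lebesgue)"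
    by (rule emeasure_weighted[OF h(2) E])
  also have "\<dots> = (\<integral>\<^sup>+x. ennreal c * (ennreal (f x) * indicator E x) \<partial>lebesgue)"
    using c f(2) h(1) by (intro nn_integral_cong) (auto simp: indicator_def ennreal_mult)
  also have "\<dots> = ennreal c * (\<integral>\<^sup>+x. ennreal (f x) * indicator E x \<partial>lebesgue)"
    using f(1) E by (intro nn_integral_cmult) auto
  finally show ?thesis using emeasure_weighted[OF f(1) E] by simp
qed

text \<open>An \<open>A\<^sub>1\<close> weight is bounded below on every cube.\<close>

lemma A1_integrable_on_cube:
  fixes a :: "real ^ 'n"
  assumes u: "weight u" "A1_const u = ennreal A" "0 \<le> A" and l: "0 < l"
    and g: "g \<in> borel_measurable lebesgue" "\<And>x. 0 \<le> g x" "\<And>x. x \<notin> hcube a l \<Longrightarrow> g x = 0"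
    and fin: "(\<integral>\<^sup>+x. ennreal (g x) * ennreal (u x) \<partial>lebesgue) < \<infinity>"
  shows "emeasure (weighted g) UNIV < \<infinity>"
proof -
  let ?Q = "hcube a l"
  note um = weight_measurable[OF u(1)]
  obtain q where q: "emeasure (weighted u) ?Q = ennreal q" "0 < q"
    using ac_loc_finite_hcube[OF weight_ac_loc_finite[OF u(1)], of a l] weight_hcube_pos[OF u(1) l, of a]
    by (cases "emeasure (weighted u) ?Q") auto
  obtain h where h: "vol ?Q = ennreal h" "0 < h"
    using hcube_pos_finite[OF l, of a] by (cases "vol ?Q") auto
  have "ennreal q * emeasure (weighted g) UNIV = (\<integral>\<^sup>+x. ennreal q * ennreal (g x) \<partial>lebesgue)"
    using g(1) emeasure_weighted[OF g(1), of UNIV] by (simp add: nn_integral_cmult)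
  also have "\<dots> \<le> (\<integral>\<^sup>+x. ennreal (A * h) * (ennreal (g x) * ennreal (u x)) \<partial>lebesgue)"
  proof (rule nn_integral_mono_AE)
    show "AE x in lebesgue. ennreal q * ennreal (g x) \<le> ennreal (A * h) * (ennreal (g x) * ennreal (u x))"
      using A1_maximal[OF u(1,2)]
    proof eventually_elim
      case (elim x)
      show ?case
      proof (cases "x \<in> ?Q")
        case True
        have "ennreal q \<le> maximal u x * ennreal h"
          using maximal_ge_avg[OF um l True] weight_abs[OF u(1)] q h by simp
        also have "\<dots> \<le> (ennreal A * ennreal (u x)) * ennreal h" using elim by (intro mult_right_mono) auto
        finally have "ennreal q * ennreal (g x) \<le> (ennreal A * ennreal (u x)) * ennreal h * ennreal (g x)"
          by (rule mult_right_mono) simp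
        also have "\<dots> = ennreal (A * h) * (ennreal (g x) * ennreal (u x))"
          using u(3) h(2) by (simp add: ennreal_mult mult_ac)
        finally show ?thesis .
      qed (simp add: g(3))
    qed
  qed
  also have "\<dots> = ennreal (A * h) * (\<integral>\<^sup>+x. ennreal (g x) * ennreal (u x) \<partial>lebesgue)"
    using g(1) um by (intro nn_integral_cmult) auto
  also have "\<dots> < \<infinity>" using fin by (simp add: ennreal_mult_less_top)
  finally show ?thesis using q(2) by (auto simp: ennreal_mult_less_top)
qed

text \<open>Fatou's lemma for sets. The covers found for the successive truncations are chosen
  independently and need not increase, so their union cannot be used.\<close>

lemma emeasure_liminf_le:
  assumes S: "\<And>n::nat. S n \<in> sets M" and le: "\<And>n. emeasure M (S n) \<le> c"
  shows "emeasure M (\<Union>n. \<Inter>m\<in>{n..}. S m) \<le> c"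
proof -
  have "emeasure M (\<Union>n. \<Inter>m\<in>{n..}. S m) = (SUP n. emeasure M (\<Inter>m\<in>{n..}. S m))"
    using S by (intro SUP_emeasure_incseq[symmetric]) (auto simp: incseq_def)
  also have "\<dots> \<le> c"
  proof (rule SUP_least)
    fix n
    have "emeasure M (\<Inter>m\<in>{n..}. S m) \<le> emeasure M (S n)" using S by (intro emeasure_mono) auto
    then show "emeasure M (\<Inter>m\<in>{n..}. S m) \<le> c" using le[of n] by simp
  qed
  finally show ?thesis .
qed

theorem theorem1p2:
  shows "\<exists>c :: ennreal \<Rightarrow> ennreal \<Rightarrow> real.
    \<forall>u \<in> (A1 :: (real ^ 'n \<Rightarrow> real) set). \<forall>v \<in> Ainf. \<forall>f.
      integrable (weighted (\<lambda>x. u x * v x)) f \<longrightarrow>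
      weak_L1_norm (weighted (\<lambda>x. u x * v x))
          (\<lambda>x. maximal (\<lambda>y. f y * v y) x / ennreal (v x))
        \<le> ennreal (c (A1_const u) (Ainf_const v))
            * L1_norm (weighted (\<lambda>x. u x * v x)) f"
proof -
  \<comment> \<open>Fixing the two constants first and choosing \<open>C\<close> afterwards for all
    weights with these constants produces \<open>c\<close> as a function of them alone.\<close>
  define P where "P a k C \<longleftrightarrow> (\<forall>u \<in> (A1 :: (real ^ 'n \<Rightarrow> real) set). \<forall>v \<in> Ainf.
    A1_const u = a \<longrightarrow> Ainf_const v = k \<longrightarrow> (\<forall>f.
      integrable (weighted (\<lambda>x. u x * v x)) f \<longrightarrow>
      weak_L1_norm (weighted (\<lambda>x. u x * v x)) (\<lambda>x. maximal (\<lambda>y. f y * v y) x / ennreal (v x))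
        \<le> ennreal C * L1_norm (weighted (\<lambda>x. u x * v x)) f))" for a k C
  have "\<forall>a k. \<exists>C. P a k C"
  proof (intro allI)
    fix a k :: ennreal
    show "\<exists>C. P a k C"
    proof (cases "a = \<infinity> \<or> k = \<infinity>")
      case True
      have "A1_const u \<noteq> \<infinity>" if "u \<in> A1" for u :: "real ^ 'n \<Rightarrow> real" using that by (auto simp: A1_def)
      \<comment> \<open>No real \<open>C\<close> could be read off from an infinite constant; this
        case is vacuous because the \<open>A\<^sub>p\<close> condition implies
        \<open>cube_Ainf\<close>, which in turn makes the Fujii-Wilson constant finite.\<close>
      moreover have "Ainf_const v \<noteq> \<infinity>" if v: "v \<in> Ainf" for v :: "real ^ 'n \<Rightarrow> real"
      proof -
        obtain p where p: "1 < p" "v \<in> Ap p" using v by (auto simp: Ainf_def)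
        obtain \<theta> where "0 \<le> \<theta>" "\<theta> < 1" "cube_Ainf (1 / 2) \<theta> (weighted v)" using Ap_imp_cube_Ainf[OF p] by blast
        then have "Ainf_const v < \<infinity>"
          using p(2) by (intro cube_Ainf_imp_Ainf_const_finite[of v "1 / 2" \<theta>]) (auto simp: Ap_def)
        then show ?thesis by simp
      qed
      ultimately show ?thesis using True unfolding P_def by blast
    next
      case False
      obtain A K where AK: "a = ennreal A" "0 \<le> A" "k = ennreal K" "0 \<le> K" using False by (cases a; cases k) auto
      obtain C where C: "0 \<le> C" and main: "\<And>u v g :: real ^ 'n \<Rightarrow> real. weight u \<Longrightarrow> A1_const u = ennreal A \<Longrightarrow>
        weight v \<Longrightarrow> Ainf_const v = ennreal K \<Longrightarrow>
        g \<in> borel_measurable lebesgue \<Longrightarrow> (\<forall>x. 0 \<le> g x) \<Longrightarrow> emeasure (weighted g) UNIV < \<infinity> \<Longrightarrow>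
        level_cover C u v g"
        using mixed_weak_type[OF AK(2,4), where 'n = 'n] by blast
      show ?thesis
        unfolding P_def
      proof (intro exI[of _ C] ballI impI allI)
        fix u v f :: "real ^ 'n \<Rightarrow> real"
        let ?M = "weighted (\<lambda>x. u x * v x)"
        assume "u \<in> A1" "v \<in> Ainf" and Ac: "A1_const u = a" and Kc: "Ainf_const v = k" and f: "integrable ?M f"
        then have u: "weight u" "A1_const u = ennreal A" and v: "weight v" "Ainf_const v = ennreal K"
          using AK by (auto simp: A1_def Ainf_def Ap_def)
        note um = weight_measurable[OF u(1)] and vm = weight_measurable[OF v(1)]
        have u0: "0 \<le> u x" and v0: "0 \<le> v x" for x using u v by (auto simp: weight_def)
        have uvm: "(\<lambda>x. u x * v x) \<in> borel_measurable lebesgue" using um vm by (rule borel_measurable_times)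
        have fm: "f \<in> borel_measurable lebesgue"
          using borel_measurable_integrable[OF f] measurable_cong_sets[of ?M lebesgue borel borel] by auto
        define X where "X = (\<integral>\<^sup>+x. ennreal (u x * v x) * ennreal \<bar>f x\<bar> \<partial>lebesgue)"
        have L1: "L1_norm ?M f = X"
          unfolding L1_norm_def X_def weighted_def using uvm fm by (intro nn_integral_density) auto
        have "L1_norm ?M f < \<infinity>" using f unfolding L1_norm_def integrable_iff_bounded by simp
        then have Xfin: "X < \<infinity>" using L1 by simp
        let ?fv = "\<lambda>y. f y * v y"
        have fvm: "?fv \<in> borel_measurable lebesgue" using fm vm by (rule borel_measurable_times)
        show "weak_L1_norm ?M (\<lambda>x. maximal ?fv x / ennreal (v x)) \<le> ennreal C * L1_norm ?M f"
          unfolding weak_L1_norm_def L1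
        proof (rule SUP_least)
          fix t :: real assume "t \<in> {0<..}"
          then have t: "0 < t" by simp
          define Q :: "nat \<Rightarrow> (real ^ 'n) set" where "Q R = hcube (\<chi> i. - real (Suc R)) (2 * real (Suc R))" for R
          \<comment> \<open>Dividing by \<open>t\<close> reduces the level set at height
            \<open>t\<close> to the comparison of a maximal function with \<open>v\<close>. The
            cutoff makes \<open>g R\<close> integrable, since \<open>u\<close> is bounded below on
            \<open>Q R\<close>.\<close>
          define g where "g R x = \<bar>?fv x\<bar> / t * indicator (Q R) x" for R x
          have gm: "g R \<in> borel_measurable lebesgue" for R
            unfolding g_def[abs_def] Q_def using fm vm
            by (intro borel_measurable_times borel_measurable_divide borel_measurable_abs borel_measurable_const borel_measurable_indicator) auto
          have g0: "0 \<le> g R x" for R x using t by (simp add: g_def)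
          have gX: "(\<integral>\<^sup>+x. ennreal (g R x) * ennreal (u x) \<partial>lebesgue) \<le> ennreal (1 / t) * X" for R
          proof -
            have "(\<integral>\<^sup>+x. ennreal (g R x) * ennreal (u x) \<partial>lebesgue)
              \<le> (\<integral>\<^sup>+x. ennreal (1 / t) * (ennreal (u x * v x) * ennreal \<bar>f x\<bar>) \<partial>lebesgue)"
            proof (rule nn_integral_mono)
              fix x
              have "g R x * u x \<le> 1 / t * (u x * v x * \<bar>f x\<bar>)"
                using u0[of x] v0[of x] t by (auto simp: g_def indicator_def abs_mult mult_ac)
              then show "ennreal (g R x) * ennreal (u x) \<le> ennreal (1 / t) * (ennreal (u x * v x) * ennreal \<bar>f x\<bar>)"
                using u0[of x] v0[of x] t g0[of R x] by (simp add: ennreal_mult[symmetric] ennreal_leI)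
            qed
            also have "\<dots> = ennreal (1 / t) * X"
              unfolding X_def using uvm fm by (intro nn_integral_cmult) auto
            finally show ?thesis .
          qed
          have gfin: "emeasure (weighted (g R)) UNIV < \<infinity>" for R
          proof (rule A1_integrable_on_cube[OF u AK(2) _ gm g0])
            show "0 < 2 * real (Suc R)" by simp
            show "g R x = 0" if "x \<notin> hcube (\<chi> i. - real (Suc R)) (2 * real (Suc R))" for x
              using that by (simp add: g_def Q_def)
            have "ennreal (1 / t) * X < \<infinity>" using Xfin by (simp add: ennreal_mult_less_top)
            then show "(\<integral>\<^sup>+x. ennreal (g R x) * ennreal (u x) \<partial>lebesgue) < \<infinity>"
              using gX[of R] by (rule le_less_trans[rotated])
          qed
          define cov where "cov R S \<longleftrightarrow> S \<in> sets lebesgue \<and>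
            (\<forall>x a l. 0 < v x \<longrightarrow> 0 < l \<longrightarrow> x \<in> closed_cube a l \<longrightarrow>
              ennreal (v x) * vol (closed_cube a l)
                < emeasure (weighted (g R)) (closed_cube a l) \<longrightarrow> x \<in> S) \<and>
            emeasure ?M S \<le> ennreal C * (\<integral>\<^sup>+x. ennreal (g R x) * ennreal (u x) \<partial>lebesgue)" for R S
          have "\<exists>S. cov R S" for R
            using main[OF u v gm _ gfin, of R] g0 unfolding level_cover_def cov_def by blast
          then obtain S where cov: "cov R (S R)" for R by metis
          have S: "\<And>R. S R \<in> sets lebesgue"
            "\<And>R x a l. 0 < v x \<Longrightarrow> 0 < l \<Longrightarrow> x \<in> closed_cube a l \<Longrightarrow>
              ennreal (v x) * vol (closed_cube a l)
                < emeasure (weighted (g R)) (closed_cube a l) \<Longrightarrow> x \<in> S R"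
            "\<And>R. emeasure ?M (S R) \<le> ennreal C * (\<integral>\<^sup>+x. ennreal (g R x) * ennreal (u x) \<partial>lebesgue)"
            using cov unfolding cov_def by blast+
          \<comment> \<open>Where \<open>v\<close> vanishes, the quotient in \<open>ennreal\<close>
            is infinite unless the maximal function is 0, so these points may belong to the level
            set. They form a null set.\<close>
          define Z where "Z = {x. \<not> 0 < v x}"
          have ZL: "Z \<in> sets lebesgue"
          proof -
            have "Z = v -` {..0} \<inter> space lebesgue" by (auto simp: Z_def)
            then show ?thesis using measurable_sets[OF vm, of "{..0}"] by simp
          qed
          have "Z \<in> null_sets lebesgue"
            using v(1) ZL unfolding weight_def by (subst (asm) AE_iff_measurable[of Z]) (auto simp: Z_def)
          then have ZM: "Z \<in> null_sets ?M"
            using ac_weighted[OF uvm] unfolding absolutely_continuous_def by blast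
          \<comment> \<open>The points that lie in the covers of all sufficiently late
            truncations.\<close>
          let ?L = "\<Union>R. \<Inter>R'\<in>{R..}. S R'"
          have LL: "?L \<in> sets lebesgue" using S(1) by (intro sets.countable_UN' sets.countable_INT'') auto
          have cover: "{x \<in> space ?M. ennreal t < maximal ?fv x / ennreal (v x)} \<subseteq> ?L \<union> Z"
          proof
            fix x assume "x \<in> {x \<in> space ?M. ennreal t < maximal ?fv x / ennreal (v x)}"
            then have x: "ennreal t < maximal ?fv x / ennreal (v x)" by simp
            show "x \<in> ?L \<union> Z"
            proof (cases "0 < v x")
              case True
              have "\<not> maximal ?fv x \<le> ennreal t * ennreal (v x)"
                using x True ennreal_divide_le_iff_mult[of "ennreal (v x)" "maximal ?fv x" "ennreal t"] by (auto simp: not_le)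
              then have "ennreal (t * v x) < maximal ?fv x" using t True by (simp add: ennreal_mult not_le)
              then obtain b l where b: "0 < l" "x \<in> closed_cube b l"
                "ennreal (t * v x) * vol (closed_cube b l) < emeasure (weighted (\<lambda>y. \<bar>?fv y\<bar>)) (closed_cube b l)"
                using maximal_gtD[OF fvm] by blast
              let ?B = "closed_cube b l"
              obtain r where r: "\<And>y. y \<in> ?B \<Longrightarrow> norm y \<le> r" using bounded_cbox[of b] unfolding bounded_iff by blast
              obtain R0 :: nat where R0: "r \<le> real R0" using real_arch_simple by blast
              \<comment> \<open>Once \<open>Q R\<close> contains the cube that witnesses the large
                average at \<open>x\<close>, the cutoff no longer changes that average.\<close>
              have "x \<in> S R" if R: "R0 \<le> R" for R
              proof (rule S(2)[OF True b(1,2)])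
                have BQ: "y \<in> Q R" if y: "y \<in> ?B" for y
                proof -
                  have "\<bar>y $ i\<bar> < real (Suc R)" for i
                    using component_le_norm_cart[of y i] r[OF y] R0 R by simp
                  then show ?thesis unfolding Q_def hcube_def by (auto simp: abs_less_iff) (smt (verit))+
                qed
                have W: "emeasure (weighted (g R)) ?B = ennreal (1 / t) * emeasure (weighted (\<lambda>y. \<bar>?fv y\<bar>)) ?B"
                  using fvm t gm BQ by (intro emeasure_weighted_cmult) (auto simp: g_def)
                show "ennreal (v x) * vol ?B < emeasure (weighted (g R)) ?B"
                proof (rule ccontr)
                  assume "\<not> ?thesis"
                  then have "ennreal (1 / t) * emeasure (weighted (\<lambda>y. \<bar>?fv y\<bar>)) ?B \<le> ennreal (v x) * vol ?B"
                    unfolding W by (simp add: not_less)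
                  then have "emeasure (weighted (\<lambda>y. \<bar>?fv y\<bar>)) ?B \<le> ennreal (1 / (1 / t)) * (ennreal (v x) * vol ?B)"
                    using t by (intro ennreal_mult_le_imp_le) auto
                  also have "\<dots> = ennreal (t * v x) * vol ?B"
                    using t True by (simp add: ennreal_mult mult.assoc)
                  finally show False using b(3) by simp
                qed
              qed
              then show ?thesis by auto
            qed (simp add: Z_def)
          qed
          have "emeasure ?M {x \<in> space ?M. ennreal t < maximal ?fv x / ennreal (v x)} \<le> emeasure ?M (?L \<union> Z)"
            using cover LL ZL by (intro emeasure_mono) auto
          also have "\<dots> = emeasure ?M ?L" using LL ZM by (intro emeasure_Un_null_set) auto
          also have "\<dots> \<le> ennreal C * (ennreal (1 / t) * X)"
            using S(1) by (intro emeasure_liminf_le order_trans[OF S(3)] mult_left_mono gX) auto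
          finally have "ennreal t * emeasure ?M {x \<in> space ?M. ennreal t < maximal ?fv x / ennreal (v x)}
            \<le> ennreal t * (ennreal C * (ennreal (1 / t) * X))" by (rule mult_left_mono) simp
          also have "\<dots> = ennreal C * X"
          proof -
            have "ennreal t * ennreal (1 / t) = 1" using t by (subst ennreal_mult[symmetric]) auto
            moreover have "ennreal t * (ennreal C * (ennreal (1 / t) * X)) = (ennreal t * ennreal (1 / t)) * (ennreal C * X)"
              by (simp only: mult_ac)
            ultimately show ?thesis by simp
          qed
          finally show "ennreal t * emeasure ?M {x \<in> space ?M. maximal ?fv x / ennreal (v x) > ennreal t} \<le> ennreal C * X" .
        qed
      qed
    qed
  qed
  then obtain c where "P a k (c a k)" for a k by metis
  then show ?thesis unfolding P_def by (intro exI[of _ c]) blast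
qed

end
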